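(* Let $n\ge 3$ and let $M(\mathcal{O},\rho)$ be the irreducible Yetter-Drinfeld module over $\mathbb{C}\mathbb{D}_n$ corresponding to a pair $(\mathcal{O},\rho)$. Assume that its Nichols algebra $\mathfrak{B}(\mathcal{O},\rho)$ is finite-dimensional. (a) If $n$ is odd, then $(\mathcal{O},\rho)=(\mathcal{O}_x,\operatorname{sgn})$, where $\operatorname{sgn}$ is the non-trivial character of $\mathbb{D}_n^x=\langle x\rangle\simeq\mathbb{Z}_2$. (b) If $n=2m$ is even, then $(\mathcal{O},\rho)$ is one of the following: (i) $(\mathcal{O}_{y^m},\rho)$, where $\rho$ is an irreducible representation of $\mathbb{D}_n$ with $\rho(y^m)=-1$ (i.e. $-\mathrm{Id}$). (ii) $(\mathcal{O}_{y^h},\chi^j)$, where $1\le h\le n-1$, $h\ne m$ and $\omega^{hj}=-1$. (iii) $(\mathcal{O}_x,\operatorname{sgn}\otimes\operatorname{sgn})$ or $(\mathcal{O}_x,\operatorname{sgn}\otimes\varepsilon)$, where $\operatorname{sgn}\otimes\operatorname{sgn}$, $\operatorname{sgn}\otimes\varepsilon$ are characters of $\mathbb{D}_n^x=\langle x\rangle\oplus\langle y^m\rangle\simeq\mathbb{Z}_2\times\mathbb{Z}_2$. (iv) $(\mathcal{O}_{xy},\operatorname{sgn}\otimes\operatorname{sgn})$ or $(\mathcal{O}_{xy},\operatorname{sgn}\otimes\varepsilon)$, where $\operatorname{sgn}\otimes\operatorname{sgn}$, $\operatorname{sgn}\otimes\varepsilon$ are characters of $\mathbb{D}_n^{xy}=\langle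 xy\rangle\oplus\langle y^m\rangle\simeq\mathbb{Z}_2\times\mathbb{Z}_2$. Moreover, in the cases (i) and (ii) the Nichols algebra $\mathfrak{B}(\mathcal{O},\rho)$ is indeed finite-dimensional, and in the cases (iii) and (iv) the braiding of $M(\mathcal{O},\rho)$ is negative.
   Context: $\mathbb{D}_n$ is the dihedral group of order $2n$, generated by $x,y$ with relations $x^2=e=y^n$, $xyx=y^{-1}$. $\omega$ is a primitive $n$-th root of $1$ in $\mathbb{C}$ and $\chi$ is the character of $\langle y\rangle$ with $\chi(y)=\omega$; for $1\le h\le n-1$ with $y^h\neq y^{-h}$ the centralizer of $y^h$ is $\langle y\rangle$. For $s\in\mathbb{D}_n$, $\mathcal{O}_s$ is its conjugacy class and $\mathbb{D}_n^s$ its centralizer. $\varepsilon$ and $\operatorname{sgn}$ denote the trivial and non-trivial characters of $\mathbb{Z}_2$; in tensor products the first factor refers to $\langle x\rangle$ (resp. $\langle xy\rangle$) and the second to $\langle y^m\rangle$. Let $G$ be a finite group, $s\in G$, $\mathcal{O}$ the conjugacy class of $s$ in $G$, $G^s$ the centralizer of $s$, and $\rho:G^s\to GL(V)$ an irreducible complex representation. List $\mathcal{O}=\{t_1=s,\dots,t_M\}$ and choose $g_i\in G$ with $g_isg_i^{-1}=t_i$. The irreducible Yetter-Drinfeld module $M(\mathcal{O},\rho)=\bigoplus_{i=1}^M g_i\otimes V$ over $\mathbb{C}G$ has, writing $g_iv:=g_i\otimes v$, coaction $\delta(g_iv)=t_i\otimes g_iv$ and action $g\cdot(g_iv)=g_j(\gamma\cdot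 v)$, where $gg_i=g_j\gamma$ with $\gamma\in G^s$. It is a braided vector space with braiding $c(g_iv\otimes g_jw)=t_i\cdot(g_jw)\otimes g_iv$. $\mathfrak{B}(\mathcal{O},\rho)$ denotes the Nichols algebra of this braided vector space. A pair $(\mathcal{O},\rho)$ is specified by the class of a representative $s$ and an irreducible representation (up to isomorphism) of $G^s$. Negative braiding (for $\rho$ one-dimensional, $V=\mathbb{C}v$): whenever $t_j,t_k\in\mathcal{O}$ commute, one has $c(g_av\otimes g_bv)=q_{ab}\,g_bv\otimes g_av$ for $a,b\in\{j,k\}$ with scalars satisfying $q_{jj}=q_{kk}=-1$ and, if $j\neq k$, $q_{jk}q_{kj}=1$. *)

theory Defs
  imports
    "HOL-Algebra.Embedded_Algebras"
    "HOL-Algebra.Elementary_Groups"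
    "HOL-Algebra.Generated_Groups"
    "HOL-Combinatorics.Permutations"
    "Jordan_Normal_Form.Matrix"
begin

hide_const (open) Multiset.mult

section \<open>Nichols algebras of finite-dimensional braided vector spaces\<close>

text \<open>
  A braided vector space with basis \<open>X\<close> is given by the structure constants of its braiding:
  \<open>c (e\<^sub>p \<otimes> e\<^sub>q) = (\<Sum>(p', q') \<in> X \<times> X. C p q (p', q') \<cdot> (e\<^sub>p\<^sub>' \<otimes> e\<^sub>q\<^sub>'))\<close>.
  The tensor algebra is then the free associative algebra on \<open>X\<close>; its elements are stored as
  finitely supported coefficient functions on words over \<open>X\<close>.
\<close>

type_synonym 'x braiding = "'x \<Rightarrow> 'x \<Rightarrow> 'x \<times> 'x \<Rightarrow> complex"

definition tensor_algebra :: "'x set \<Rightarrow> ('x list \<Rightarrow> complex) ring" where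
  "tensor_algebra X =
     \<lparr> carrier = {f. finite {w. f w \<noteq> 0} \<and> {w. f w \<noteq> 0} \<subseteq> lists X},
       mult = (\<lambda>f h w. \<Sum>i\<le>length w. f (take i w) * h (drop i w)),
       one = (\<lambda>w. if w = [] then 1 else 0),
       zero = (\<lambda>w. 0),
       add = (\<lambda>f h w. f w + h w) \<rparr>"

text \<open>
  The operator \<open>id\<^sup>i \<otimes> c \<otimes> id\<close> acting on the tensor factors \<open>i\<close> and \<open>i + 1\<close> (counted from 0).
  It is used on tensors of length greater than \<open>i + 1\<close> only.
\<close>

definition braid_at :: "'x set \<Rightarrow> 'x braiding \<Rightarrow> nat \<Rightarrow> ('x list \<Rightarrow> complex) \<Rightarrow> 'x list \<Rightarrow> complex"
  where "braid_at X C i f w =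
     (\<Sum>(p, q) \<in> X \<times> X. C p q (w ! i, w ! Suc i) * f (w[i := p, Suc i := q]))"

definition word_perm :: "nat list \<Rightarrow> nat \<Rightarrow> nat" where
  "word_perm is = foldr (\<lambda>i \<sigma>. transpose i (Suc i) \<circ> \<sigma>) is id"

definition reduced_word :: "nat \<Rightarrow> (nat \<Rightarrow> nat) \<Rightarrow> nat list \<Rightarrow> bool" where
  "reduced_word m \<sigma> is \<longleftrightarrow>
     set is \<subseteq> {i. Suc i < m} \<and> word_perm is = \<sigma> \<and>
     (\<forall>js. set js \<subseteq> {i. Suc i < m} \<and> word_perm js = \<sigma> \<longrightarrow> length is \<le> length js)"

text \<open>
  The image of \<open>\<sigma>\<close> under the Matsumoto section of the projection from the braid group onto the
  symmetric group on \<open>m\<close> letters, acting on the \<open>m\<close>-th tensor power. By Matsumoto's theorem and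
  the braid equation it does not depend on the reduced word that is chosen.
\<close>

definition matsumoto_lift ::
    "'x set \<Rightarrow> 'x braiding \<Rightarrow> nat \<Rightarrow> (nat \<Rightarrow> nat) \<Rightarrow> ('x list \<Rightarrow> complex) \<Rightarrow> 'x list \<Rightarrow> complex"
  where "matsumoto_lift X C m \<sigma> = foldr (braid_at X C) (SOME is. reduced_word m \<sigma> is)"

text \<open>
  The sum over all \<open>m\<close> of the quantum symmetrizers; the one of degree \<open>m\<close> determines the
  coefficients of the words of length \<open>m\<close>.
\<close>

definition quantum_symmetrizer ::
    "'x set \<Rightarrow> 'x braiding \<Rightarrow> ('x list \<Rightarrow> complex) \<Rightarrow> 'x list \<Rightarrow> complex"
  where "quantum_symmetrizer X C f w =
     (\<Sum>\<sigma> | \<sigma> permutes {..<length w}. matsumoto_lift X C (length w) \<sigma> f w)"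

definition nichols_ideal :: "'x set \<Rightarrow> 'x braiding \<Rightarrow> ('x list \<Rightarrow> complex) set" where
  "nichols_ideal X C =
     {f \<in> carrier (tensor_algebra X). quantum_symmetrizer X C f = (\<lambda>w. 0)}"

definition nichols_algebra :: "'x set \<Rightarrow> 'x braiding \<Rightarrow> ('x list \<Rightarrow> complex) set ring" where
  "nichols_algebra X C = tensor_algebra X Quot nichols_ideal X C"

definition nichols_scalars :: "'x set \<Rightarrow> 'x braiding \<Rightarrow> ('x list \<Rightarrow> complex) set set" where
  "nichols_scalars X C =
     {nichols_ideal X C +>\<^bsub>tensor_algebra X\<^esub> (\<lambda>w. if w = [] then a else 0) | a. True}"

definition finite_dim_nichols :: "'x set \<Rightarrow> 'x braiding \<Rightarrow> bool" where
  "finite_dim_nichols X C \<longleftrightarrow>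
     ring.finite_dimension (nichols_algebra X C) (nichols_scalars X C)
       (carrier (nichols_algebra X C))"


section \<open>Irreducible Yetter-Drinfeld modules over group algebras\<close>

definition centralizer :: "('g, 'b) monoid_scheme \<Rightarrow> 'g \<Rightarrow> 'g set" where
  "centralizer G s = {h \<in> carrier G. h \<otimes>\<^bsub>G\<^esub> s = s \<otimes>\<^bsub>G\<^esub> h}"

definition conj_class :: "('g, 'b) monoid_scheme \<Rightarrow> 'g \<Rightarrow> 'g set" where
  "conj_class G s = {h \<otimes>\<^bsub>G\<^esub> s \<otimes>\<^bsub>G\<^esub> inv\<^bsub>G\<^esub> h | h. h \<in> carrier G}"

abbreviation complex_ring :: "complex ring" where
  "complex_ring \<equiv> \<lparr> carrier = UNIV, mult = (*), one = 1, zero = 0, add = (+) \<rparr>"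

text \<open>
  Representations of the subgroup \<open>H\<close> of \<open>G\<close> on \<open>\<complex>\<^sup>d\<close>. Only the values of \<open>\<rho>\<close> on \<open>H\<close> matter.
\<close>

definition representation ::
    "('g, 'b) monoid_scheme \<Rightarrow> 'g set \<Rightarrow> nat \<Rightarrow> ('g \<Rightarrow> complex mat) \<Rightarrow> bool"
  where "representation G H d \<rho> \<longleftrightarrow>
     \<rho> \<in> hom (G\<lparr>carrier := H\<rparr>) (units_of (ring_mat TYPE(complex) d ()))"

definition irreducible_rep ::
    "('g, 'b) monoid_scheme \<Rightarrow> 'g set \<Rightarrow> nat \<Rightarrow> ('g \<Rightarrow> complex mat) \<Rightarrow> bool"
  where "irreducible_rep G H d \<rho> \<longleftrightarrow>
     representation G H d \<rho> \<and> d > 0 \<and>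
     (\<forall>W. submodule W complex_ring (module_vec TYPE(complex) d) \<and>
          (\<forall>h\<in>H. \<forall>v\<in>W. \<rho> h *\<^sub>v v \<in> W) \<longrightarrow>
          W = {0\<^sub>v d} \<or> W = carrier_vec d)"

definition characters :: "('g, 'b) monoid_scheme \<Rightarrow> 'g set \<Rightarrow> ('g \<Rightarrow> complex) set" where
  "characters G H = hom (G\<lparr>carrier := H\<rparr>) (units_of complex_ring)"

definition char_rep :: "('g \<Rightarrow> complex) \<Rightarrow> 'g \<Rightarrow> complex mat" where
  "char_rep \<phi> h = mat 1 1 (\<lambda>_. \<phi> h)"

text \<open>
  Equality of the pairs (class of \<open>s\<close>, \<open>\<rho>\<close>) and (class of \<open>s'\<close>, \<open>\<rho>'\<close>), where \<open>\<rho>\<close> and \<open>\<rho>'\<close> are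
  representations of the centralizers of \<open>s\<close> and \<open>s'\<close> up to isomorphism. When the
  representative is changed from \<open>s\<close> to \<open>s' = k s k\<^sup>-\<^sup>1\<close>, the representation is transported along
  conjugation by \<open>k\<close>.
\<close>

definition same_pair ::
    "('g, 'b) monoid_scheme \<Rightarrow> nat \<Rightarrow> 'g \<Rightarrow> ('g \<Rightarrow> complex mat) \<Rightarrow>
      nat \<Rightarrow> 'g \<Rightarrow> ('g \<Rightarrow> complex mat) \<Rightarrow> bool"
  where "same_pair G d s \<rho> d' s' \<rho>' \<longleftrightarrow>
     d = d' \<and>
     (\<exists>k \<in> carrier G. k \<otimes>\<^bsub>G\<^esub> s \<otimes>\<^bsub>G\<^esub> inv\<^bsub>G\<^esub> k = s' \<and>
       (\<exists>P \<in> Units (ring_mat TYPE(complex) d ()).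
         \<forall>h \<in> centralizer G s. P * \<rho> h = \<rho>' (k \<otimes>\<^bsub>G\<^esub> h \<otimes>\<^bsub>G\<^esub> inv\<^bsub>G\<^esub> k) * P))"

text \<open>The family \<open>g\<close> of the elements \<open>g\<^sub>i\<close>, indexed by the elements \<open>t\<^sub>i\<close> of the class of \<open>s\<close>.\<close>

definition class_section :: "('g, 'b) monoid_scheme \<Rightarrow> 'g \<Rightarrow> ('g \<Rightarrow> 'g) \<Rightarrow> bool" where
  "class_section G s g \<longleftrightarrow>
     (\<forall>t \<in> conj_class G s. g t \<in> carrier G \<and> g t \<otimes>\<^bsub>G\<^esub> s \<otimes>\<^bsub>G\<^esub> inv\<^bsub>G\<^esub> (g t) = t)"

text \<open>
  The basis element \<open>(t, a)\<close> of the Yetter-Drinfeld module stands for \<open>g\<^sub>t \<otimes> e\<^sub>a\<close>, where \<open>e\<^sub>a\<close> is the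
  \<open>a\<close>-th standard basis vector (from 0) of the space \<open>\<complex>\<^sup>d\<close> on which \<open>\<rho>\<close> acts; its coaction is
  \<open>\<delta> (t, a) = t \<otimes> (t, a)\<close>.
\<close>

definition yd_basis :: "('g, 'b) monoid_scheme \<Rightarrow> nat \<Rightarrow> 'g \<Rightarrow> ('g \<times> nat) set" where
  "yd_basis G d s = conj_class G s \<times> {..<d}"

text \<open>
  \<open>yd_action G d \<rho> g h p q\<close> is the coefficient of the basis element \<open>q\<close> in \<open>h \<cdot> p\<close>: the group
  element \<open>h g\<^sub>t\<close> is \<open>g\<^sub>u \<gamma>\<close> with \<open>u = h t h\<^sup>-\<^sup>1\<close> and \<open>\<gamma> = g\<^sub>u\<^sup>-\<^sup>1 h g\<^sub>t\<close> in the centralizer.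
\<close>

definition yd_action ::
    "('g, 'b) monoid_scheme \<Rightarrow> nat \<Rightarrow> ('g \<Rightarrow> complex mat) \<Rightarrow> ('g \<Rightarrow> 'g) \<Rightarrow>
      'g \<Rightarrow> 'g \<times> nat \<Rightarrow> 'g \<times> nat \<Rightarrow> complex"
  where "yd_action G d \<rho> g h = (\<lambda>(t, a) (u, b).
     if u = h \<otimes>\<^bsub>G\<^esub> t \<otimes>\<^bsub>G\<^esub> inv\<^bsub>G\<^esub> h \<and> b < d
     then \<rho> (inv\<^bsub>G\<^esub> (g u) \<otimes>\<^bsub>G\<^esub> h \<otimes>\<^bsub>G\<^esub> g t) $$ (b, a)
     else 0)"

text \<open>\<open>c (p \<otimes> q) = (t \<cdot> q) \<otimes> p\<close>, where \<open>t = fst p\<close> is the degree of \<open>p\<close>.\<close>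

definition yd_braiding ::
    "('g, 'b) monoid_scheme \<Rightarrow> nat \<Rightarrow> ('g \<Rightarrow> complex mat) \<Rightarrow> ('g \<Rightarrow> 'g) \<Rightarrow> ('g \<times> nat) braiding"
  where "yd_braiding G d \<rho> g p q =
     (\<lambda>(q', p'). if p' = p then yd_action G d \<rho> g (fst p) q q' else 0)"

definition yd_finite_dim_nichols ::
    "('g, 'b) monoid_scheme \<Rightarrow> nat \<Rightarrow> 'g \<Rightarrow> ('g \<Rightarrow> complex mat) \<Rightarrow> ('g \<Rightarrow> 'g) \<Rightarrow> bool"
  where "yd_finite_dim_nichols G d s \<rho> g \<longleftrightarrow>
     finite_dim_nichols (yd_basis G d s) (yd_braiding G d \<rho> g)"

text \<open>For \<open>d = 1\<close> the basis element \<open>(t, 0)\<close> is \<open>g\<^sub>t v\<close> with \<open>v = e\<^sub>0\<close>.\<close>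

definition negative_braiding ::
    "('g, 'b) monoid_scheme \<Rightarrow> nat \<Rightarrow> 'g \<Rightarrow> ('g \<Rightarrow> complex mat) \<Rightarrow> ('g \<Rightarrow> 'g) \<Rightarrow> bool"
  where "negative_braiding G d s \<rho> g \<longleftrightarrow>
     d = 1 \<and>
     (\<forall>t \<in> conj_class G s. \<forall>u \<in> conj_class G s. t \<otimes>\<^bsub>G\<^esub> u = u \<otimes>\<^bsub>G\<^esub> t \<longrightarrow>
       (\<exists>q :: 'g \<Rightarrow> 'g \<Rightarrow> complex.
         (\<forall>a \<in> {t, u}. \<forall>b \<in> {t, u}. \<forall>r \<in> yd_basis G d s \<times> yd_basis G d s.
            yd_braiding G d \<rho> g (a, 0) (b, 0) r = (if r = ((b, 0), (a, 0)) then q a b else 0)) \<and>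
         q t t = -1 \<and> q u u = -1 \<and> (t \<noteq> u \<longrightarrow> q t u * q u t = 1)))"


section \<open>Dihedral groups\<close>

text \<open>
  Any group of order \<open>2 n\<close> with generators satisfying the defining relations is the dihedral group.
\<close>

definition dihedral_group :: "nat \<Rightarrow> ('g, 'b) monoid_scheme \<Rightarrow> 'g \<Rightarrow> 'g \<Rightarrow> bool" where
  "dihedral_group n G x y \<longleftrightarrow>
     group G \<and> order G = 2 * n \<and> x \<in> carrier G \<and> y \<in> carrier G \<and>
     generate G {x, y} = carrier G \<and>
     x [^]\<^bsub>G\<^esub> (2::nat) = \<one>\<^bsub>G\<^esub> \<and> y [^]\<^bsub>G\<^esub> n = \<one>\<^bsub>G\<^esub> \<and> x \<otimes>\<^bsub>G\<^esub> y \<otimes>\<^bsub>G\<^esub> x = inv\<^bsub>G\<^esub> y"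

definition primitive_root_of_unity :: "nat \<Rightarrow> complex \<Rightarrow> bool" where
  "primitive_root_of_unity n \<omega> \<longleftrightarrow> \<omega> ^ n = 1 \<and> (\<forall>k. 0 < k \<and> k < n \<longrightarrow> \<omega> ^ k \<noteq> 1)"

text \<open>The two characters of a cyclic group of order 2, as functions of the exponent of its generator.\<close>

definition Z2_triv :: "nat \<Rightarrow> complex" where
  "Z2_triv i = 1"

definition Z2_sgn :: "nat \<Rightarrow> complex" where
  "Z2_sgn i = (-1) ^ i"

text \<open>
  \<open>\<phi>\<close> is the character \<open>\<alpha> \<otimes> \<beta>\<close> of the subgroup \<open>H\<close>, the direct sum of the subgroups of order 2
  generated by \<open>a\<close> and by \<open>z\<close>.
\<close>

definition tensor_character ::
    "('g, 'b) monoid_scheme \<Rightarrow> 'g set \<Rightarrow> 'g \<Rightarrow> 'g \<Rightarrow> (nat \<Rightarrow> complex) \<Rightarrow> (nat \<Rightarrow> complex) \<Rightarrow>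
      ('g \<Rightarrow> complex) \<Rightarrow> bool"
  where "tensor_character G H a z \<alpha> \<beta> \<phi> \<longleftrightarrow>
     \<phi> \<in> characters G H \<and>
     (\<forall>i k :: nat. \<phi> (a [^]\<^bsub>G\<^esub> i \<otimes>\<^bsub>G\<^esub> z [^]\<^bsub>G\<^esub> k) = \<alpha> i * \<beta> k)"

definition klein_direct_sum :: "('g, 'b) monoid_scheme \<Rightarrow> 'g set \<Rightarrow> 'g \<Rightarrow> 'g \<Rightarrow> bool" where
  "klein_direct_sum G H a z \<longleftrightarrow>
     H = generate G {a} <#>\<^bsub>G\<^esub> generate G {z} \<and>
     generate G {a} \<inter> generate G {z} = {\<one>\<^bsub>G\<^esub>} \<and>
     G\<lparr>carrier := H\<rparr> \<cong> integer_mod_group 2 \<times>\<times> integer_mod_group 2"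

definition sgn_pair ::
    "('g, 'b) monoid_scheme \<Rightarrow> 'g \<Rightarrow> nat \<Rightarrow> 'g \<Rightarrow> ('g \<Rightarrow> complex mat) \<Rightarrow> bool"
  where "sgn_pair G x d s \<rho> \<longleftrightarrow>
     (\<exists>\<phi> \<in> characters G (centralizer G x).
        (\<exists>h \<in> centralizer G x. \<phi> h \<noteq> 1) \<and> same_pair G d s \<rho> 1 x (char_rep \<phi>))"

definition central_pair ::
    "('g, 'b) monoid_scheme \<Rightarrow> 'g \<Rightarrow> nat \<Rightarrow> nat \<Rightarrow> 'g \<Rightarrow> ('g \<Rightarrow> complex mat) \<Rightarrow> bool"
  where "central_pair G y m d s \<rho> \<longleftrightarrow>
     (\<exists>\<rho>'. irreducible_rep G (carrier G) d \<rho>' \<and> \<rho>' (y [^]\<^bsub>G\<^esub> m) = - 1\<^sub>m d \<and>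
        same_pair G d s \<rho> d (y [^]\<^bsub>G\<^esub> m) \<rho>')"

definition rotation_pair ::
    "('g, 'b) monoid_scheme \<Rightarrow> 'g \<Rightarrow> nat \<Rightarrow> nat \<Rightarrow> complex \<Rightarrow> ('g \<Rightarrow> complex) \<Rightarrow>
      nat \<Rightarrow> 'g \<Rightarrow> ('g \<Rightarrow> complex mat) \<Rightarrow> bool"
  where "rotation_pair G y n m \<omega> \<chi> d s \<rho> \<longleftrightarrow>
     (\<exists>h j :: nat. 1 \<le> h \<and> h \<le> n - 1 \<and> h \<noteq> m \<and> \<omega> ^ (h * j) = -1 \<and>
        same_pair G d s \<rho> 1 (y [^]\<^bsub>G\<^esub> h) (char_rep (\<lambda>k. \<chi> k ^ j)))"

definition reflection_pair ::
    "('g, 'b) monoid_scheme \<Rightarrow> 'g \<Rightarrow> 'g \<Rightarrow> nat \<Rightarrow> 'g \<Rightarrow> ('g \<Rightarrow> complex mat) \<Rightarrow> bool"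
  where "reflection_pair G a z d s \<rho> \<longleftrightarrow>
     (\<exists>\<phi>. (tensor_character G (centralizer G a) a z Z2_sgn Z2_sgn \<phi> \<or>
           tensor_character G (centralizer G a) a z Z2_sgn Z2_triv \<phi>) \<and>
        same_pair G d s \<rho> 1 a (char_rep \<phi>))"

end

theory Submission
  imports Defs "Jordan_Normal_Form.Char_Poly"
    "HOL-Computational_Algebra.Fundamental_Theorem_Algebra"
begin

text \<open>
  By Matsumoto's theorem the quantum symmetrizer factors through the symmetrizers of smaller
  degree, so that its kernel is an ideal and the Nichols algebra is finite-dimensional if and only
  if the symmetrizers vanish in all large degrees. Every element \<open>s\<close> of a dihedral group is
  conjugate to its inverse, and \<open>\<rho> s\<close> is a scalar \<open>q\<close> by Schur's lemma. If \<open>q = 1\<close>, the powers of a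
  basis vector in degree \<open>s\<close> survive. If \<open>s\<close> is a non-central rotation, the braiding is diagonal of
  rank two with \<open>q\<^sub>1\<^sub>1 = q\<^sub>2\<^sub>2 = q\<close> and \<open>q\<^sub>1\<^sub>2 = q\<^sub>2\<^sub>1 = q\<^sup>-\<^sup>1\<close>, that is, of affine Cartan type; for \<open>q\<^sup>2 \<noteq> 1\<close> skew
  derivations show that all the powers of the imaginary root vector \<open>x\<^sub>1 x\<^sub>2 - q\<^sup>-\<^sup>1 x\<^sub>2 x\<^sub>1\<close> survive. Hence
  \<open>q = -1\<close>. For a rotation \<open>s\<close> the braiding is then the negative of the flip, and the Nichols algebra
  is an exterior algebra.
\<close>

subsection \<open>Reduced words in the symmetric groups\<close>

text \<open>The Matsumoto section is defined by an arbitrary choice of reduced words, so nothing can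
  be computed before word independence is available; afterwards the words are adapted to the cosets
  of a point stabilizer. Off the centre the centralizer of \<open>s\<close> is abelian, so
  \<open>d = 1\<close> and the braiding permutes basis tensors up to scalars; for central
  \<open>s\<close> the class is a point and the braiding is a multiple of the flip for every
  \<open>d\<close>. These two situations cover all pairs. In the rotation case the root vector
  \<open>z\<close> commutes with itself under the braiding, because the four braiding scalars
  multiply to 1, and so it behaves like a polynomial variable: deriving along \<open>p\<close> and
  then along \<open>r\<close> sends \<open>z^(k+1)\<close> to \<open>(1 - q^-2) (k+1) z^k\<close>.
  This is where \<open>q^2 \<noteq> 1\<close> and characteristic 0 enter. Reflections need no root
  vector: \<open>s^2 = 1\<close> leaves only \<open>q = 1\<close> and \<open>q = -1\<close>.\<close>

lemma word_perm_Nil [simp]: "word_perm [] = id"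
  and word_perm_Cons [simp]: "word_perm (i # is) = transpose i (Suc i) \<circ> word_perm is"
  by (simp_all add: word_perm_def)

lemma word_perm_append: "word_perm (is @ js) = word_perm is \<circ> word_perm js"
  by (induction "is") (simp_all add: comp_assoc)

lemma word_perm_permutes:
  "set is \<subseteq> {i. Suc i < m} \<Longrightarrow> word_perm is permutes {..<m}"
  by (induction "is") (auto intro!: permutes_compose permutes_swap_id simp: permutes_id)

lemma bij_word_perm: "bij (word_perm is)"
proof (induction "is")
  case Nil
  show "bij (word_perm [])" by simp
next
  case (Cons i "is")
  then show "bij (word_perm (i # is))"
    by (simp only: word_perm_Cons) (rule bij_comp, simp_all)
qed

lemma word_perm_rev: "word_perm (rev is) = inv_into UNIV (word_perm is)"
proof (rule inv_unique_comp[symmetric])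
  show "word_perm is \<circ> word_perm (rev is) = id"
  proof (induction "is")
    case Nil
    show "word_perm [] \<circ> word_perm (rev []) = id" by simp
  next
    case (Cons i "is")
    have "word_perm (i # is) \<circ> word_perm (rev (i # is)) =
        transpose i (Suc i) \<circ> (word_perm is \<circ> word_perm (rev is)) \<circ> transpose i (Suc i)"
      by (simp add: word_perm_append comp_assoc)
    also have "\<dots> = id" by (simp only: Cons comp_id transpose_comp_involutory)
    finally show "word_perm (i # is) \<circ> word_perm (rev (i # is)) = id" .
  qed
  show "word_perm (rev is) \<circ> word_perm is = id"
  proof (induction "is")
    case Nil
    show "word_perm (rev []) \<circ> word_perm [] = id" by simp
  next
    case (Cons i "is")
    have "word_perm (rev (i # is)) \<circ> word_perm (i # is) =
        word_perm (rev is) \<circ> (transpose i (Suc i) \<circ> transpose i (Suc i)) \<circ> word_perm is"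
      by (simp only: rev.simps word_perm_append word_perm_Cons word_perm_Nil comp_id comp_assoc)
    also have "\<dots> = id" by (simp only: Cons comp_id transpose_comp_involutory)
    finally show "word_perm (rev (i # is)) \<circ> word_perm (i # is) = id" .
  qed
qed

section \<open>Length as the number of inversions\<close>

definition inversions :: "(nat \<Rightarrow> nat) \<Rightarrow> (nat \<times> nat) set" where
  "inversions \<sigma> = {(a, b). a < b \<and> \<sigma> b < \<sigma> a}"

lemma inversions_id: "inversions id = {}"
  by (auto simp: inversions_def)

lemma finite_inversions:
  assumes "\<sigma> permutes {..<m}"
  shows "finite (inversions \<sigma>)"
proof -
  have "a < m \<and> b < m" if "a < b" "\<sigma> b < \<sigma> a" for a b
  proof -
    have *: "\<sigma> k < m \<longleftrightarrow> k < m" for k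
      using permutes_in_image[OF assms, of k] by simp
    have **: "\<sigma> k = k" if "\<not> k < m" for k
      using permutes_not_in[OF assms, of k] that by simp
    show ?thesis using that *[of a] *[of b] **[of a] **[of b] by fastforce
  qed
  then have "inversions \<sigma> \<subseteq> {..<m} \<times> {..<m}"
    by (auto simp: inversions_def)
  then show ?thesis by (rule finite_subset) simp
qed

lemma transpose_Suc_less:
  "a < b \<Longrightarrow> (a, b) \<noteq> (i, Suc i) \<Longrightarrow> transpose i (Suc i) a < transpose i (Suc i) b"
  by (auto simp: transpose_def)

text \<open>An adjacent transposition keeps the order of every pair except
  \<open>(i, Suc i)\<close>, so relabelling carries old inversions to new ones and only that pair is
  added.\<close>

lemma inversions_transpose:
  assumes "\<sigma> i < \<sigma> (Suc i)"
  shows "inversions (\<sigma> \<circ> transpose i (Suc i)) =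
     insert (i, Suc i) (map_prod (transpose i (Suc i)) (transpose i (Suc i)) ` inversions \<sigma>)"
    (is "?L = insert _ (map_prod ?s ?s ` _)")
proof (intro Set.set_eqI iffI)
  fix x assume x: "x \<in> ?L"
  obtain a b where ab: "x = (a, b)" by (cases x)
  show "x \<in> insert (i, Suc i) (map_prod ?s ?s ` inversions \<sigma>)"
  proof (cases "(a, b) = (i, Suc i)")
    case False
    then have "(?s a, ?s b) \<in> inversions \<sigma>"
      using x ab transpose_Suc_less[of a b i] by (auto simp: inversions_def)
    then have "map_prod ?s ?s (?s a, ?s b) \<in> map_prod ?s ?s ` inversions \<sigma>" by (rule imageI)
    with ab show ?thesis by simp
  qed (simp add: ab)
next
  fix x assume x: "x \<in> insert (i, Suc i) (map_prod ?s ?s ` inversions \<sigma>)"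
  show "x \<in> ?L"
  proof (cases "x = (i, Suc i)")
    case True with assms show ?thesis by (simp add: inversions_def)
  next
    case False
    with x obtain a b where ab: "x = (?s a, ?s b)" "(a, b) \<in> inversions \<sigma>" by auto
    then have "(a, b) \<noteq> (i, Suc i)" using assms by (auto simp: inversions_def)
    with ab show ?thesis
      using transpose_Suc_less[of a b i] by (auto simp: inversions_def)
  qed
qed

lemma card_inversions_transpose:
  assumes "finite (inversions \<sigma>)" "\<sigma> i < \<sigma> (Suc i)"
  shows "card (inversions (\<sigma> \<circ> transpose i (Suc i))) = Suc (card (inversions \<sigma>))"
proof -
  let ?s = "transpose i (Suc i)"
  have "(i, Suc i) \<notin> map_prod ?s ?s ` inversions \<sigma>"
  proof
    assume "(i, Suc i) \<in> map_prod ?s ?s ` inversions \<sigma>"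
    then obtain a b where "(a, b) \<in> inversions \<sigma>" "?s a = i" "?s b = Suc i" by auto
    moreover from this have "a = ?s i" "b = ?s (Suc i)"
      by (metis transpose_involutory)+
    ultimately show False by (simp add: inversions_def)
  qed
  moreover have "inj_on (map_prod ?s ?s) (inversions \<sigma>)"
    by (rule inj_on_inverseI[where g = "map_prod ?s ?s"]) (auto split: prod.splits)
  ultimately show ?thesis
    using assms by (simp add: inversions_transpose card_image)
qed

text \<open>Unlike \<open>reduced_word\<close>, this involves neither a bound \<open>m\<close> nor a
  minimum over words, and it can be checked letter by letter with \<open>red_snoc\<close>.\<close>

definition red :: "nat list \<Rightarrow> bool" where
  "red is \<longleftrightarrow> card (inversions (word_perm is)) = length is"

lemma finite_inversions_word_perm: "finite (inversions (word_perm is))"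
proof -
  have "set is \<subseteq> {i. Suc i < Suc (Suc (Max (set is)))}"
    by (auto simp: less_Suc_eq_le)
  then show ?thesis
    using finite_inversions word_perm_permutes by blast
qed

lemma inj_word_perm: "word_perm is a = word_perm is b \<longleftrightarrow> a = b"
  using bij_word_perm[of "is"] by (metis bij_def injD)

text \<open>A descent at \<open>i\<close> becomes an ascent after appending \<open>i\<close>, so the
  second case is the first one applied to the extended word.\<close>

lemma card_inversions_snoc:
  "word_perm is i < word_perm is (Suc i) \<Longrightarrow>
     card (inversions (word_perm (is @ [i]))) = Suc (card (inversions (word_perm is)))"
  "\<not> word_perm is i < word_perm is (Suc i) \<Longrightarrow>
     card (inversions (word_perm is)) = Suc (card (inversions (word_perm (is @ [i]))))"
proof -
  show "word_perm is i < word_perm is (Suc i) \<Longrightarrow>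
     card (inversions (word_perm (is @ [i]))) = Suc (card (inversions (word_perm is)))"
    using card_inversions_transpose[OF finite_inversions_word_perm] by (simp add: word_perm_append)
  assume "\<not> word_perm is i < word_perm is (Suc i)"
  then have "word_perm (is @ [i]) i < word_perm (is @ [i]) (Suc i)"
    using inj_word_perm[of "is" i "Suc i"] by (simp add: word_perm_append)
  note card_inversions_transpose[OF finite_inversions_word_perm this]
  moreover have "word_perm (is @ [i]) \<circ> transpose i (Suc i) = word_perm is"
    by (simp add: word_perm_append comp_assoc)
  ultimately show "card (inversions (word_perm is)) = Suc (card (inversions (word_perm (is @ [i]))))"
    by (simp only:)
qed

lemma card_inversions_le: "card (inversions (word_perm is)) \<le> length is"
proof (induction "is" rule: rev_induct)
  case Nil
  show ?case by (simp only: word_perm_Nil inversions_id) simp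
next
  case (snoc i "is")
  then show ?case
    using card_inversions_snoc[of "is" i] by (cases "word_perm is i < word_perm is (Suc i)") auto
qed

lemma red_Nil [simp]: "red []"
  using card_inversions_le[of "[]"] by (simp add: red_def)

text \<open>Each letter changes the number of inversions by exactly one, upwards at an ascent. As
  the number never exceeds the length, a reduced word can contain no downward step.\<close>

lemma red_snoc: "red (is @ [i]) \<longleftrightarrow> red is \<and> word_perm is i < word_perm is (Suc i)"
  using card_inversions_snoc[of "is" i] card_inversions_le[of "is"]
  by (cases "word_perm is i < word_perm is (Suc i)") (auto simp: red_def)

lemma red_snoc': "word_perm is = \<sigma> \<Longrightarrow> red is \<Longrightarrow> \<sigma> i < \<sigma> (Suc i) \<Longrightarrow> red (is @ [i])"
  by (simp add: red_snoc)

lemma card_inversions_inv: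
  assumes "bij \<sigma>"
  shows "card (inversions (inv_into UNIV \<sigma>)) = card (inversions \<sigma>)"
proof -
  have *: "inv_into UNIV \<sigma> (\<sigma> a) = a" "\<sigma> (inv_into UNIV \<sigma> a) = a" for a
    using assms by (simp_all add: bij_is_inj bij_is_surj surj_f_inv_f)
  have "bij_betw (\<lambda>(a, b). (\<sigma> b, \<sigma> a)) (inversions \<sigma>) (inversions (inv_into UNIV \<sigma>))"
    by (rule bij_betw_byWitness[where f' = "\<lambda>(a, b). (inv_into UNIV \<sigma> b, inv_into UNIV \<sigma> a)"])
       (auto simp: * inversions_def)
  then show ?thesis by (simp add: bij_betw_same_card)
qed

lemma red_rev: "red (rev is) \<longleftrightarrow> red is"
  by (simp add: red_def word_perm_rev card_inversions_inv bij_word_perm)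

text \<open>Bubble sort: undoing a descent lowers the number of inversions. A permutation without
  descents is strictly increasing on all of the natural numbers, hence the identity.\<close>

lemma exists_red_word:
  assumes "\<sigma> permutes {..<m}"
  shows "\<exists>is. set is \<subseteq> {i. Suc i < m} \<and> word_perm is = \<sigma> \<and> red is"
  using assms
proof (induction "card (inversions \<sigma>)" arbitrary: \<sigma> rule: less_induct)
  case less
  note bij = permutes_bij[OF less.prems]
  show ?case
  proof (cases "\<exists>i. Suc i < m \<and> \<sigma> (Suc i) < \<sigma> i")
    case True
    then obtain i where i: "Suc i < m" "\<sigma> (Suc i) < \<sigma> i" by blast
    let ?\<tau> = "\<sigma> \<circ> transpose i (Suc i)"
    have \<tau>: "?\<tau> permutes {..<m}"
      using i less.prems by (intro permutes_compose permutes_swap_id) auto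
    have "?\<tau> i < ?\<tau> (Suc i)" using i by simp
    note card_inversions_transpose[OF finite_inversions[OF \<tau>] this]
    moreover have "?\<tau> \<circ> transpose i (Suc i) = \<sigma>" by (simp add: comp_assoc)
    ultimately have "card (inversions ?\<tau>) < card (inversions \<sigma>)" by (simp only: lessI)
    from less.hyps[OF this \<tau>] obtain "is" where
      "is": "set is \<subseteq> {i. Suc i < m}" "word_perm is = ?\<tau>" "red is" by blast
    have "red (is @ [i])" using "is" i by (simp add: red_snoc)
    moreover have "word_perm (is @ [i]) = \<sigma>"
      using "is" by (simp add: word_perm_append comp_assoc)
    ultimately show ?thesis using "is" i by (intro exI[of _ "is @ [i]"]) auto
  next
    case False
    have step: "\<sigma> i < \<sigma> (Suc i)" for i
    proof (cases "Suc i < m")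
      case True
      with False have "\<sigma> i \<le> \<sigma> (Suc i)" by (meson not_less)
      moreover have "\<sigma> i \<noteq> \<sigma> (Suc i)" using bij by (metis bij_def injD n_not_Suc_n)
      ultimately show ?thesis by simp
    next
      case F: False
      then have "\<sigma> (Suc i) = Suc i" using permutes_not_in[OF less.prems] by simp
      moreover have "\<sigma> i \<le> i"
        using permutes_in_image[OF less.prems, of i] permutes_not_in[OF less.prems, of i] F
        by (cases "i < m") auto
      ultimately show ?thesis by simp
    qed
    then have mono: "strict_mono \<sigma>" by (simp add: strict_mono_Suc_iff)
    have "\<sigma> k = k" for k
    proof (induction k rule: less_induct)
      case (less k)
      have "k \<le> \<sigma> k" using mono by (simp add: strict_mono_imp_increasing)
      moreover obtain l where l: "\<sigma> l = k" using bij by (metis bij_pointE)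
      ultimately show ?case
        using less[of l] mono by (metis le_neq_implies_less strict_mono_less)
    qed
    then have "\<sigma> = id" by auto
    then show ?thesis by (intro exI[of _ "[]"]) simp
  qed
qed

text \<open>The number of inversions bounds the length of every word from below, and by
  \<open>exists_red_word\<close> the bound is attained.\<close>

lemma reduced_word_iff:
  assumes "\<sigma> permutes {..<m}"
  shows "reduced_word m \<sigma> is \<longleftrightarrow> set is \<subseteq> {i. Suc i < m} \<and> word_perm is = \<sigma> \<and> red is"
proof -
  obtain ks where ks: "set ks \<subseteq> {i. Suc i < m}" "word_perm ks = \<sigma>" "red ks"
    using exists_red_word[OF assms] by blast
  show ?thesis
    unfolding reduced_word_def red_def
    using card_inversions_le ks red_def by (metis le_antisym)
qed

lemma some_reduced_word:
  assumes "\<sigma> permutes {..<m}"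
  defines "is \<equiv> SOME is. reduced_word m \<sigma> is"
  shows "set is \<subseteq> {i. Suc i < m}" "word_perm is = \<sigma>" "red is"
proof -
  have "reduced_word m \<sigma> is"
    unfolding is_def using exists_red_word[OF assms(1)] reduced_word_iff[OF assms(1)]
    by (metis someI_ex)
  then show "set is \<subseteq> {i. Suc i < m}" "word_perm is = \<sigma>" "red is"
    by (simp_all add: reduced_word_iff[OF assms(1)])
qed

section \<open>Matsumoto's theorem\<close>

lemma foldr_respects:
  assumes "\<And>i f h. Suc i < m \<Longrightarrow> E f h \<Longrightarrow> E (B i f) (B i h)" and "set is \<subseteq> {i. Suc i < m}" and "E f h"
  shows "E (foldr B is f) (foldr B is h)"
  using assms(2) by (induction "is") (auto intro: assms)

text \<open>
  Two different last letters of reduced words of the same permutation are both descents of it, so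
  that reduced words ending in the longest element of the parabolic subgroup generated by the two
  letters connect the given ones.
\<close>

lemma matsumoto:
  fixes B :: "nat \<Rightarrow> 'f \<Rightarrow> 'f"
  assumes "equivp E"
    and resp: "\<And>i f h. Suc i < m \<Longrightarrow> E f h \<Longrightarrow> E (B i f) (B i h)"
    and far: "\<And>i j f. Suc i < j \<Longrightarrow> Suc j < m \<Longrightarrow> E (B i (B j f)) (B j (B i f))"
    and braid: "\<And>i f. Suc (Suc i) < m \<Longrightarrow>
      E (B i (B (Suc i) (B i f))) (B (Suc i) (B i (B (Suc i) f)))"
    and "set is \<subseteq> {i. Suc i < m}" "set js \<subseteq> {i. Suc i < m}" "red is" "red js"
    and "word_perm is = word_perm js"
  shows "E (foldr B is f) (foldr B js f)"
proof -
  note E_refl = equivp_reflp[OF assms(1)] and E_sym = equivp_symp[OF assms(1)]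
    and E_trans = equivp_transp[OF assms(1)]
  note fr = foldr_respects[where E = E and B = B and m = m, OF resp]
  show ?thesis using assms(5-)
  proof (induction "length is" arbitrary: "is" js f)
    case 0
    then have "length js = 0" by (metis red_def)
    with 0 show ?case by (simp add: E_refl)
  next
    case (Suc n)
    have "length js = Suc n" using Suc.hyps(2) Suc.prems by (metis red_def)
    with Suc.hyps(2) obtain is' i js' j where ij: "is = is' @ [i]" "js = js' @ [j]"
      by (metis append_butlast_last_id length_0_conv nat.distinct(1))
    let ?s = "\<lambda>i. transpose i (Suc i)"
    have len: "n = length is'" "n = length js'"
      using Suc.hyps(2) \<open>length js = Suc n\<close> ij by auto
    have sets: "set is' \<subseteq> {i. Suc i < m}" "set js' \<subseteq> {i. Suc i < m}" "Suc i < m" "Suc j < m"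
      using Suc.prems ij by auto
    have reds: "red is'" "red js'" using Suc.prems ij by (auto simp: red_snoc)
    define \<sigma> where "\<sigma> = word_perm is"
    have wi: "word_perm is' = \<sigma> \<circ> ?s i"
      by (simp add: \<sigma>_def ij word_perm_append comp_assoc)
    have wj: "word_perm js' = \<sigma> \<circ> ?s j"
      using Suc.prems by (simp add: \<sigma>_def ij word_perm_append comp_assoc)
    have desc: "\<sigma> (Suc i) < \<sigma> i" "\<sigma> (Suc j) < \<sigma> j"
      using Suc.prems by (simp_all add: ij red_snoc wi wj)
    have \<sigma>p: "\<sigma> permutes {..<m}" unfolding \<sigma>_def using Suc.prems by (intro word_perm_permutes)
    have sp: "?s k permutes {..<m}" if "Suc k < m" for k
      using that by (intro permutes_swap_id) auto
    \<comment> \<open>All data are quantified again, so that the case of \<open>j\<close> below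
      \<open>i\<close> follows from the symmetry of \<open>E\<close> by exchanging the two
      words.\<close>
    have main: "E (foldr B (is' @ [i]) f) (foldr B (js' @ [j]) f)"
      if "i \<le> j" "n = length is'" "n = length js'" "set is' \<subseteq> {i. Suc i < m}"
        "set js' \<subseteq> {i. Suc i < m}" "Suc i < m" "Suc j < m" "red is'" "red js'"
        "word_perm is' = \<sigma> \<circ> ?s i" "word_perm js' = \<sigma> \<circ> ?s j" "\<sigma> (Suc i) < \<sigma> i" "\<sigma> (Suc j) < \<sigma> j"
      for i j is' js' f
    proof -
      consider "i = j" | "Suc i = j" | "Suc i < j" using \<open>i \<le> j\<close> by linarith
      then show ?thesis
      proof cases
        case 1
        with that show ?thesis using Suc.hyps(1)[of is' js' "B i f"] by simp
      next
        case 2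
        \<comment> \<open>The shortest element in the coset of \<open>\<sigma>\<close> by the
          subgroup generated by the two letters. A reduced word of it, followed by either side of
          the braid relation, is a reduced word of \<open>\<sigma>\<close>.\<close>
        let ?\<tau> = "\<sigma> \<circ> ?s i \<circ> ?s j \<circ> ?s i"
        have \<tau>eq: "?\<tau> = \<sigma> \<circ> ?s j \<circ> ?s i \<circ> ?s j"
          by (rule ext) (auto simp: 2[symmetric] transpose_def)
        have "?\<tau> permutes {..<m}"
          using \<sigma>p sp that by (intro permutes_compose)
        then obtain ks where ks: "set ks \<subseteq> {i. Suc i < m}" "word_perm ks = ?\<tau>" "red ks"
          using exists_red_word by blast
        \<comment> \<open>\<open>\<sigma>\<close> decreases along the consecutive positions
          \<open>i\<close>, \<open>j\<close>, \<open>Suc j\<close>. Hence \<open>?\<tau>\<close>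
          increases there, and each letter added to \<open>ks\<close> below is an ascent.\<close>
        have d: "\<sigma> (Suc j) < \<sigma> j" "\<sigma> j < \<sigma> i" using that 2 by auto
        have r1: "red (ks @ [i])"
          using ks d 2 by (simp add: red_snoc transpose_def)
        have r2: "red (ks @ [j])"
          using ks d 2 by (simp add: red_snoc transpose_def)
        have w1: "word_perm (ks @ [i]) = \<sigma> \<circ> ?s i \<circ> ?s j"
          using ks by (simp add: word_perm_append comp_assoc)
        have w2: "word_perm (ks @ [j]) = \<sigma> \<circ> ?s j \<circ> ?s i"
          using ks(2) unfolding \<tau>eq by (simp add: word_perm_append comp_assoc)
        have r3: "red ((ks @ [i]) @ [j])"
          by (rule red_snoc'[OF w1 r1]) (use d 2 in \<open>auto simp: transpose_def\<close>)
        have r4: "red ((ks @ [j]) @ [i])"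
          by (rule red_snoc'[OF w2 r2]) (use d 2 in \<open>auto simp: transpose_def\<close>)
        have w3: "word_perm ((ks @ [i]) @ [j]) = word_perm is'"
          unfolding word_perm_append[of "ks @ [i]"] w1 that(10)
          by (simp add: comp_assoc)
        have w4: "word_perm ((ks @ [j]) @ [i]) = word_perm js'"
          unfolding word_perm_append[of "ks @ [j]"] w2 that(11)
          by (simp add: comp_assoc)
        \<comment> \<open>The common last letter is dropped, so the induction hypothesis applies to
          words that are one letter shorter.\<close>
        have e1: "E (foldr B is' (B i f)) (foldr B ((ks @ [i]) @ [j]) (B i f))"
          using that ks by (intro Suc.hyps(1)) (auto simp: r3 w3 simp del: append_assoc)
        have e2: "E (foldr B js' (B j f)) (foldr B ((ks @ [j]) @ [i]) (B j f))"
          using that ks by (intro Suc.hyps(1)) (auto simp: r4 w4 simp del: append_assoc)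
        have "E (foldr B ks (B i (B j (B i f)))) (foldr B ks (B j (B i (B j f))))"
          using 2 that ks by (intro fr) (auto simp: braid)
        then show ?thesis
          using e1 e2 by simp (meson E_sym E_trans)
      next
        case 3
        let ?\<tau> = "\<sigma> \<circ> ?s i \<circ> ?s j"
        have \<tau>eq: "?\<tau> = \<sigma> \<circ> ?s j \<circ> ?s i"
          using 3 by (intro ext) (auto simp: transpose_def)
        have "?\<tau> permutes {..<m}"
          using \<sigma>p sp that by (intro permutes_compose)
        then obtain ks where ks: "set ks \<subseteq> {i. Suc i < m}" "word_perm ks = ?\<tau>" "red ks"
          using exists_red_word by blast
        have r1: "red (ks @ [j])" and r2: "red (ks @ [i])"
          using ks that 3 by (simp_all add: red_snoc transpose_def)
        have w1: "word_perm (ks @ [j]) = word_perm is'"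
          using ks that by (simp add: word_perm_append comp_assoc)
        have w2: "word_perm (ks @ [i]) = word_perm js'"
          using ks that unfolding \<tau>eq by (simp add: word_perm_append comp_assoc)
        have e1: "E (foldr B is' (B i f)) (foldr B (ks @ [j]) (B i f))"
          using that ks by (intro Suc.hyps(1)) (auto simp: r1 w1)
        have e2: "E (foldr B js' (B j f)) (foldr B (ks @ [i]) (B j f))"
          using that ks by (intro Suc.hyps(1)) (auto simp: r2 w2)
        have "E (foldr B ks (B i (B j f))) (foldr B ks (B j (B i f)))"
          using 3 that ks by (intro fr) (auto simp: far)
        then show ?thesis
          using e1 e2 by simp (meson E_sym E_trans)
      qed
    qed
    show ?case
    proof (cases "i \<le> j")
      case True
      show ?thesis unfolding ij by (rule main[OF True len sets reds wi wj desc])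
    next
      case False
      then have "j \<le> i" by simp
      show ?thesis unfolding ij
        by (rule E_sym, rule main[OF \<open>j \<le> i\<close> len(2,1) sets(2,1,4,3) reds(2,1) wj wi desc(2,1)])
    qed
  qed
qed

subsection \<open>Cosets of a point stabilizer\<close>

lemma word_perm_fixes:
  "(\<And>j. j \<in> set is \<Longrightarrow> k < j \<or> Suc j < k) \<Longrightarrow> word_perm is k = k"
proof (induction "is")
  case (Cons j "is")
  then have "word_perm is k = k" "k < j \<or> Suc j < k" by auto
  then show ?case by (auto simp: transpose_def)
qed simp

text \<open>The cycles here and in the next lemma represent the cosets of the stabilizers of
  \<open>0\<close> and of \<open>N\<close>: a coset is determined by which position is sent to the
  fixed point.\<close>

lemma word_perm_upt: "word_perm [0..<i] i = 0"
  by (induction i) (simp_all add: word_perm_append)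

lemma word_perm_rev_upt: "i \<le> N \<Longrightarrow> word_perm (rev [i..<N]) i = N"
proof (induction i rule: inc_induct)
  case (step i)
  then have "rev [i..<N] = rev [Suc i..<N] @ [i]" by (simp add: upt_conv_Cons)
  with step show ?case by (simp add: word_perm_append)
qed simp

text \<open>The embedding of a symmetric group as the stabilizer of \<open>0\<close> in the
  symmetric group with one more letter.\<close>

definition shift_perm :: "(nat \<Rightarrow> nat) \<Rightarrow> nat \<Rightarrow> nat" where
  "shift_perm \<tau> = case_nat 0 (\<lambda>k. Suc (\<tau> k))"

lemma shift_perm_simps [simp]: "shift_perm \<tau> 0 = 0" "shift_perm \<tau> (Suc k) = Suc (\<tau> k)"
  by (simp_all add: shift_perm_def)

lemma word_perm_map_Suc: "word_perm (map Suc is) = shift_perm (word_perm is)"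
proof (induction "is")
  case Nil
  have "shift_perm id k = k" for k by (cases k) simp_all
  then show "word_perm (map Suc []) = shift_perm (word_perm [])" by auto
next
  case (Cons i "is")
  have "word_perm (map Suc (i # is)) k = shift_perm (word_perm (i # is)) k" for k
    by (cases k) (simp_all add: Cons transpose_def)
  then show "word_perm (map Suc (i # is)) = shift_perm (word_perm (i # is))" by auto
qed

text \<open>The word \<open>is\<close> fixes \<open>N\<close>. Before the letter \<open>i\<close> is
  appended, the largest value \<open>N\<close> has travelled down to position \<open>Suc i\<close>,
  so \<open>i\<close> is an ascent.\<close>

lemma red_append_rev_upt:
  assumes "red is" "set is \<subseteq> {j. Suc j < N}" "i \<le> N"
  shows "red (is @ rev [i..<N])"
  using \<open>i \<le> N\<close>
proof (induction i rule: inc_induct)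
  case base
  show ?case using assms by simp
next
  case (step i)
  let ?js = "is @ rev [Suc i..<N]"
  have "word_perm is N = N" using assms(2) by (intro word_perm_fixes) auto
  then have N: "word_perm ?js (Suc i) = N"
    using step word_perm_rev_upt[of "Suc i" N] by (simp add: word_perm_append)
  have "word_perm ?js permutes {..<Suc N}"
    using assms by (intro word_perm_permutes) auto
  then have "word_perm ?js i < Suc N"
    using step permutes_in_image[of _ _ i] by fastforce
  moreover have "word_perm ?js i \<noteq> N" using N inj_word_perm[of ?js i "Suc i"] by simp
  ultimately have "red (?js @ [i])" using step N by (simp add: red_snoc del: append_assoc)
  then show ?case using step by (simp add: upt_conv_Cons)
qed

lemma red_map_Suc: "red is \<Longrightarrow> red (map Suc is)"
proof (induction "is" rule: rev_induct)
  case (snoc i "is")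
  then have "red (map Suc is @ [Suc i])"
    by (simp add: red_snoc word_perm_map_Suc)
  then show ?case by simp
qed simp

text \<open>The mirror image: before the letter \<open>i\<close> is appended, the smallest value
  \<open>0\<close> sits at position \<open>i\<close>, so \<open>i\<close> is an ascent.\<close>

lemma red_map_Suc_append_upt:
  assumes "red is"
  shows "red (map Suc is @ [0..<i])"
proof (induction i)
  case 0
  show ?case using assms by (simp add: red_map_Suc)
next
  case (Suc i)
  let ?js = "map Suc is @ [0..<i]"
  have 0: "word_perm ?js i = 0"
    by (simp add: word_perm_append word_perm_map_Suc word_perm_upt)
  have "word_perm ?js (Suc i) \<noteq> 0" using inj_word_perm[of ?js i "Suc i"] 0 by simp
  then have "red (?js @ [i])" using 0 Suc by (simp add: red_snoc del: append_assoc)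
  then show ?case by simp
qed

text \<open>The index \<open>i\<close> is recovered as the preimage of \<open>t\<close>, which gives
  injectivity. Surjectivity follows by counting, since
  \<open>Suc N * fact N = fact (Suc N)\<close>.\<close>

lemma bij_betw_cosets:
  assumes "finite J" "card J = fact N" and "\<And>\<tau>. \<tau> \<in> J \<Longrightarrow> \<tau> permutes {..<Suc N}"
    and "\<And>\<tau>. \<tau> \<in> J \<Longrightarrow> \<tau> t = t"
    and "\<And>i. i \<le> N \<Longrightarrow> b i permutes {..<Suc N}" and "\<And>i. i \<le> N \<Longrightarrow> b i i = t"
  shows "bij_betw (\<lambda>(i, \<tau>). \<tau> \<circ> b i) ({..N} \<times> J) {\<sigma>. \<sigma> permutes {..<Suc N}}"
proof -
  have "inj_on (\<lambda>(i, \<tau>). \<tau> \<circ> b i) ({..N} \<times> J)"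
  proof (rule inj_onI, clarify)
    fix i \<tau> i' \<tau>'
    assume *: "i \<le> N" "i' \<le> N" "\<tau> \<in> J" "\<tau>' \<in> J" "\<tau> \<circ> b i = \<tau>' \<circ> b i'"
    have "(\<tau> \<circ> b i) i = (\<tau> \<circ> b i) i'"
      using assms(4,6) * by (metis comp_apply)
    moreover have "inj (\<tau> \<circ> b i)"
      using permutes_compose assms(3,5) * by (meson permutes_inj inj_compose)
    ultimately have ii: "i = i'" by (simp add: inj_def del: comp_apply)
    have "\<tau> k = \<tau>' k" for k
    proof -
      obtain l where "k = b i l" using permutes_surj[OF assms(5)[OF *(1)]] by (metis surjD)
      then show ?thesis using *(5) ii by (metis comp_apply)
    qed
    then show "i = i' \<and> \<tau> = \<tau>'" using ii by blast
  qed
  moreover have "(\<lambda>(i, \<tau>). \<tau> \<circ> b i) ` ({..N} \<times> J) = {\<sigma>. \<sigma> permutes {..<Suc N}}"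
  proof (rule card_subset_eq)
    show "finite {\<sigma>. \<sigma> permutes {..<Suc N}}" by (simp add: finite_permutations)
    show "(\<lambda>(i, \<tau>). \<tau> \<circ> b i) ` ({..N} \<times> J) \<subseteq> {\<sigma>. \<sigma> permutes {..<Suc N}}"
      using assms(3,5) by (auto intro!: permutes_compose)
    have "card {\<sigma>. \<sigma> permutes {..<Suc N}} = fact (Suc N)"
      by (rule card_permutations) simp_all
    then show "card ((\<lambda>(i, \<tau>). \<tau> \<circ> b i) ` ({..N} \<times> J)) = card {\<sigma>. \<sigma> permutes {..<Suc N}}"
      using calculation assms(1,2) by (simp add: card_image)
  qed
  ultimately show ?thesis by (simp add: bij_betw_def)
qed

lemma permutes_Suc: "\<tau> permutes {..<N} \<Longrightarrow> \<tau> permutes {..<Suc N}"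
  by (rule permutes_subset) auto

lemma shift_perm_permutes:
  assumes "\<tau> permutes {..<N}"
  shows "shift_perm \<tau> permutes {..<Suc N}"
proof -
  obtain "is" where "is": "set is \<subseteq> {i. Suc i < N}" "word_perm is = \<tau>"
    using exists_red_word[OF assms] by blast
  then have "word_perm (map Suc is) permutes {..<Suc N}"
    by (intro word_perm_permutes) auto
  with "is" show ?thesis by (simp add: word_perm_map_Suc)
qed

lemma inj_shift_perm: "inj shift_perm"
proof (rule injI, rule ext)
  fix \<tau> \<tau>' k assume "shift_perm \<tau> = shift_perm \<tau>'"
  then have "shift_perm \<tau> (Suc k) = shift_perm \<tau>' (Suc k)" by (rule fun_cong)
  then show "\<tau> k = \<tau>' k" by simp
qed

lemma sum_permutes_last:
  fixes h :: "(nat \<Rightarrow> nat) \<Rightarrow> 'c::comm_monoid_add"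
  shows "(\<Sum>\<sigma> | \<sigma> permutes {..<Suc N}. h \<sigma>) =
    (\<Sum>i\<le>N. \<Sum>\<tau> | \<tau> permutes {..<N}. h (\<tau> \<circ> word_perm (rev [i..<N])))"
proof -
  have "bij_betw (\<lambda>(i, \<tau>). \<tau> \<circ> word_perm (rev [i..<N])) ({..N} \<times> {\<tau>. \<tau> permutes {..<N}})
     {\<sigma>. \<sigma> permutes {..<Suc N}}"
  proof (rule bij_betw_cosets)
    show "card {\<tau>. \<tau> permutes {..<N}} = fact N" by (rule card_permutations) simp_all
    show "word_perm (rev [i..<N]) permutes {..<Suc N}" for i by (rule word_perm_permutes) auto
  qed (auto simp: finite_permutations permutes_Suc permutes_not_in word_perm_rev_upt)
  from sum.reindex_bij_betw[OF this, of h, symmetric] show ?thesis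
    by (simp add: sum.cartesian_product split_def)
qed

lemma sum_permutes_first:
  fixes h :: "(nat \<Rightarrow> nat) \<Rightarrow> 'c::comm_monoid_add"
  shows "(\<Sum>\<sigma> | \<sigma> permutes {..<Suc N}. h \<sigma>) =
    (\<Sum>i\<le>N. \<Sum>\<tau> | \<tau> permutes {..<N}. h (shift_perm \<tau> \<circ> word_perm [0..<i]))"
proof -
  have inj: "inj_on shift_perm A" for A by (rule inj_on_subset[OF inj_shift_perm]) simp
  have "bij_betw (\<lambda>(i, \<tau>). \<tau> \<circ> word_perm [0..<i])
     ({..N} \<times> shift_perm ` {\<tau>. \<tau> permutes {..<N}}) {\<sigma>. \<sigma> permutes {..<Suc N}}"
  proof (rule bij_betw_cosets)
    have "card {\<tau>. \<tau> permutes {..<N}} = fact N" by (rule card_permutations) simp_all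
    then show "card (shift_perm ` {\<tau>. \<tau> permutes {..<N}}) = fact N"
      by (simp add: card_image inj)
    show "i \<le> N \<Longrightarrow> word_perm [0..<i] permutes {..<Suc N}" for i
      by (rule word_perm_permutes) auto
  qed (auto simp: finite_permutations shift_perm_permutes word_perm_upt)
  from sum.reindex_bij_betw[OF this, of h, symmetric]
  have "(\<Sum>\<sigma> | \<sigma> permutes {..<Suc N}. h \<sigma>) =
    (\<Sum>i\<le>N. \<Sum>\<tau>\<in>shift_perm ` {\<tau>. \<tau> permutes {..<N}}. h (\<tau> \<circ> word_perm [0..<i]))"
    by (simp add: sum.cartesian_product split_def)
  then show ?thesis by (simp add: sum.reindex[OF inj])
qed

lemma sum_permutes_inv:
  "(\<Sum>\<sigma> | \<sigma> permutes S. h \<sigma>) = (\<Sum>\<sigma> | \<sigma> permutes S. h (inv_into UNIV \<sigma>))"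
  by (rule sum.reindex_bij_witness[of _ "inv_into UNIV" "inv_into UNIV"])
     (auto simp: permutes_inv permutes_inv_inv)

subsection \<open>Factorizations of the quantum symmetrizer\<close>

lemma braid_at_append:
  "Suc i < length u \<Longrightarrow> braid_at X C i F (u @ v) = braid_at X C i (\<lambda>m. F (m @ v)) u"
  by (simp add: braid_at_def nth_append list_update_append split_def)

lemma braid_at_Cons: "braid_at X C (Suc i) F (x # u) = braid_at X C i (\<lambda>m. F (x # m)) u"
  by (simp add: braid_at_def)

lemma braid_at_cong:
  assumes "\<And>v. v \<in> lists X \<Longrightarrow> length v = length w \<Longrightarrow> f v = h v" and "w \<in> lists X" "Suc i < length w"
  shows "braid_at X C i f w = braid_at X C i h w"
  unfolding braid_at_def
proof (intro sum.cong refl, clarify)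
  fix p q assume "p \<in> X" "q \<in> X"
  then have "set (w[i := p, Suc i := q]) \<subseteq> X"
    using assms(2) by (intro set_update_subsetI) auto
  then show "C p q (w ! i, w ! Suc i) * f (w[i := p, Suc i := q]) =
        C p q (w ! i, w ! Suc i) * h (w[i := p, Suc i := q])"
    using assms(1)[of "w[i := p, Suc i := q]"] by (simp add: in_lists_conv_set subset_eq)
qed

lemma braid_at_cong_length:
  assumes "\<And>v. length v = length w \<Longrightarrow> f v = h v"
  shows "braid_at X C i f w = braid_at X C i h w"
  unfolding braid_at_def by (intro sum.cong refl) (auto simp: assms)

lemma braid_at_sum:
  "braid_at X C i (\<lambda>w. \<Sum>a\<in>A. f a w) w = (\<Sum>a\<in>A. braid_at X C i (f a) w)"
proof -
  have "braid_at X C i (\<lambda>w. \<Sum>a\<in>A. f a w) w =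
    (\<Sum>z\<in>X \<times> X. \<Sum>a\<in>A. C (fst z) (snd z) (w ! i, w ! Suc i) * f a (w[i := fst z, Suc i := snd z]))"
    by (simp add: braid_at_def split_def sum_distrib_left)
  also have "\<dots> = (\<Sum>a\<in>A. \<Sum>z\<in>X \<times> X.
      C (fst z) (snd z) (w ! i, w ! Suc i) * f a (w[i := fst z, Suc i := snd z]))"
    by (rule sum.swap)
  finally show ?thesis by (simp add: braid_at_def split_def)
qed

lemma braid_at_scale: "braid_at X C i (\<lambda>w. k * f w) w = k * braid_at X C i f w"
  by (simp add: braid_at_def split_def sum_distrib_left mult_ac)

lemma braid_at_add:
  "braid_at X C i (\<lambda>w. f w + h w) w = braid_at X C i f w + braid_at X C i h w"
  by (simp add: braid_at_def split_def sum.distrib algebra_simps)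

lemma foldr_braid_at_append:
  "set is \<subseteq> {i. Suc i < length u} \<Longrightarrow>
     foldr (braid_at X C) is F (u @ v) = foldr (braid_at X C) is (\<lambda>m. F (m @ v)) u"
proof (induction "is" arbitrary: u)
  case (Cons i "is")
  have "braid_at X C i (\<lambda>m. foldr (braid_at X C) is F (m @ v)) u =
      braid_at X C i (foldr (braid_at X C) is (\<lambda>m. F (m @ v))) u"
    using Cons by (intro braid_at_cong_length) simp
  with Cons.prems show ?case by (simp add: braid_at_append)
qed simp

lemma foldr_braid_at_Cons:
  "foldr (braid_at X C) (map Suc is) F (x # u) = foldr (braid_at X C) is (\<lambda>m. F (x # m)) u"
  by (induction "is" arbitrary: u) (simp_all add: braid_at_Cons)

text \<open>The braid relations hold only on words over \<open>X\<close> that are long enough, so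
  equality of operators is replaced by equality on the words over \<open>X\<close> of one length.
  This is the relation to which \<open>matsumoto\<close> is applied.\<close>

definition agree :: "'x set \<Rightarrow> nat \<Rightarrow> ('x list \<Rightarrow> complex) \<Rightarrow> ('x list \<Rightarrow> complex) \<Rightarrow> bool" where
  "agree X N f h \<longleftrightarrow> (\<forall>w\<in>lists X. length w = N \<longrightarrow> f w = h w)"

lemma agreeD: "agree X (length w) f h \<Longrightarrow> w \<in> lists X \<Longrightarrow> f w = h w"
  by (simp add: agree_def)

lemma equivp_agree: "equivp (agree X N)"
  by (rule equivpI) (auto simp: agree_def reflp_def symp_def transp_def)

lemma braid_at_agree:
  "Suc i < N \<Longrightarrow> agree X N f h \<Longrightarrow> agree X N (braid_at X C i f) (braid_at X C i h)"
  by (auto simp: agree_def intro!: braid_at_cong)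

lemma foldr_braid_at_agree:
  "set is \<subseteq> {i. Suc i < N} \<Longrightarrow> agree X N f h \<Longrightarrow>
     agree X N (foldr (braid_at X C) is f) (foldr (braid_at X C) is h)"
  by (rule foldr_respects[where m = N and E = "agree X N" and B = "braid_at X C"])
     (auto intro: braid_at_agree)

lemma foldr_braid_at_sum:
  "foldr (braid_at X C) is (\<lambda>w. \<Sum>a\<in>A. f a w) w = (\<Sum>a\<in>A. foldr (braid_at X C) is (f a) w)"
proof (induction "is" arbitrary: w)
  case (Cons i "is")
  then have "foldr (braid_at X C) is (\<lambda>w. \<Sum>a\<in>A. f a w) =
      (\<lambda>w. \<Sum>a\<in>A. foldr (braid_at X C) is (f a) w)" by auto
  then show ?case by (simp add: braid_at_sum)
qed simp

lemma foldr_braid_at_scale: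
  "foldr (braid_at X C) is (\<lambda>w. k * f w) w = k * foldr (braid_at X C) is f w"
proof (induction "is" arbitrary: w)
  case (Cons i "is")
  then have "foldr (braid_at X C) is (\<lambda>w. k * f w) = (\<lambda>w. k * foldr (braid_at X C) is f w)" by auto
  then show ?case by (simp add: braid_at_scale)
qed simp

lemma foldr_braid_at_add:
  "foldr (braid_at X C) is (\<lambda>w. f w + h w) w =
     foldr (braid_at X C) is f w + foldr (braid_at X C) is h w"
proof (induction "is" arbitrary: w)
  case (Cons i "is")
  then have "foldr (braid_at X C) is (\<lambda>w. f w + h w) =
     (\<lambda>w. foldr (braid_at X C) is f w + foldr (braid_at X C) is h w)" by auto
  then show ?case by (simp add: braid_at_add)
qed simp

lemma foldr_braid_at_zero: "foldr (braid_at X C) is (\<lambda>w. 0) w = 0"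
  using foldr_braid_at_scale[of X C "is" 0 "\<lambda>w. 0"] by simp

lemma quantum_symmetrizer_agree:
  assumes "agree X (length w) f h" "w \<in> lists X"
  shows "quantum_symmetrizer X C f w = quantum_symmetrizer X C h w"
  unfolding quantum_symmetrizer_def matsumoto_lift_def
proof (intro sum.cong refl, clarify)
  fix \<sigma> assume "\<sigma> permutes {..<length w}"
  from foldr_braid_at_agree[OF some_reduced_word(1)[OF this] assms(1)] assms(2)
  show "foldr (braid_at X C) (SOME is. reduced_word (length w) \<sigma> is) f w =
         foldr (braid_at X C) (SOME is. reduced_word (length w) \<sigma> is) h w"
    by (rule agreeD)
qed

lemma quantum_symmetrizer_sum:
  "quantum_symmetrizer X C (\<lambda>w. \<Sum>a\<in>A. f a w) w = (\<Sum>a\<in>A. quantum_symmetrizer X C (f a) w)"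
  unfolding quantum_symmetrizer_def matsumoto_lift_def foldr_braid_at_sum by (rule sum.swap)

lemma quantum_symmetrizer_scale:
  "quantum_symmetrizer X C (\<lambda>w. k * f w) w = k * quantum_symmetrizer X C f w"
  by (simp add: quantum_symmetrizer_def matsumoto_lift_def foldr_braid_at_scale sum_distrib_left)

lemma quantum_symmetrizer_add:
  "quantum_symmetrizer X C (\<lambda>w. f w + h w) w =
     quantum_symmetrizer X C f w + quantum_symmetrizer X C h w"
  by (simp add: quantum_symmetrizer_def matsumoto_lift_def foldr_braid_at_add sum.distrib)

text \<open>The braid equation is required on words over \<open>X\<close> because
  \<open>braid_at\<close> sums over letters of \<open>X\<close>. \<open>C_outside\<close> keeps
  supports inside \<open>lists X\<close>, since \<open>nichols_ideal\<close> tests the symmetrizer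
  on all words.\<close>

locale braided_space =
  fixes X :: "'x set" and C :: "'x braiding"
  assumes finite_X: "finite X"
    and C_outside: "p \<in> X \<Longrightarrow> q \<in> X \<Longrightarrow> r \<notin> X \<times> X \<Longrightarrow> C p q r = 0"
    and braid_equation: "w \<in> lists X \<Longrightarrow> Suc (Suc i) < length w \<Longrightarrow>
      braid_at X C i (braid_at X C (Suc i) (braid_at X C i f)) w =
      braid_at X C (Suc i) (braid_at X C i (braid_at X C (Suc i) f)) w"
begin

abbreviation "B \<equiv> braid_at X C"
abbreviation "Q \<equiv> quantum_symmetrizer X C"
abbreviation "red_word N \<tau> \<equiv> SOME is. reduced_word N \<tau> is"

lemma braid_at_far:
  assumes "Suc i < j" "Suc j < length w"
  shows "B i (B j f) w = B j (B i f) w"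
proof -
  have "B i (B j f) w = (\<Sum>z\<in>X \<times> X. \<Sum>z'\<in>X \<times> X.
      C (fst z) (snd z) (w ! i, w ! Suc i) * (C (fst z') (snd z') (w ! j, w ! Suc j) *
        f (w[i := fst z, Suc i := snd z, j := fst z', Suc j := snd z'])))"
    using assms by (simp add: braid_at_def split_def sum_distrib_left)
  also have "\<dots> = (\<Sum>z'\<in>X \<times> X. \<Sum>z\<in>X \<times> X.
      C (fst z) (snd z) (w ! i, w ! Suc i) * (C (fst z') (snd z') (w ! j, w ! Suc j) *
        f (w[i := fst z, Suc i := snd z, j := fst z', Suc j := snd z'])))"
    by (rule sum.swap)
  also have "\<dots> = (\<Sum>z'\<in>X \<times> X. \<Sum>z\<in>X \<times> X.
      C (fst z') (snd z') (w ! j, w ! Suc j) * (C (fst z) (snd z) (w ! i, w ! Suc i) *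
        f (w[j := fst z', Suc j := snd z', i := fst z, Suc i := snd z])))"
  proof (intro sum.cong refl)
    fix z z' :: "'x \<times> 'x"
    have "w[i := fst z, Suc i := snd z, j := fst z', Suc j := snd z'] =
        w[j := fst z', Suc j := snd z', i := fst z, Suc i := snd z]"
      using assms by (intro nth_equalityI) (auto simp: nth_list_update)
    then show "C (fst z) (snd z) (w ! i, w ! Suc i) * (C (fst z') (snd z') (w ! j, w ! Suc j) *
        f (w[i := fst z, Suc i := snd z, j := fst z', Suc j := snd z'])) =
      C (fst z') (snd z') (w ! j, w ! Suc j) * (C (fst z) (snd z) (w ! i, w ! Suc i) *
        f (w[j := fst z', Suc j := snd z', i := fst z, Suc i := snd z]))"
      by simp
  qed
  also have "\<dots> = B j (B i f) w"
    using assms by (simp add: braid_at_def split_def sum_distrib_left)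
  finally show ?thesis .
qed

section \<open>The symmetrizer in successive degrees\<close>

lemma matsumoto_braid:
  assumes "set is \<subseteq> {i. Suc i < N}" "set js \<subseteq> {i. Suc i < N}" "red is" "red js"
    "word_perm is = word_perm js"
  shows "agree X N (foldr B is f) (foldr B js f)"
proof (rule matsumoto[where m = N, OF equivp_agree])
  show "Suc i < N \<Longrightarrow> agree X N f h \<Longrightarrow> agree X N (B i f) (B i h)" for i f h
    by (rule braid_at_agree)
  show "Suc i < j \<Longrightarrow> Suc j < N \<Longrightarrow> agree X N (B i (B j f)) (B j (B i f))" for i j f
    unfolding agree_def using braid_at_far by blast
  show "Suc (Suc i) < N \<Longrightarrow>
      agree X N (B i (B (Suc i) (B i f))) (B (Suc i) (B i (B (Suc i) f)))" for i f
    using braid_equation by (simp add: agree_def)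
qed (use assms in simp_all)

text \<open>This frees the computation from the word picked by \<open>SOME\<close>: any reduced word
  adapted to a coset decomposition may be used.\<close>

lemma matsumoto_lift_eq:
  assumes "set is \<subseteq> {i. Suc i < length w}" "red is" "word_perm is = \<sigma>" "w \<in> lists X"
  shows "matsumoto_lift X C (length w) \<sigma> f w = foldr B is f w"
proof -
  have \<sigma>: "\<sigma> permutes {..<length w}" using assms word_perm_permutes by blast
  show ?thesis unfolding matsumoto_lift_def
    by (rule agreeD[OF matsumoto_braid]) (use assms some_reduced_word[OF \<sigma>] in auto)
qed

text \<open>Each permutation is a stabilizer element followed by a cycle that places the last
  letter. The stabilizer elements sum to the symmetrizer of the first factors, which acts
  innermost.\<close>

lemma quantum_symmetrizer_snoc:
  assumes "u \<in> lists X" "x \<in> X"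
  shows "Q F (u @ [x]) = (\<Sum>i\<le>length u.
    foldr B [i..<length u] (\<lambda>w. Q (\<lambda>m. F (m @ [last w])) (butlast w)) (u @ [x]))"
proof -
  let ?N = "length u" and ?w = "u @ [x]"
  have w: "?w \<in> lists X" using assms by simp
  \<comment> \<open>Inverting the permutation and its stabilizer part \<open>\<tau>\<close> puts the
    cycle on the left. The reduced word then starts with \<open>[i..<?N]\<close>, and
    \<open>foldr\<close> applies the part of \<open>\<tau>\<close> first.\<close>
  have *: "matsumoto_lift X C (Suc ?N) (inv_into UNIV (inv_into UNIV \<tau> \<circ> word_perm (rev [i..<?N]))) F ?w =
      foldr B [i..<?N] (foldr B (red_word ?N \<tau>) F) ?w"
    if "i \<le> ?N" and \<tau>: "\<tau> permutes {..<?N}" for i \<tau>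
  proof -
    note s = some_reduced_word[OF \<tau>]
    let ?rw = "red_word ?N \<tau>"
    have "red (rev (rev ?rw @ rev [i..<?N]))"
      unfolding red_rev using s that by (intro red_append_rev_upt) (auto simp: red_rev)
    then have r: "red ([i..<?N] @ ?rw)" by simp
    have "word_perm ([i..<?N] @ ?rw) = inv_into UNIV (word_perm (rev ?rw @ rev [i..<?N]))"
      by (subst word_perm_rev[symmetric]) simp
    also have "\<dots> = inv_into UNIV (inv_into UNIV \<tau> \<circ> word_perm (rev [i..<?N]))"
      using s(2) by (simp add: word_perm_append word_perm_rev)
    finally have wp: "word_perm ([i..<?N] @ ?rw) =
      inv_into UNIV (inv_into UNIV \<tau> \<circ> word_perm (rev [i..<?N]))" .
    have "matsumoto_lift X C (length ?w) (inv_into UNIV (inv_into UNIV \<tau> \<circ> word_perm (rev [i..<?N]))) F ?w =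
      foldr B ([i..<?N] @ ?rw) F ?w"
      using s(1) w by (intro matsumoto_lift_eq r wp) auto
    then show ?thesis by simp
  qed
  have "Q F ?w = (\<Sum>i\<le>?N. \<Sum>\<tau> | \<tau> permutes {..<?N}.
      matsumoto_lift X C (Suc ?N) (inv_into UNIV (inv_into UNIV \<tau> \<circ> word_perm (rev [i..<?N]))) F ?w)"
    unfolding quantum_symmetrizer_def
    apply (subst sum_permutes_inv)
    apply (simp add: sum_permutes_last)
    apply (subst sum_permutes_inv)
    apply (rule refl)
    done
  also have "\<dots> = (\<Sum>i\<le>?N. \<Sum>\<tau> | \<tau> permutes {..<?N}.
      foldr B [i..<?N] (foldr B (red_word ?N \<tau>) F) ?w)"
    by (intro sum.cong refl) (simp add: *)
  also have "\<dots> = (\<Sum>i\<le>?N.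
      foldr B [i..<?N] (\<lambda>w. \<Sum>\<tau> | \<tau> permutes {..<?N}. foldr B (red_word ?N \<tau>) F w) ?w)"
    by (simp add: foldr_braid_at_sum)
  also have "\<dots> = (\<Sum>i\<le>?N.
      foldr B [i..<?N] (\<lambda>w. Q (\<lambda>m. F (m @ [last w])) (butlast w)) ?w)"
  proof (intro sum.cong refl)
    fix i assume "i \<in> {..?N}"
    have "agree X (Suc ?N) (\<lambda>w. \<Sum>\<tau> | \<tau> permutes {..<?N}. foldr B (red_word ?N \<tau>) F w)
      (\<lambda>w. Q (\<lambda>m. F (m @ [last w])) (butlast w))"
      unfolding agree_def
    proof (intro ballI impI)
      fix w assume "w \<in> lists X" "length w = Suc ?N"
      then obtain v y where v: "w = v @ [y]" "length v = ?N"
        by (metis append_butlast_last_id diff_Suc_1 length_butlast list.size(3) nat.distinct(1))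
      show "(\<Sum>\<tau> | \<tau> permutes {..<?N}. foldr B (red_word ?N \<tau>) F w) =
        Q (\<lambda>m. F (m @ [last w])) (butlast w)"
        unfolding quantum_symmetrizer_def matsumoto_lift_def v(1)
        using some_reduced_word(1)[of _ ?N] v(2)
        by (intro sum.cong) (simp_all add: foldr_braid_at_append)
    qed
    then have "agree X (length ?w)
       (foldr B [i..<?N] (\<lambda>w. \<Sum>\<tau> | \<tau> permutes {..<?N}. foldr B (red_word ?N \<tau>) F w))
       (foldr B [i..<?N] (\<lambda>w. Q (\<lambda>m. F (m @ [last w])) (butlast w)))"
      by (intro foldr_braid_at_agree) auto
    from agreeD[OF this w]
    show "foldr B [i..<?N] (\<lambda>w. \<Sum>\<tau> | \<tau> permutes {..<?N}. foldr B (red_word ?N \<tau>) F w) ?w =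
      foldr B [i..<?N] (\<lambda>w. Q (\<lambda>m. F (m @ [last w])) (butlast w)) ?w" .
  qed
  finally show ?thesis .
qed

lemma red_shifted_coset:
  assumes "\<tau> permutes {..<N}" "i \<le> N"
  shows "red (map Suc (red_word N \<tau>) @ [0..<i])"
    "set (map Suc (red_word N \<tau>) @ [0..<i]) \<subseteq> {i. Suc i < Suc N}"
    "word_perm (map Suc (red_word N \<tau>) @ [0..<i]) = shift_perm \<tau> \<circ> word_perm [0..<i]"
  using some_reduced_word[OF assms(1)] \<open>i \<le> N\<close>
  by (auto simp: word_perm_append word_perm_map_Suc intro!: red_map_Suc_append_upt)

text \<open>The counterpart of \<open>quantum_symmetrizer_snoc\<close> for the stabilizer of the
  first position.\<close>

lemma quantum_symmetrizer_Cons':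
  assumes "u \<in> lists X" "x \<in> X"
  shows "Q F (x # u) = (\<Sum>i\<le>length u.
    foldr B (rev [0..<i]) (\<lambda>w. Q (\<lambda>m. F (hd w # m)) (tl w)) (x # u))"
proof -
  let ?N = "length u" and ?w = "x # u"
  have w: "?w \<in> lists X" using assms by simp
  have *: "matsumoto_lift X C (Suc ?N) (inv_into UNIV (shift_perm \<tau> \<circ> word_perm [0..<i])) F ?w =
      foldr B (rev [0..<i]) (foldr B (map Suc (rev (red_word ?N \<tau>))) F) ?w"
    if "i \<le> ?N" and \<tau>: "\<tau> permutes {..<?N}" for i \<tau>
  proof -
    let ?rw = "red_word ?N \<tau>"
    note s = red_shifted_coset[OF \<tau> that(1)]
    have "matsumoto_lift X C (length ?w) (inv_into UNIV (shift_perm \<tau> \<circ> word_perm [0..<i])) F ?w =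
      foldr B (rev (map Suc ?rw @ [0..<i])) F ?w"
      using s w by (intro matsumoto_lift_eq) (simp_all add: red_rev word_perm_rev del: rev_append)
    then show ?thesis by (simp add: rev_map)
  qed
  \<comment> \<open>Reversed reduced words are reduced words of the inverses, so summing over them
    gives the same symmetrizer.\<close>
  have **: "(\<Sum>\<tau> | \<tau> permutes {..<?N}. foldr B (rev (red_word ?N \<tau>)) h v) = Q h v"
    if "length v = ?N" "v \<in> lists X" for h v
  proof -
    have "(\<Sum>\<tau> | \<tau> permutes {..<?N}. foldr B (rev (red_word ?N \<tau>)) h v) =
      (\<Sum>\<tau> | \<tau> permutes {..<?N}. matsumoto_lift X C (length v) (inv_into UNIV \<tau>) h v)"
    proof (intro sum.cong refl, clarify)
      fix \<tau> assume "\<tau> permutes {..<?N}"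
      note s = some_reduced_word[OF this]
      show "foldr B (rev (red_word ?N \<tau>)) h v =
        matsumoto_lift X C (length v) (inv_into UNIV \<tau>) h v"
        using s that by (intro matsumoto_lift_eq[symmetric]) (simp_all add: red_rev word_perm_rev)
    qed
    also have "\<dots> = Q h v"
      unfolding quantum_symmetrizer_def that(1) by (rule sum_permutes_inv[symmetric])
    finally show ?thesis .
  qed
  have "Q F ?w = (\<Sum>i\<le>?N. \<Sum>\<tau> | \<tau> permutes {..<?N}.
      matsumoto_lift X C (Suc ?N) (inv_into UNIV (shift_perm \<tau> \<circ> word_perm [0..<i])) F ?w)"
    unfolding quantum_symmetrizer_def
    by (subst sum_permutes_inv) (simp add: sum_permutes_first)
  also have "\<dots> = (\<Sum>i\<le>?N. \<Sum>\<tau> | \<tau> permutes {..<?N}.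
      foldr B (rev [0..<i]) (foldr B (map Suc (rev (red_word ?N \<tau>))) F) ?w)"
    by (intro sum.cong refl) (simp add: *)
  also have "\<dots> = (\<Sum>i\<le>?N. foldr B (rev [0..<i])
      (\<lambda>w. \<Sum>\<tau> | \<tau> permutes {..<?N}. foldr B (map Suc (rev (red_word ?N \<tau>))) F w) ?w)"
    by (simp add: foldr_braid_at_sum)
  also have "\<dots> = (\<Sum>i\<le>?N.
      foldr B (rev [0..<i]) (\<lambda>w. Q (\<lambda>m. F (hd w # m)) (tl w)) ?w)"
  proof (intro sum.cong refl)
    fix i assume i: "i \<in> {..?N}"
    let ?f = "\<lambda>w. \<Sum>\<tau> | \<tau> permutes {..<?N}. foldr B (map Suc (rev (red_word ?N \<tau>))) F w"
    have "agree X (Suc ?N) ?f (\<lambda>w. Q (\<lambda>m. F (hd w # m)) (tl w))"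
      unfolding agree_def
    proof (intro ballI impI)
      fix w assume "w \<in> lists X" "length w = Suc ?N"
      then obtain y v where v: "w = y # v" "length v = ?N" "v \<in> lists X"
        by (cases w) auto
      then show "?f w = Q (\<lambda>m. F (hd w # m)) (tl w)"
        using **[of v "\<lambda>m. F (y # m)"] by (simp add: foldr_braid_at_Cons)
    qed
    then have "agree X (length ?w) (foldr B (rev [0..<i]) ?f)
       (foldr B (rev [0..<i]) (\<lambda>w. Q (\<lambda>m. F (hd w # m)) (tl w)))"
      using i by (intro foldr_braid_at_agree) auto
    from agreeD[OF this w]
    show "foldr B (rev [0..<i]) ?f ?w =
      foldr B (rev [0..<i]) (\<lambda>w. Q (\<lambda>m. F (hd w # m)) (tl w)) ?w" .
  qed
  finally show ?thesis .
qed

text \<open>Here the permutations are not inverted: the cycles act first and the smaller symmetrizer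
  is outermost, opposite to \<open>quantum_symmetrizer_Cons'\<close>. In this form the sum of the
  cycles becomes a skew derivation.\<close>

lemma quantum_symmetrizer_Cons:
  assumes "u \<in> lists X" "x \<in> X"
  shows "Q F (x # u) = (\<Sum>i\<le>length u. Q (\<lambda>m. foldr B [0..<i] F (x # m)) u)"
proof -
  let ?N = "length u" and ?w = "x # u"
  have *: "matsumoto_lift X C (length ?w) (shift_perm \<tau> \<circ> word_perm [0..<i]) F ?w =
      matsumoto_lift X C ?N \<tau> (\<lambda>m. foldr B [0..<i] F (x # m)) u"
    if "i \<le> ?N" and \<tau>: "\<tau> permutes {..<?N}" for i \<tau>
  proof -
    note s = red_shifted_coset[OF \<tau> that(1)]
    have "matsumoto_lift X C (length ?w) (shift_perm \<tau> \<circ> word_perm [0..<i]) F ?w =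
      foldr B (map Suc (red_word ?N \<tau>) @ [0..<i]) F ?w"
      using s assms by (intro matsumoto_lift_eq) simp_all
    then show ?thesis by (simp add: foldr_braid_at_Cons matsumoto_lift_def)
  qed
  have "Q F ?w = (\<Sum>i\<le>?N. \<Sum>\<tau> | \<tau> permutes {..<?N}.
      matsumoto_lift X C (length ?w) (shift_perm \<tau> \<circ> word_perm [0..<i]) F ?w)"
    unfolding quantum_symmetrizer_def by (simp add: sum_permutes_first)
  also have "\<dots> = (\<Sum>i\<le>?N. Q (\<lambda>m. foldr B [0..<i] F (x # m)) u)"
    unfolding quantum_symmetrizer_def by (intro sum.cong refl) (use * in auto)
  finally show ?thesis .
qed

section \<open>The kernel of the symmetrizer absorbs tensor factors\<close>

lemma foldr_vanishes:
  assumes "\<And>v. v \<in> lists X \<Longrightarrow> length v = length w \<Longrightarrow> f v = 0"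
    "w \<in> lists X" "set is \<subseteq> {i. Suc i < length w}"
  shows "foldr B is f w = 0"
proof -
  have "agree X (length w) (foldr B is f) (foldr B is (\<lambda>w. 0))"
    using assms by (intro foldr_braid_at_agree) (auto simp: agree_def)
  then show ?thesis using assms(2) by (simp add: agreeD foldr_braid_at_zero)
qed

text \<open>By iterating \<open>quantum_symmetrizer_snoc\<close>, the symmetrizer of degree
  \<open>k + n\<close> factors through the one on the first \<open>k\<close> factors, and so it
  kills whatever the latter kills for every fixed tail \<open>v\<close>.\<close>

lemma quantum_symmetrizer_vanishes_right:
  assumes "\<And>v m. v \<in> lists X \<Longrightarrow> length v = n \<Longrightarrow> m \<in> lists X \<Longrightarrow> length m = k \<Longrightarrow>
    Q (\<lambda>m. F (m @ v)) m = 0"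
  shows "w \<in> lists X \<Longrightarrow> length w = k + n \<Longrightarrow> Q F w = 0"
  using assms
proof (induction n arbitrary: F w)
  case 0
  from "0.prems"(3)[of "[]" w] "0.prems"(1,2) show ?case by simp
next
  case (Suc n)
  have IH: "Q (\<lambda>m. F (m @ [y])) v = 0" if "v \<in> lists X" "length v = k + n" "y \<in> X" for v y
  proof (rule Suc.IH[OF that(1,2)])
    fix v' m assume "v' \<in> lists X" "length v' = n" "m \<in> lists X" "length m = k"
    then show "Q (\<lambda>m. F ((m @ v') @ [y])) m = 0"
      using Suc.prems(3)[of "v' @ [y]" m] that(3) by simp
  qed
  obtain u x where w: "w = u @ [x]" "length u = k + n"
    using Suc.prems(2)
    by (metis add_Suc_right append_butlast_last_id diff_Suc_1 length_butlast list.size(3) nat.distinct(1))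
  have "foldr B [i..<length u] (\<lambda>w. Q (\<lambda>m. F (m @ [last w])) (butlast w)) w = 0" for i
  proof (rule foldr_vanishes)
    fix v' assume v': "v' \<in> lists X" "length v' = length w"
    then obtain v y where "v' = v @ [y]" "length v = k + n"
      using w by (metis append_butlast_last_id diff_Suc_1 length_append_singleton length_butlast list.size(3) nat.distinct(1))
    with v' show "Q (\<lambda>m. F (m @ [last v'])) (butlast v') = 0" by (simp add: IH)
  qed (use Suc.prems w in auto)
  then show ?case
    using Suc.prems(1) w quantum_symmetrizer_snoc[of u x F] by simp
qed

lemma quantum_symmetrizer_vanishes_left:
  assumes "\<And>v m. v \<in> lists X \<Longrightarrow> length v = n \<Longrightarrow> m \<in> lists X \<Longrightarrow> length m = k \<Longrightarrow>
    Q (\<lambda>m. F (v @ m)) m = 0"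
  shows "w \<in> lists X \<Longrightarrow> length w = n + k \<Longrightarrow> Q F w = 0"
  using assms
proof (induction n arbitrary: F w)
  case 0
  from "0.prems"(3)[of "[]" w] "0.prems"(1,2) show ?case by simp
next
  case (Suc n)
  have IH: "Q (\<lambda>m. F (y # m)) v = 0" if "v \<in> lists X" "length v = n + k" "y \<in> X" for v y
  proof (rule Suc.IH[OF that(1,2)])
    fix v' m assume "v' \<in> lists X" "length v' = n" "m \<in> lists X" "length m = k"
    then show "Q (\<lambda>m. F (y # v' @ m)) m = 0"
      using Suc.prems(3)[of "y # v'" m] that(3) by simp
  qed
  obtain x u where w: "w = x # u" "length u = n + k"
    using Suc.prems(2) by (cases w) auto
  have "foldr B (rev [0..<i]) (\<lambda>w. Q (\<lambda>m. F (hd w # m)) (tl w)) w = 0" if "i \<le> length u" for i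
  proof (rule foldr_vanishes)
    fix v' assume v': "v' \<in> lists X" "length v' = length w"
    then obtain y v where "v' = y # v" "length v = n + k"
      using w by (cases v') auto
    with v' show "Q (\<lambda>m. F (hd v' # m)) (tl v') = 0" by (simp add: IH)
  qed (use Suc.prems w that in auto)
  then show ?case
    using Suc.prems(1) w quantum_symmetrizer_Cons'[of u x F] by simp
qed

end

subsection \<open>The Nichols algebra as a quotient algebra\<close>

definition concat_prod :: "('x list \<Rightarrow> complex) \<Rightarrow> ('x list \<Rightarrow> complex) \<Rightarrow> 'x list \<Rightarrow> complex" where
  "concat_prod f h w = (\<Sum>i\<le>length w. f (take i w) * h (drop i w))"

lemma concat_prod_Nil [simp]: "concat_prod f h [] = f [] * h []"
  by (simp add: concat_prod_def)

text \<open>Separating the cut before the first letter gives a recursion on the word with a changed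
  first factor; associativity and the unit law on the right follow by induction with that factor
  arbitrary.\<close>

lemma concat_prod_Cons [simp]:
  "concat_prod f h (x # w) = f [] * h (x # w) + concat_prod (\<lambda>v. f (x # v)) h w"
proof -
  have "(\<Sum>i\<le>Suc (length w). f (take i (x # w)) * h (drop i (x # w))) =
    f [] * h (x # w) + (\<Sum>i\<le>length w. f (x # take i w) * h (drop i w))"
    by (subst sum.atMost_Suc_shift) simp
  then show ?thesis by (simp add: concat_prod_def)
qed

lemma concat_prod_add_left:
  "concat_prod (\<lambda>v. f v + f' v) h w = concat_prod f h w + concat_prod f' h w"
  by (simp add: concat_prod_def algebra_simps sum.distrib)

lemma concat_prod_add_right:
  "concat_prod f (\<lambda>v. h v + h' v) w = concat_prod f h w + concat_prod f h' w"
  by (simp add: concat_prod_def algebra_simps sum.distrib)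

lemma concat_prod_scale_left: "concat_prod (\<lambda>v. k * f v) h w = k * concat_prod f h w"
  by (simp add: concat_prod_def sum_distrib_left mult_ac)

lemma concat_prod_zero_left [simp]: "concat_prod (\<lambda>v. 0) h w = 0"
  by (simp add: concat_prod_def)

lemma concat_prod_assoc:
  "concat_prod (concat_prod f g) h w = concat_prod f (concat_prod g h) w"
proof (induction w arbitrary: f)
  case (Cons x w)
  then show ?case
    by (simp add: concat_prod_add_left concat_prod_scale_left algebra_simps)
qed simp

definition const_tensor :: "complex \<Rightarrow> 'x list \<Rightarrow> complex" where
  "const_tensor a = (\<lambda>w. if w = [] then a else 0)"

lemma concat_prod_const_left: "concat_prod (const_tensor a) h w = a * h w"
  by (cases w) (simp_all add: const_tensor_def)

lemma concat_prod_const_right: "concat_prod f (const_tensor a) w = f w * a"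
  by (induction w arbitrary: f) (simp_all add: const_tensor_def)

lemma tensor_algebra_simps [simp]:
  "f \<otimes>\<^bsub>tensor_algebra X\<^esub> h = concat_prod f h"
  "\<one>\<^bsub>tensor_algebra X\<^esub> = const_tensor 1"
  "\<zero>\<^bsub>tensor_algebra X\<^esub> = (\<lambda>w. 0)"
  "f \<oplus>\<^bsub>tensor_algebra X\<^esub> h = (\<lambda>w. f w + h w)"
  by (auto simp: tensor_algebra_def concat_prod_def const_tensor_def)

lemma carrier_tensor_algebra:
  "f \<in> carrier (tensor_algebra X) \<longleftrightarrow> finite {w. f w \<noteq> 0} \<and> (\<forall>w. f w \<noteq> 0 \<longrightarrow> w \<in> lists X)"
  by (auto simp: tensor_algebra_def)

lemma const_tensor_carrier [simp]: "const_tensor a \<in> carrier (tensor_algebra X)"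
proof -
  have "{w. const_tensor a w \<noteq> 0} \<subseteq> {[]}" by (auto simp: const_tensor_def)
  then show ?thesis
    by (auto simp: carrier_tensor_algebra const_tensor_def intro: finite_subset split: if_splits)
qed

lemma tensor_algebra_add_closed:
  assumes "f \<in> carrier (tensor_algebra X)" "h \<in> carrier (tensor_algebra X)"
  shows "(\<lambda>w. f w + h w) \<in> carrier (tensor_algebra X)"
proof -
  have "{w. f w + h w \<noteq> 0} \<subseteq> {w. f w \<noteq> 0} \<union> {w. h w \<noteq> 0}" by auto
  moreover have "finite ({w. f w \<noteq> 0} \<union> {w. h w \<noteq> 0})"
    "{w. f w \<noteq> 0} \<union> {w. h w \<noteq> 0} \<subseteq> lists X"
    using assms by (auto simp: tensor_algebra_def)
  ultimately have "finite {w. f w + h w \<noteq> 0}" "{w. f w + h w \<noteq> 0} \<subseteq> lists X"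
    by (blast intro: finite_subset)+
  then show ?thesis by (simp add: tensor_algebra_def)
qed

lemma tensor_algebra_mult_closed:
  assumes "f \<in> carrier (tensor_algebra X)" "h \<in> carrier (tensor_algebra X)"
  shows "concat_prod f h \<in> carrier (tensor_algebra X)"
proof -
  have *: "\<exists>u v. w = u @ v \<and> f u \<noteq> 0 \<and> h v \<noteq> 0" if "concat_prod f h w \<noteq> 0" for w
  proof -
    from sum.not_neutral_contains_not_neutral[OF that[unfolded concat_prod_def]]
    obtain i where "f (take i w) * h (drop i w) \<noteq> 0" by blast
    then have "w = take i w @ drop i w \<and> f (take i w) \<noteq> 0 \<and> h (drop i w) \<noteq> 0" by simp
    then show ?thesis by blast
  qed
  then have "{w. concat_prod f h w \<noteq> 0} \<subseteq> (\<lambda>(u, v). u @ v) ` ({u. f u \<noteq> 0} \<times> {v. h v \<noteq> 0})"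
    by fastforce
  then have "finite {w. concat_prod f h w \<noteq> 0}"
    using assms by (rule_tac finite_subset) (auto simp: carrier_tensor_algebra)
  moreover have "w \<in> lists X" if "concat_prod f h w \<noteq> 0" for w
  proof -
    obtain u v where uv: "w = u @ v" "f u \<noteq> 0" "h v \<noteq> 0" using *[OF \<open>concat_prod f h w \<noteq> 0\<close>] by blast
    then have "u \<in> lists X" "v \<in> lists X" using assms unfolding carrier_tensor_algebra by blast+
    with uv show ?thesis by simp
  qed
  ultimately show ?thesis unfolding carrier_tensor_algebra by blast
qed

lemma tensor_algebra_scale_closed:
  assumes "f \<in> carrier (tensor_algebra X)"
  shows "(\<lambda>w. k * f w) \<in> carrier (tensor_algebra X)"
proof -
  have "{w. k * f w \<noteq> 0} \<subseteq> {w. f w \<noteq> 0}" by auto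
  with assms show ?thesis by (auto simp: carrier_tensor_algebra intro: finite_subset)
qed

lemma zero_tensor_algebra_closed: "(\<lambda>w. 0) \<in> carrier (tensor_algebra X)"
  by (simp add: tensor_algebra_def)

lemma ring_tensor_algebra: "ring (tensor_algebra X)"
proof (rule ringI)
  show "abelian_group (tensor_algebra X)"
  proof (rule abelian_groupI)
    fix f assume f: "f \<in> carrier (tensor_algebra X)"
    from tensor_algebra_scale_closed[OF this, of "-1"]
    show "\<exists>h\<in>carrier (tensor_algebra X). h \<oplus>\<^bsub>tensor_algebra X\<^esub> f = \<zero>\<^bsub>tensor_algebra X\<^esub>"
      by (intro bexI[of _ "\<lambda>w. -1 * f w"]) auto
  qed (auto simp: tensor_algebra_add_closed zero_tensor_algebra_closed algebra_simps)
  show "Group.monoid (tensor_algebra X)"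
    by (rule monoidI)
       (auto simp: tensor_algebra_mult_closed concat_prod_assoc concat_prod_const_left
         concat_prod_const_right)
qed (auto simp: concat_prod_add_left concat_prod_add_right)

lemma a_inv_tensor_algebra:
  assumes "f \<in> carrier (tensor_algebra X)"
  shows "\<ominus>\<^bsub>tensor_algebra X\<^esub> f = (\<lambda>w. - f w)"
proof -
  interpret ring "tensor_algebra X" by (rule ring_tensor_algebra)
  show ?thesis
    using assms tensor_algebra_scale_closed[OF assms, of "-1"] by (intro minus_equality) auto
qed

lemma field_complex_ring: "field complex_ring"
proof (rule cring.cring_fieldI)
  show "cring complex_ring"
    by (rule cringI[OF abelian_groupI comm_monoidI])
       (auto simp: algebra_simps intro: exI[of _ "- _"])
  show "Units complex_ring = carrier complex_ring - {\<zero>\<^bsub>complex_ring\<^esub>}"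
  proof (rule equalityI; rule subsetI)
    fix a assume "a \<in> carrier complex_ring - {\<zero>\<^bsub>complex_ring\<^esub>}"
    then show "a \<in> Units complex_ring"
      by (auto simp: Units_def intro: exI[of _ "inverse a"])
  qed (auto simp: Units_def)
qed

lemma quantum_symmetrizer_Nil: "quantum_symmetrizer X C f [] = f []"
proof -
  have "(SOME is. reduced_word 0 id is) = []"
    using some_reduced_word(1)[of id 0] by (simp add: permutes_id)
  moreover have "{\<sigma>::nat \<Rightarrow> nat. \<sigma> permutes {}} = {id}" by (auto simp: permutes_empty)
  ultimately show ?thesis by (simp add: quantum_symmetrizer_def matsumoto_lift_def)
qed

section \<open>The kernel of the symmetrizer as an ideal\<close>

context braided_space
begin

abbreviation "T \<equiv> tensor_algebra X"
abbreviation "I \<equiv> nichols_ideal X C"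

lemma braid_at_support:
  assumes f: "\<And>v. v \<notin> lists X \<Longrightarrow> f v = 0" and w: "w \<notin> lists X" and i: "Suc i < length w"
  shows "B i f w = 0"
  unfolding braid_at_def
proof (rule sum.neutral, clarify)
  fix p q assume pq: "p \<in> X" "q \<in> X"
  show "C p q (w ! i, w ! Suc i) * f (w[i := p, Suc i := q]) = 0"
  proof (rule ccontr)
    assume *: "C p q (w ! i, w ! Suc i) * f (w[i := p, Suc i := q]) \<noteq> 0"
    then have X: "w ! i \<in> X" "w ! Suc i \<in> X" using C_outside[OF pq, of "(w ! i, w ! Suc i)"] by auto
    have "w[i := p, Suc i := q] \<in> lists X" using * f by fastforce
    then have "set (w[i := p, Suc i := q]) \<subseteq> X" by (simp only: lists_eq_set mem_Collect_eq)
    \<comment> \<open>Putting back the two old letters, which belong to \<open>X\<close> by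
      \<open>C_outside\<close>, turns a word over \<open>X\<close> into \<open>w\<close>.\<close>
    then have "set (w[i := p, Suc i := q, i := w ! i, Suc i := w ! Suc i]) \<subseteq> X"
      using X by (intro set_update_subsetI[of "w[i := p, Suc i := q, i := w ! i]"]
        set_update_subsetI[of "w[i := p, Suc i := q]"])
    moreover have "w[i := p, Suc i := q, i := w ! i, Suc i := w ! Suc i] = w"
      using i by (intro nth_equalityI) (auto simp: nth_list_update)
    ultimately show False using w by auto
  qed
qed

lemma foldr_braid_at_support:
  assumes f: "\<And>v. v \<notin> lists X \<Longrightarrow> f v = 0" and "w \<notin> lists X" "set is \<subseteq> {i. Suc i < length w}"
  shows "foldr B is f w = 0"
  using assms(2,3)
proof (induction "is" arbitrary: w)
  case Nil
  then show ?case by (simp add: f)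
next
  case (Cons i "is")
  let ?f = "\<lambda>v. if length v = length w then foldr B is f v else 0"
  have "B i (foldr B is f) w = B i ?f w"
    by (rule braid_at_cong_length) simp
  also have "\<dots> = 0" using Cons by (intro braid_at_support) auto
  finally show ?case by simp
qed

lemma quantum_symmetrizer_support:
  assumes "f \<in> carrier T" "w \<notin> lists X"
  shows "Q f w = 0"
  unfolding quantum_symmetrizer_def matsumoto_lift_def
proof (rule sum.neutral, clarify)
  fix \<sigma> assume "\<sigma> permutes {..<length w}"
  from some_reduced_word(1)[OF this] show "foldr B (red_word (length w) \<sigma>) f w = 0"
    using assms by (intro foldr_braid_at_support) (auto simp: carrier_tensor_algebra)
qed

text \<open>On words that leave \<open>X\<close> the symmetrizer vanishes automatically, so only
  words over \<open>X\<close> remain to be tested.\<close>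

lemma nichols_ideal_iff: "f \<in> I \<longleftrightarrow> f \<in> carrier T \<and> (\<forall>w\<in>lists X. Q f w = 0)"
  using quantum_symmetrizer_support by (fastforce simp: nichols_ideal_def)

lemma nichols_ideal_mult:
  assumes "a \<in> I" "x \<in> carrier T"
  shows "concat_prod a x \<in> I" "concat_prod x a \<in> I"
proof -
  have a: "a \<in> carrier T" "\<And>w. w \<in> lists X \<Longrightarrow> Q a w = 0"
    using assms by (auto simp: nichols_ideal_iff)
  have "Q (concat_prod a x) w = 0" if w: "w \<in> lists X" for w
  proof -
    \<comment> \<open>Only words of the length of \<open>w\<close> matter. For them the range of
      cuts is constant, so the product becomes a fixed sum and linearity applies; each summand is a
      tensor product cut at \<open>i\<close>.\<close>
    have "Q (concat_prod a x) w = Q (\<lambda>u. \<Sum>i\<le>length w. a (take i u) * x (drop i u)) w"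
      by (rule quantum_symmetrizer_agree) (auto simp: agree_def concat_prod_def w)
    also have "\<dots> = (\<Sum>i\<le>length w. Q (\<lambda>u. a (take i u) * x (drop i u)) w)"
      by (rule quantum_symmetrizer_sum)
    also have "\<dots> = 0"
    proof (rule sum.neutral, clarify)
      fix i assume i: "i \<le> length w"
      show "Q (\<lambda>u. a (take i u) * x (drop i u)) w = 0"
      proof (rule quantum_symmetrizer_vanishes_right[where k = i and n = "length w - i"])
        fix v m assume vm: "v \<in> lists X" "m \<in> lists X" "length m = i"
        have "Q (\<lambda>m. a (take i (m @ v)) * x (drop i (m @ v))) m = Q (\<lambda>m. x v * a m) m"
          using vm by (intro quantum_symmetrizer_agree) (auto simp: agree_def)
        then show "Q (\<lambda>m. a (take i (m @ v)) * x (drop i (m @ v))) m = 0"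
          using a vm by (simp add: quantum_symmetrizer_scale)
      qed (use w i in auto)
    qed
    finally show ?thesis .
  qed
  then show "concat_prod a x \<in> I"
    using a assms by (simp add: nichols_ideal_iff tensor_algebra_mult_closed)
  have "Q (concat_prod x a) w = 0" if w: "w \<in> lists X" for w
  proof -
    have "Q (concat_prod x a) w = Q (\<lambda>u. \<Sum>i\<le>length w. x (take i u) * a (drop i u)) w"
      by (rule quantum_symmetrizer_agree) (auto simp: agree_def concat_prod_def w)
    also have "\<dots> = (\<Sum>i\<le>length w. Q (\<lambda>u. x (take i u) * a (drop i u)) w)"
      by (rule quantum_symmetrizer_sum)
    also have "\<dots> = 0"
    proof (rule sum.neutral, clarify)
      fix i assume i: "i \<le> length w"
      show "Q (\<lambda>u. x (take i u) * a (drop i u)) w = 0"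
      proof (rule quantum_symmetrizer_vanishes_left[where n = i and k = "length w - i"])
        fix v m assume vm: "v \<in> lists X" "length v = i" "m \<in> lists X"
        have "Q (\<lambda>m. x (take i (v @ m)) * a (drop i (v @ m))) m = Q (\<lambda>m. x v * a m) m"
          using vm by (intro quantum_symmetrizer_agree) (auto simp: agree_def)
        then show "Q (\<lambda>m. x (take i (v @ m)) * a (drop i (v @ m))) m = 0"
          using a vm by (simp add: quantum_symmetrizer_scale)
      qed (use w i in auto)
    qed
    finally show ?thesis .
  qed
  then show "concat_prod x a \<in> I"
    using a assms by (simp add: nichols_ideal_iff tensor_algebra_mult_closed)
qed

lemma ideal_nichols: "ideal I T"
proof (rule idealI[OF ring_tensor_algebra])
  interpret T: ring T by (rule ring_tensor_algebra)
  show "subgroup I (add_monoid T)"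
  proof (rule T.add.subgroupI)
    show "I \<subseteq> carrier T" by (auto simp: nichols_ideal_iff)
    have "(\<lambda>w. 0) \<in> I"
      using quantum_symmetrizer_scale[of X C 0 "\<lambda>w. 0"] T.zero_closed
      by (simp add: nichols_ideal_iff)
    then show "I \<noteq> {}" by blast
    fix a b assume ab: "a \<in> I" "b \<in> I"
    then show "a \<oplus>\<^bsub>T\<^esub> b \<in> I"
      by (simp add: nichols_ideal_iff quantum_symmetrizer_add tensor_algebra_add_closed)
    have "Q (\<lambda>w. - a w) w = - Q a w" for w
      using quantum_symmetrizer_scale[of X C "-1" a w] by simp
    then show "\<ominus>\<^bsub>T\<^esub> a \<in> I"
      using ab T.a_inv_closed[of a] by (simp add: nichols_ideal_iff a_inv_tensor_algebra)
  qed
qed (auto simp: nichols_ideal_mult)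

section \<open>The quotient ring and its dimension\<close>

sublocale nichols: ideal I T by (rule ideal_nichols)

abbreviation "A \<equiv> nichols_algebra X C"
abbreviation "K \<equiv> nichols_scalars X C"
abbreviation "coset f \<equiv> I +>\<^bsub>T\<^esub> f"

lemma ring_nichols: "ring A"
  unfolding nichols_algebra_def by (rule nichols.quotient_is_ring)

sublocale nichols_ring: ring A by (rule ring_nichols)

lemma coset_hom: "ring_hom_ring T A coset"
  unfolding nichols_algebra_def by (rule nichols.rcos_ring_hom_ring)

lemma coset_mult: "f \<in> carrier T \<Longrightarrow> h \<in> carrier T \<Longrightarrow>
    coset f \<otimes>\<^bsub>A\<^esub> coset h = coset (concat_prod f h)"
  and coset_add: "f \<in> carrier T \<Longrightarrow> h \<in> carrier T \<Longrightarrow>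
    coset f \<oplus>\<^bsub>A\<^esub> coset h = coset (\<lambda>w. f w + h w)"
  and coset_carrier: "f \<in> carrier T \<Longrightarrow> coset f \<in> carrier A"
  using ring_hom_mult[OF ring_hom_ring.homh[OF coset_hom]]
    ring_hom_add[OF ring_hom_ring.homh[OF coset_hom]]
    ring_hom_closed[OF ring_hom_ring.homh[OF coset_hom]] by simp_all

lemma coset_zero: "coset (\<lambda>w. 0) = \<zero>\<^bsub>A\<^esub>"
  using ring_hom_zero[OF ring_hom_ring.homh[OF coset_hom] ring_tensor_algebra ring_nichols] by simp

lemma carrier_nichols: "carrier A = coset ` carrier T"
  by (auto simp: nichols_algebra_def FactRing_def A_RCOSETS_def' )

lemma coset_eq_iff:
  assumes "f \<in> carrier T" "h \<in> carrier T"
  shows "coset f = coset h \<longleftrightarrow> (\<lambda>w. f w - h w) \<in> I"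
proof -
  have "f \<ominus>\<^bsub>T\<^esub> h = (\<lambda>w. f w - h w)"
    using assms by (simp add: a_minus_def a_inv_tensor_algebra)
  then show ?thesis
    using nichols.quotient_eq_iff_same_a_r_cos[OF ideal_nichols assms] by simp
qed

lemma nichols_scalars_eq: "K = range (\<lambda>a. coset (const_tensor a))"
  by (auto simp: nichols_scalars_def const_tensor_def)

lemma subfield_nichols_scalars: "subfield K A"
proof -
  interpret R: field complex_ring by (rule field_complex_ring)
  have hom: "ring_hom_ring complex_ring A (\<lambda>a. coset (const_tensor a))"
  proof (rule ring_hom_ringI[OF R.ring_axioms ring_nichols])
    fix a b :: complex
    have "const_tensor (a * b) = concat_prod (const_tensor a) (const_tensor b :: 'x list \<Rightarrow> _)"
      by (rule ext) (simp add: concat_prod_const_left, simp add: const_tensor_def)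
    then show "coset (const_tensor (a \<otimes>\<^bsub>complex_ring\<^esub> b)) =
        coset (const_tensor a) \<otimes>\<^bsub>A\<^esub> coset (const_tensor b)"
      by (simp add: coset_mult)
    have "const_tensor (a + b) = (\<lambda>w::'x list. const_tensor a w + const_tensor b w)"
      by (auto simp: const_tensor_def)
    then show "coset (const_tensor (a \<oplus>\<^bsub>complex_ring\<^esub> b)) =
        coset (const_tensor a) \<oplus>\<^bsub>A\<^esub> coset (const_tensor b)"
      by (simp add: coset_add)
    show "coset (const_tensor \<one>\<^bsub>complex_ring\<^esub>) = \<one>\<^bsub>A\<^esub>"
      using ring_hom_one[OF ring_hom_ring.homh[OF coset_hom]] by simp
  qed (simp add: coset_carrier)
  \<comment> \<open>The symmetrizer is the identity in degree 0, so the empty word witnesses that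
    the quotient is not zero.\<close>
  have "const_tensor 1 \<notin> I"
    by (auto simp: nichols_ideal_iff quantum_symmetrizer_Nil const_tensor_def intro!: bexI[of _ "[]"])
  then have "\<one>\<^bsub>A\<^esub> \<noteq> \<zero>\<^bsub>A\<^esub>"
    using nichols.rcos_const_imp_mem[of "const_tensor 1"]
    by (auto simp: nichols_algebra_def FactRing_def)
  from ring_hom_ring.img_is_subfield(2)[OF hom R.carrier_is_subfield this]
  show ?thesis by (simp add: nichols_scalars_eq)
qed

text \<open>A finite spanning set has representatives of bounded degree. Since the symmetrizer
  preserves the degree, a tensor whose image is nonzero beyond that bound lies outside the
  span.\<close>

lemma not_finite_dim_nichols:
  assumes "\<And>L. \<exists>f\<in>carrier T. \<exists>w\<in>lists X. L \<le> length w \<and> Q f w \<noteq> 0"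
  shows "\<not> finite_dim_nichols X C"
proof
  assume "finite_dim_nichols X C"
  then obtain n where "nichols_ring.dimension n K (carrier A)"
    unfolding finite_dim_nichols_def nichols_ring.finite_dimension_def by blast
  from nichols_ring.exists_base[OF subfield_nichols_scalars this] obtain Us
    where Us: "set Us \<subseteq> carrier A" "nichols_ring.Span K Us = carrier A" by blast
  have "\<exists>L. \<forall>U\<in>set Us. \<exists>u\<in>carrier T. U = coset u \<and> (\<forall>w. L \<le> length w \<longrightarrow> u w = 0)"
    using Us(1)
  proof (induction Us)
    case (Cons U Us)
    then obtain L where L: "\<forall>U\<in>set Us. \<exists>u\<in>carrier T. U = coset u \<and> (\<forall>w. L \<le> length w \<longrightarrow> u w = 0)"
      by auto
    from Cons obtain u where u: "u \<in> carrier T" "U = coset u" by (auto simp: carrier_nichols)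
    then have fin: "finite (length ` {w. u w \<noteq> 0})" by (simp add: carrier_tensor_algebra)
    obtain M where u0: "\<And>w. M \<le> length w \<Longrightarrow> u w = 0"
    proof
      fix w :: "'x list" assume w: "Suc (Max (length ` {w. u w \<noteq> 0})) \<le> length w"
      show "u w = 0"
      proof (rule ccontr)
        assume "u w \<noteq> 0"
        then have "length w \<le> Max (length ` {w. u w \<noteq> 0})" using fin by (intro Max_ge) auto
        with w show False by simp
      qed
    qed
    have "\<exists>u'\<in>carrier T. V = coset u' \<and> (\<forall>w. max L M \<le> length w \<longrightarrow> u' w = 0)"
      if V: "V \<in> set (U # Us)" for V
    proof (cases "V = U")
      case True
      with u u0 have "V = coset u \<and> (\<forall>w. max L M \<le> length w \<longrightarrow> u w = 0)" by simp
      with u show ?thesis by blast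
    next
      case False
      with V have "V \<in> set Us" by simp
      with L obtain u' where "u' \<in> carrier T" "V = coset u'" "\<forall>w. L \<le> length w \<longrightarrow> u' w = 0"
        by blast
      then have "V = coset u' \<and> (\<forall>w. max L M \<le> length w \<longrightarrow> u' w = 0)" by simp
      with \<open>u' \<in> carrier T\<close> show ?thesis by blast
    qed
    then show ?case by blast
  qed simp
  then obtain L where
    L: "\<And>U. U \<in> set Us \<Longrightarrow> \<exists>u\<in>carrier T. U = coset u \<and> (\<forall>w. L \<le> length w \<longrightarrow> u w = 0)" by blast
  obtain f w where f: "f \<in> carrier T" "w \<in> lists X" "L \<le> length w" "Q f w \<noteq> 0"
    using assms by blast
  have comb: "\<exists>g\<in>carrier T. nichols_ring.combine Ks Us = coset g \<and> (\<forall>w. L \<le> length w \<longrightarrow> g w = 0)"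
    if "set Ks \<subseteq> K" for Ks
    using that L
  proof (induction Ks Us rule: nichols_ring.combine.induct)
    case (1 k Ks U Us)
    then obtain g where g: "g \<in> carrier T" "nichols_ring.combine Ks Us = coset g"
      "\<And>w. L \<le> length w \<Longrightarrow> g w = 0" by auto
    from "1.prems" obtain u where u: "u \<in> carrier T" "U = coset u" "\<And>w. L \<le> length w \<Longrightarrow> u w = 0"
      by auto
    from "1.prems" obtain a where a: "k = coset (const_tensor a)" by (auto simp: nichols_scalars_eq)
    have "concat_prod (const_tensor a) u = (\<lambda>w. a * u w)" by (auto simp: concat_prod_const_left)
    then have "k \<otimes>\<^bsub>A\<^esub> U = coset (\<lambda>w. a * u w)" using u a by (simp add: coset_mult)
    then have "nichols_ring.combine (k # Ks) (U # Us) = coset (\<lambda>w. a * u w + g w)"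
      using g u by (simp add: coset_add tensor_algebra_scale_closed)
    then show ?case
      using g u by (intro bexI[of _ "\<lambda>w. a * u w + g w"])
        (auto simp: tensor_algebra_add_closed tensor_algebra_scale_closed)
  next
    case ("2_1" Us)
    show ?case
      by (intro bexI[of _ "\<lambda>w. 0"]) (auto simp: coset_zero zero_tensor_algebra_closed)
  next
    case ("2_2" Ks)
    show ?case
      by (intro bexI[of _ "\<lambda>w. 0"]) (auto simp: coset_zero zero_tensor_algebra_closed)
  qed
  have "coset f \<in> nichols_ring.Span K Us" using f Us by (simp add: coset_carrier)
  then obtain Ks where Ks: "set Ks \<subseteq> K" "coset f = nichols_ring.combine Ks Us"
    unfolding nichols_ring.Span_eq_combine_set[OF subfield_nichols_scalars Us(1)] by blast
  with comb obtain g where g: "g \<in> carrier T" "coset f = coset g" "\<And>w. L \<le> length w \<Longrightarrow> g w = 0"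
    by metis
  then have "(\<lambda>w. f w - g w) \<in> I" using f by (simp add: coset_eq_iff)
  then have "Q (\<lambda>w. f w - g w) w = 0" using f by (simp add: nichols_ideal_iff)
  \<comment> \<open>The value at \<open>w\<close> depends only on coefficients of words as long as
    \<open>w\<close>, where \<open>g\<close> is zero.\<close>
  moreover have "Q (\<lambda>w. f w - g w) w = Q f w"
    using f g(3) by (intro quantum_symmetrizer_agree) (auto simp: agree_def)
  ultimately show False using f by simp
qed

text \<open>All tensors supported in degrees above \<open>D\<close> lie in the ideal, so the
  finitely many words of length at most \<open>D\<close> span the quotient.\<close>

lemma finite_dim_nicholsI:
  assumes "\<And>f w. w \<in> lists X \<Longrightarrow> D < length w \<Longrightarrow> Q f w = 0"
  shows "finite_dim_nichols X C"
proof -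
  let ?W = "{w \<in> lists X. length w \<le> D}"
  let ?\<delta> = "\<lambda>v w :: 'x list. if w = v then 1 else 0 :: complex"
  have finW: "finite ?W" using finite_lists_length_le[OF finite_X, of D] by (simp add: lists_eq_set)
  obtain vs where vs: "set vs = ?W" using finite_list[OF finW] by blast
  have \<delta>: "?\<delta> v \<in> carrier T" if "v \<in> lists X" for v
  proof -
    have "{w. ?\<delta> v w \<noteq> 0} \<subseteq> {v}" by auto
    with that show ?thesis by (auto simp: carrier_tensor_algebra intro: finite_subset split: if_splits)
  qed
  define Us where "Us = map (\<lambda>v. coset (?\<delta> v)) vs"
  have Us: "set Us \<subseteq> carrier A"
  proof
    fix U assume "U \<in> set Us"
    then obtain v where "v \<in> lists X" "U = coset (?\<delta> v)" using vs by (auto simp: Us_def)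
    then show "U \<in> carrier A" using coset_carrier[OF \<delta>] by simp
  qed
  note Span = nichols_ring.Span_subgroup_props[OF subfield_nichols_scalars Us]
  have base: "coset (?\<delta> v) \<in> nichols_ring.Span K Us" if "v \<in> ?W" for v
  proof -
    have "coset (?\<delta> v) \<in> set Us" using that vs by (auto simp: Us_def)
    then show ?thesis
      using nichols_ring.Span_base_incl[OF subfield_nichols_scalars Us] by blast
  qed
  have fin_supp: "\<forall>f\<in>carrier T. (\<forall>w. f w \<noteq> 0 \<longrightarrow> w \<in> S) \<longrightarrow> coset f \<in> nichols_ring.Span K Us"
    if "finite S" "S \<subseteq> ?W" for S
    using that
  proof (induction S)
    case empty
    have "coset f = \<zero>\<^bsub>A\<^esub>" if "\<forall>w. f w \<noteq> 0 \<longrightarrow> w \<in> {}" for f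
    proof -
      have "f = (\<lambda>w. 0)" using that by auto
      then show ?thesis by (simp only: coset_zero)
    qed
    with Span(2) show ?case by metis
  next
    case (insert v S)
    show ?case
    proof (intro ballI impI)
      fix f assume f: "f \<in> carrier T" "\<forall>w. f w \<noteq> 0 \<longrightarrow> w \<in> insert v S"
      define f' where "f' = (\<lambda>w. f w + - f v * ?\<delta> v w)"
      have v: "v \<in> lists X" "v \<in> ?W" using insert by auto
      have f': "f' \<in> carrier T"
        unfolding f'_def by (intro tensor_algebra_add_closed tensor_algebra_scale_closed f \<delta> v)
      have "\<forall>w. f' w \<noteq> 0 \<longrightarrow> w \<in> S" using f(2) by (auto simp: f'_def split: if_splits)
      with f' insert have S1: "coset f' \<in> nichols_ring.Span K Us" by auto
      have "coset (const_tensor (f v)) \<in> K" by (auto simp: nichols_scalars_eq)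
      from nichols_ring.Span_smult_closed[OF subfield_nichols_scalars Us this base[OF v(2)]]
      have S2: "coset (const_tensor (f v)) \<otimes>\<^bsub>A\<^esub> coset (?\<delta> v) \<in> nichols_ring.Span K Us" .
      have "concat_prod (const_tensor (f v)) (?\<delta> v) = (\<lambda>w. f v * ?\<delta> v w)"
        by (rule ext) (rule concat_prod_const_left)
      then have "coset (const_tensor (f v)) \<otimes>\<^bsub>A\<^esub> coset (?\<delta> v) = coset (\<lambda>w. f v * ?\<delta> v w)"
        using \<delta>[OF v(1)] by (simp add: coset_mult)
      then have "coset f' \<oplus>\<^bsub>A\<^esub> (coset (const_tensor (f v)) \<otimes>\<^bsub>A\<^esub> coset (?\<delta> v)) =
          coset (\<lambda>w. f' w + f v * ?\<delta> v w)"
        using coset_add[OF f' tensor_algebra_scale_closed[OF \<delta>[OF v(1)]], of "f v"] by simp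
      also have "(\<lambda>w. f' w + f v * ?\<delta> v w) = f" by (auto simp: f'_def)
      finally show "coset f \<in> nichols_ring.Span K Us" using Span(3)[OF S1 S2] by simp
    qed
  qed
  have "carrier A \<subseteq> nichols_ring.Span K Us"
  proof
    fix U assume "U \<in> carrier A"
    then obtain f where f: "f \<in> carrier T" "U = coset f" by (auto simp: carrier_nichols)
    \<comment> \<open>The truncation of \<open>f\<close> at degree \<open>D\<close> represents the
      same coset, because the discarded part is in the ideal.\<close>
    define h where "h = (\<lambda>w. if length w \<le> D then f w else 0)"
    have "{w. h w \<noteq> 0} \<subseteq> {w. f w \<noteq> 0}" by (auto simp: h_def)
    then have h: "h \<in> carrier T"
      using f by (auto simp: carrier_tensor_algebra h_def intro: finite_subset split: if_splits)
    have "(\<lambda>w. f w - h w) \<in> I"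
    proof -
      have "(\<lambda>w. f w + -1 * h w) \<in> carrier T"
        by (intro tensor_algebra_add_closed tensor_algebra_scale_closed f h)
      moreover have "Q (\<lambda>w. f w - h w) w = 0" if w: "w \<in> lists X" for w
      proof (cases "length w \<le> D")
        case True
        have "Q (\<lambda>w. f w - h w) w = Q (\<lambda>w. 0 * f w) w"
          using w True by (intro quantum_symmetrizer_agree) (auto simp: agree_def h_def)
        then show ?thesis by (simp only: quantum_symmetrizer_scale) simp
      qed (use assms w in simp)
      ultimately show ?thesis by (simp add: nichols_ideal_iff)
    qed
    then have "U = coset h" using f h by (simp add: coset_eq_iff)
    moreover have "\<forall>w. h w \<noteq> 0 \<longrightarrow> w \<in> ?W"
      using h by (auto simp: carrier_tensor_algebra) (auto simp: h_def split: if_splits)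
    ultimately show "U \<in> nichols_ring.Span K Us" using fin_supp[OF finW] h by blast
  qed
  with Span(1) have "nichols_ring.Span K Us = carrier A" by blast
  with nichols_ring.Span_finite_dimension[OF subfield_nichols_scalars Us]
  show ?thesis by (simp add: finite_dim_nichols_def)
qed

end

subsection \<open>Monomial braidings\<close>

text \<open>
  The braiding maps \<open>v \<otimes> L v u\<close> to \<open>c u v\<close> times \<open>u \<otimes> v\<close>: it is described through its outputs,
  because \<open>braid_at\<close> acts on coefficient functions.
\<close>

locale monomial_braiding =
  fixes X :: "'x set" and C :: "'x braiding" and c :: "'x \<Rightarrow> 'x \<Rightarrow> complex" and L :: "'x \<Rightarrow> 'x \<Rightarrow> 'x"
  assumes finite: "finite X"
    and L_closed: "x \<in> X \<Longrightarrow> y \<in> X \<Longrightarrow> L y x \<in> X"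
    and C_eq: "p \<in> X \<Longrightarrow> q \<in> X \<Longrightarrow>
      C p q (u, v) = (if u \<in> X \<and> v \<in> X \<and> p = v \<and> q = L v u then c u v else 0)"
    and L_braid: "x \<in> X \<Longrightarrow> y \<in> X \<Longrightarrow> z \<in> X \<Longrightarrow> L z (L y x) = L (L z y) (L z x)"
    and c_braid: "x \<in> X \<Longrightarrow> y \<in> X \<Longrightarrow> z \<in> X \<Longrightarrow>
      c x y * c (L y x) z = c x z * c (L z x) (L z y)"
begin

lemma braid_at_monomial:
  assumes "w \<in> lists X" "Suc i < length w"
  shows "braid_at X C i f w =
    c (w ! i) (w ! Suc i) * f (w[i := w ! Suc i, Suc i := L (w ! Suc i) (w ! i)])"
proof -
  let ?u = "w ! i" and ?v = "w ! Suc i"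
  have X: "?u \<in> X" "?v \<in> X" using assms by (auto simp: in_lists_conv_set)
  have "braid_at X C i f w = (\<Sum>z\<in>X \<times> X. if z = (?v, L ?v ?u)
      then c ?u ?v * f (w[i := ?v, Suc i := L ?v ?u]) else 0)"
    unfolding braid_at_def
  proof (intro sum.cong refl)
    fix z assume "z \<in> X \<times> X"
    then obtain a b where "z = (a, b)" "a \<in> X" "b \<in> X" by auto
    then show "(case z of (p, q) \<Rightarrow> C p q (?u, ?v) * f (w[i := p, Suc i := q])) =
        (if z = (?v, L ?v ?u) then c ?u ?v * f (w[i := ?v, Suc i := L ?v ?u]) else 0)"
      by (cases "a = ?v \<and> b = L ?v ?u") (auto simp: C_eq X)
  qed
  also have "\<dots> = c ?u ?v * f (w[i := ?v, Suc i := L ?v ?u])"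
    using finite X L_closed by (subst sum.delta) auto
  finally show ?thesis .
qed

lemma list_update_lists: "w \<in> lists X \<Longrightarrow> a \<in> X \<Longrightarrow> w[i := a] \<in> lists X"
  unfolding lists_eq_set mem_Collect_eq by (intro set_update_subsetI)

sublocale braided_space X C
proof
  show "p \<in> X \<Longrightarrow> q \<in> X \<Longrightarrow> r \<notin> X \<times> X \<Longrightarrow> C p q r = 0" for p q r
    by (cases r) (auto simp: C_eq)
next
  fix w i f assume w: "w \<in> lists X" and i: "Suc (Suc i) < length w"
  define x y z where xyz: "x = w ! i" "y = w ! Suc i" "z = w ! Suc (Suc i)"
  have X: "x \<in> X" "y \<in> X" "z \<in> X"
    using w i by (auto simp: in_lists_conv_set xyz)
  note [simp] = braid_at_monomial list_update_lists L_closed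
  have "braid_at X C i (braid_at X C (Suc i) (braid_at X C i f)) w =
    c x y * (c (L y x) z * (c y z *
      f (w[i := y, Suc i := L y x, Suc i := z, Suc (Suc i) := L z (L y x), i := z, Suc i := L z y])))"
    using w i X by (simp add: xyz[symmetric])
  moreover have "braid_at X C (Suc i) (braid_at X C i (braid_at X C (Suc i) f)) w =
    c y z * (c x z * (c (L z x) (L z y) *
      f (w[Suc i := z, Suc (Suc i) := L z y, i := z, Suc i := L z x,
         Suc i := L z y, Suc (Suc i) := L (L z y) (L z x)])))"
    using w i X by (simp add: xyz[symmetric])
  moreover have "w[i := y, Suc i := L y x, Suc i := z, Suc (Suc i) := L z (L y x), i := z, Suc i := L z y] =
    w[Suc i := z, Suc (Suc i) := L z y, i := z, Suc i := L z x,
         Suc i := L z y, Suc (Suc i) := L (L z y) (L z x)]"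
    unfolding L_braid[OF X] using i by (intro nth_equalityI) (auto simp: nth_list_update)
  \<comment> \<open>The factor \<open>c y z\<close> occurs on both sides of the braid equation; what
    remains is \<open>c_braid\<close>.\<close>
  moreover have "c x y * (c (L y x) z * (c y z * k)) = c y z * (c x z * (c (L z x) (L z y) * k))" for k
  proof -
    have "c x y * (c (L y x) z * (c y z * k)) = (c x y * c (L y x) z) * (c y z * k)" by simp
    also have "\<dots> = (c x z * c (L z x) (L z y)) * (c y z * k)" by (simp only: c_braid[OF X])
    finally show ?thesis by (simp only: mult_ac)
  qed
  ultimately show "braid_at X C i (braid_at X C (Suc i) (braid_at X C i f)) w =
      braid_at X C (Suc i) (braid_at X C i (braid_at X C (Suc i) f)) w"
    by (simp only:)
qed (rule finite)

text \<open>Every reduced word fixes the \<open>N\<close>-th tensor power of \<open>p\<close> with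
  coefficient 1, so the symmetrizer multiplies it by \<open>fact N\<close>, which is nonzero in
  characteristic 0.\<close>

lemma not_finite_dim_nichols_fixed_point:
  assumes "p \<in> X" "L p p = p" "c p p = 1"
  shows "\<not> finite_dim_nichols X C"
proof (rule not_finite_dim_nichols)
  fix N
  let ?w = "replicate N p"
  have w: "?w \<in> lists X" using assms(1) by (auto simp: in_lists_conv_set)
  have step: "B i f ?w = f ?w" if "Suc i < N" for i f
  proof -
    have "?w[i := p, Suc i := p] = ?w"
      using that by (intro nth_equalityI) (auto simp: nth_list_update)
    with that w assms show ?thesis by (simp add: braid_at_monomial)
  qed
  have fix_word: "foldr B is f ?w = f ?w" if "set is \<subseteq> {i. Suc i < N}" for "is" f
    using that by (induction "is") (auto simp: step)
  let ?f = "\<lambda>w. if w = ?w then 1 else 0 :: complex"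
  have "{w. ?f w \<noteq> 0} = {?w}" by auto
  then have f: "?f \<in> carrier T" using w by (simp add: tensor_algebra_def)
  have "Q ?f ?w = (\<Sum>\<sigma> | \<sigma> permutes {..<N}. 1)"
    unfolding quantum_symmetrizer_def matsumoto_lift_def length_replicate
    by (intro sum.cong refl) (subst fix_word, use some_reduced_word(1) in auto)
  also have "\<dots> = of_nat (fact N)" by (simp add: card_permutations)
  finally have "Q ?f ?w \<noteq> 0" by simp
  with f w show "\<exists>f\<in>carrier T. \<exists>w\<in>lists X. N \<le> length w \<and> Q f w \<noteq> 0"
    by (intro bexI[of _ ?f] bexI[of _ ?w]) simp_all
qed

end

subsection \<open>Negative flips\<close>

lemma sign_word_perm: "sign (word_perm is) = (-1) ^ length is"
proof (induction "is")
  case Nil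
  show "sign (word_perm []) = (-1) ^ length []" by (simp add: sign_id)
next
  case (Cons i "is")
  have "word_perm is permutes {..<Suc (Suc (Max (set is)))}"
    by (rule word_perm_permutes) (auto simp: less_Suc_eq_le)
  then have "permutation (word_perm is)" by (rule permutes_imp_permutation[rotated]) simp
  then have "sign (word_perm (i # is)) = sign (transpose i (Suc i)) * sign (word_perm is)"
    by (simp only: word_perm_Cons) (rule sign_compose, simp_all add: permutation_swap_id)
  then show "sign (word_perm (i # is)) = (-1) ^ length (i # is)"
    using Cons by (simp add: sign_swap_id)
qed

locale negative_flip = monomial_braiding X C "\<lambda>_ _. -1" "\<lambda>_ u. u" for X :: "'x set" and C
begin

lemma foldr_braid_at_flip:
  assumes "w \<in> lists X" "set is \<subseteq> {i. Suc i < length w}"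
  shows "foldr B is f w = (-1) ^ length is * f (permute_list (word_perm is) w)"
  using assms
proof (induction "is" arbitrary: w)
  case (Cons i "is")
  let ?w = "permute_list (transpose i (Suc i)) w"
  have s: "transpose i (Suc i) permutes {..<length w}"
    using Cons.prems by (intro permutes_swap_id) auto
  have eq: "w[i := w ! Suc i, Suc i := w ! i] = ?w"
    using Cons.prems s
    by (intro nth_equalityI) (auto simp: permute_list_nth nth_list_update transpose_def)
  have w: "?w \<in> lists X"
    using Cons.prems(1) s by (simp add: in_lists_conv_set)
  have "foldr B (i # is) f w = - foldr B is f ?w"
    using Cons.prems by (simp add: braid_at_monomial eq)
  also have "\<dots> = - ((-1) ^ length is * f (permute_list (word_perm is) ?w))"
    using Cons.IH[OF w] Cons.prems by simp
  also have "permute_list (word_perm is) ?w = permute_list (word_perm (i # is)) w"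
    using word_perm_permutes[of "is" "length w"] Cons.prems
    unfolding word_perm_Cons by (subst permute_list_compose) auto
  finally show ?case by (simp del: word_perm_Cons)
qed simp

lemma quantum_symmetrizer_flip:
  assumes "w \<in> lists X"
  shows "Q f w = (\<Sum>\<sigma> | \<sigma> permutes {..<length w}. of_int (sign \<sigma>) * f (permute_list \<sigma> w))"
  unfolding quantum_symmetrizer_def matsumoto_lift_def
proof (intro sum.cong refl, clarify)
  fix \<sigma> assume "\<sigma> permutes {..<length w}"
  note s = some_reduced_word[OF this]
  have "of_int (sign \<sigma>) = (-1 :: complex) ^ length (red_word (length w) \<sigma>)"
    using sign_word_perm[of "red_word (length w) \<sigma>"] s(2) by simp
  then show "foldr B (red_word (length w) \<sigma>) f w = of_int (sign \<sigma>) * f (permute_list \<sigma> w)"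
    using foldr_braid_at_flip[OF assms s(1)] s(2) by simp
qed

text \<open>The symmetrizer is the signed sum over all permutations. A word longer than
  \<open>card X\<close> repeats a letter, and composing with the transposition of the two equal
  positions shows that the sum equals its own negative.\<close>

lemma finite_dim_nichols_flip: "finite_dim_nichols X C"
proof (rule finite_dim_nicholsI)
  fix f :: "'x list \<Rightarrow> complex" and w assume w: "w \<in> lists X" "card X < length w"
  have "\<not> distinct w"
  proof
    assume "distinct w"
    then have "length w = card (set w)" by (simp add: distinct_card)
    also have "\<dots> \<le> card X" using w finite by (intro card_mono) auto
    finally show False using w by simp
  qed
  then obtain i j where ij: "i < length w" "j < length w" "i \<noteq> j" "w ! i = w ! j"
    by (auto simp: distinct_conv_nth)
  let ?t = "transpose i j"
  have t: "?t permutes {..<length w}" using ij by (intro permutes_swap_id) auto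
  have tw: "permute_list ?t w = w"
    using ij t by (intro nth_equalityI) (auto simp: permute_list_nth transpose_def)
  let ?h = "\<lambda>\<sigma>. of_int (sign \<sigma>) * f (permute_list \<sigma> w)"
  have "(\<Sum>\<sigma> | \<sigma> permutes {..<length w}. ?h \<sigma>) = (\<Sum>\<sigma> | \<sigma> permutes {..<length w}. ?h (?t \<circ> \<sigma>))"
    by (rule sum.reindex_bij_witness[of _ "\<lambda>\<sigma>. ?t \<circ> \<sigma>" "\<lambda>\<sigma>. ?t \<circ> \<sigma>"])
       (auto simp: t permutes_compose comp_assoc[symmetric])
  also have "\<dots> = (\<Sum>\<sigma> | \<sigma> permutes {..<length w}. - ?h \<sigma>)"
  proof (intro sum.cong refl, clarify)
    fix \<sigma> assume \<sigma>: "\<sigma> permutes {..<length w}"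
    have "sign (?t \<circ> \<sigma>) = sign ?t * sign \<sigma>"
      using \<sigma> t by (intro sign_compose) (auto simp: permutation_permutes)
    moreover have "permute_list (?t \<circ> \<sigma>) w = permute_list \<sigma> w"
      using permute_list_compose[OF \<sigma>, of ?t] by (simp add: tw)
    ultimately show "?h (?t \<circ> \<sigma>) = - ?h \<sigma>" using ij by (simp add: sign_swap_id)
  qed
  also have "\<dots> = - (\<Sum>\<sigma> | \<sigma> permutes {..<length w}. ?h \<sigma>)" by (simp add: sum_negf)
  finally show "Q f w = 0" by (simp add: quantum_symmetrizer_flip[OF w(1)])
qed

end

subsection \<open>Diagonal braidings of affine Cartan type\<close>

text \<open>The coefficient of a word in the skew derivative of \<open>f\<close> along
  \<open>a\<close>: the sum over all ways to insert \<open>a\<close> into the word, weighted by the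
  scalars for braiding \<open>a\<close> past the letters before it.\<close>

primrec left_der :: "('x \<Rightarrow> 'x \<Rightarrow> complex) \<Rightarrow> 'x \<Rightarrow> 'x list \<Rightarrow> ('x list \<Rightarrow> complex) \<Rightarrow> complex" where
  "left_der c a [] f = f [a]"
| "left_der c a (v # w) f = f (a # v # w) + c a v * left_der c a w (\<lambda>m. f (v # m))"

lemma left_der_add: "left_der c a w (\<lambda>m. f m + h m) = left_der c a w f + left_der c a w h"
  by (induction w arbitrary: f h) (simp_all add: algebra_simps)

lemma left_der_scale: "left_der c a w (\<lambda>m. k * f m) = k * left_der c a w f"
  by (induction w arbitrary: f) (simp_all add: algebra_simps)

text \<open>
  The imaginary root vector is \<open>z = x\<^sub>p x\<^sub>r - \<kappa> x\<^sub>r x\<^sub>p\<close> with \<open>\<kappa> = c p r\<close>, and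
  \<open>root_power p r \<kappa>\<close> is the formal sum of all its powers.
\<close>

definition root_coeff :: "'x \<Rightarrow> 'x \<Rightarrow> complex \<Rightarrow> 'x \<Rightarrow> 'x \<Rightarrow> complex" where
  "root_coeff p r \<kappa> a b = (if a = p \<and> b = r then 1 else if a = r \<and> b = p then - \<kappa> else 0)"

fun root_power :: "'x \<Rightarrow> 'x \<Rightarrow> complex \<Rightarrow> 'x list \<Rightarrow> complex" where
  "root_power p r \<kappa> [] = 1"
| "root_power p r \<kappa> [a] = 0"
| "root_power p r \<kappa> (a # b # w) = root_coeff p r \<kappa> a b * root_power p r \<kappa> w"

locale affine_braiding = monomial_braiding X C c "\<lambda>_ u. u" for X :: "'x set" and C c +
  fixes p r :: 'x and q :: complex
  assumes pr: "p \<in> X" "r \<in> X" "p \<noteq> r"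
    and c_diag: "c p p = q" "c r r = q" and c_off: "c p r = inverse q" "c r p = inverse q"
    and q: "q \<noteq> 0" "q\<^sup>2 \<noteq> 1"
begin

abbreviation "\<zeta> \<equiv> root_coeff p r (inverse q)"
abbreviation "F \<equiv> root_power p r (inverse q)"
abbreviation "D \<equiv> left_der c"

text \<open>In \<open>quantum_symmetrizer_Cons\<close> the cycle with index \<open>i\<close> moves
  \<open>a\<close> past the next \<open>i\<close> letters; for a diagonal braiding the sum of these
  moves is the skew derivation along \<open>a\<close>.\<close>

lemma quantum_symmetrizer_left_der:
  assumes "a \<in> X" "u \<in> lists X"
  shows "Q f (a # u) = Q (\<lambda>m. D a m f) u"
proof -
  have *: "(\<Sum>i\<le>length m. foldr B [0..<i] f (a # m)) = D a m f" if "m \<in> lists X" for m f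
    using that
  proof (induction m arbitrary: f rule: list.induct)
    case (Cons v w)
    \<comment> \<open>The operator at position 0 exchanges \<open>a\<close> with \<open>v\<close>;
      the remaining ones act one place further to the right, so \<open>v\<close> can be split
      off.\<close>
    have "foldr B [0..<Suc i] f (a # v # w) = c a v * foldr B [0..<i] (\<lambda>m. f (v # m)) (a # w)" for i
    proof -
      have "[0..<Suc i] = 0 # map Suc [0..<i]" by (simp add: map_Suc_upt upt_conv_Cons del: upt_Suc)
      then show ?thesis
        using Cons.prems assms(1) by (simp add: braid_at_monomial foldr_braid_at_Cons del: upt_Suc)
    qed
    with Cons show ?case
      by (simp add: sum.atMost_Suc_shift sum_distrib_left[symmetric] del: sum.atMost_Suc upt_Suc)
  qed simp
  have "Q f (a # u) = Q (\<lambda>m. \<Sum>i\<le>length u. foldr B [0..<i] f (a # m)) u"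
    by (simp add: quantum_symmetrizer_Cons assms quantum_symmetrizer_sum)
  also have "\<dots> = Q (\<lambda>m. D a m f) u"
    using assms by (intro quantum_symmetrizer_agree) (auto simp: agree_def *[symmetric])
  finally show ?thesis .
qed

text \<open>Both words of the root vector contain one \<open>p\<close> and one \<open>r\<close>, so
  moving a letter past it costs \<open>q * inverse q = 1\<close>.\<close>

lemma \<zeta>_balanced: "a \<in> {p, r} \<Longrightarrow> c a b1 * (c a b2 * (\<zeta> b1 b2 * k)) = \<zeta> b1 b2 * k"
  using pr q by (auto simp: root_coeff_def c_diag c_off)

text \<open>An \<open>a\<close> inserted before or just after \<open>b1\<close> forms a root factor
  with \<open>b1\<close>; at every later place it has passed a complete root factor, at no cost by
  \<open>\<zeta>_balanced\<close>.\<close>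

lemma D_F:
  assumes "a \<in> {p, r}"
  shows "D a (b1 # b2 # w) F = (\<zeta> a b1 + c a b1 * \<zeta> b1 a) * F (b2 # w) + \<zeta> b1 b2 * D a w F"
  using \<zeta>_balanced[OF assms, of b1 b2 "D a w F"]
  unfolding left_der.simps root_power.simps left_der_scale by (simp add: algebra_simps)

text \<open>This fixes the coefficient \<open>\<kappa>\<close>: with
  \<open>\<kappa> = c p r = c r p\<close> the derivation along \<open>r\<close> annihilates the root
  vector.\<close>

lemma D_r_coeff: "\<zeta> r b + c r b * \<zeta> b r = 0"
  using pr by (auto simp: root_coeff_def c_off)

lemma D_r_F: "D r w F = 0"
proof (induction w rule: induct_list012)
  case (2 b)
  then show ?case using D_r_coeff[of b] by simp
next
  case (3 b1 b2 w)
  have "D r (b1 # b2 # w) F = (\<zeta> r b1 + c r b1 * \<zeta> b1 r) * F (b2 # w) + \<zeta> b1 b2 * D r w F"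
    by (rule D_F) simp
  then show ?case by (simp only: D_r_coeff "3.IH"(1) mult_zero_left mult_zero_right add_0)
qed simp

text \<open>A Leibniz rule: differentiating the first root factor gives the constant
  \<open>1 - q^-2\<close>, and the other factors are reached through the first one
  unchanged.\<close>

lemma D_r_D_p_F_rec:
  "D r (b1 # b2 # w) (\<lambda>m. D p m F) =
    (1 - inverse q * inverse q) * F (b1 # b2 # w) + \<zeta> b1 b2 * D r w (\<lambda>m. D p m F)"
proof -
  define H where "H = (\<lambda>m. D p m F)"
  define e where "e b = \<zeta> p b + c p b * \<zeta> b p" for b
  have H: "H (b1 # b2 # w) = e b1 * F (b2 # w) + \<zeta> b1 b2 * H w" for b1 b2 w
    unfolding H_def e_def by (rule D_F) simp
  have er: "e r = 1 - inverse q * inverse q"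
    using pr by (simp add: e_def root_coeff_def c_off)
  have "D r w (\<lambda>m. H (b1 # b2 # m)) = e b1 * D r w (\<lambda>m. F (b2 # m)) + \<zeta> b1 b2 * D r w H"
    by (simp only: H left_der_add left_der_scale)
  then have "D r (b1 # b2 # w) H = e r * F (b1 # b2 # w)
      + (\<zeta> r b1 + c r b1 * \<zeta> b1 r) * H (b2 # w)
      + c r b1 * e b1 * (F (r # b2 # w) + c r b2 * D r w (\<lambda>m. F (b2 # m)))
      + c r b1 * (c r b2 * (\<zeta> b1 b2 * D r w H))"
    by (simp add: H algebra_simps del: root_power.simps)
  \<comment> \<open>The bracket is the derivation of \<open>F\<close> along \<open>r\<close> at
    \<open>b2 # w\<close>, which vanishes by \<open>D_r_F\<close>.\<close>
  also have "F (r # b2 # w) + c r b2 * D r w (\<lambda>m. F (b2 # m)) = 0"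
    using D_r_F[of "b2 # w"] by simp
  finally show ?thesis
    using \<zeta>_balanced[of r b1 b2 "D r w H"] by (simp add: D_r_coeff er H_def)
qed

text \<open>As for the derivative of a power, every root factor contributes the same constant. The
  numerical factor is never zero, so no power of the root vector dies.\<close>

lemma D_r_D_p_F:
  "even (length w) \<Longrightarrow>
    D r w (\<lambda>m. D p m F) = (1 - inverse q * inverse q) * of_nat (length w div 2 + 1) * F w"
proof (induction w rule: induct_list012)
  case 1
  show ?case using pr by (simp add: root_coeff_def c_off)
next
  case (3 b1 b2 w)
  then have IH: "D r w (\<lambda>m. D p m F) = (1 - inverse q * inverse q) * of_nat (length w div 2 + 1) * F w"
    by simp
  show ?case
    by (simp only: D_r_D_p_F_rec IH root_power.simps length_Cons) (simp add: algebra_simps)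
qed simp

lemma quantum_symmetrizer_root_power: "Q F (concat (replicate k [p, r])) \<noteq> 0"
proof (induction k)
  case 0
  show ?case by (simp add: quantum_symmetrizer_Nil)
next
  case (Suc k)
  let ?w = "concat (replicate k [p, r])"
  have w: "?w \<in> lists X" using pr by (induction k) auto
  have len: "even (length ?w)" by (induction k) auto
  have "Q F (concat (replicate (Suc k) [p, r])) = Q (\<lambda>m. D r m (\<lambda>m. D p m F)) ?w"
    using pr w by (simp add: quantum_symmetrizer_left_der)
  also have "\<dots> = Q (\<lambda>m. (1 - inverse q * inverse q) * of_nat (length ?w div 2 + 1) * F m) ?w"
    using w len by (intro quantum_symmetrizer_agree) (auto simp: agree_def D_r_D_p_F)
  also have "\<dots> = (1 - inverse q * inverse q) * of_nat (length ?w div 2 + 1) * Q F ?w"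
    by (rule quantum_symmetrizer_scale)
  also have "\<dots> \<noteq> 0"
  proof -
    have "1 - inverse q * inverse q \<noteq> 0"
      using q by (auto simp: field_simps power2_eq_square)
    moreover have "of_nat (length ?w div 2 + 1) \<noteq> (0 :: complex)" by (simp only: of_nat_eq_0_iff)
    ultimately show ?thesis using Suc by (simp only: mult_eq_0_iff simp_thms)
  qed
  finally show ?case .
qed

lemma not_finite_dim_nichols_affine: "\<not> finite_dim_nichols X C"
proof (rule not_finite_dim_nichols)
  fix N
  let ?w = "concat (replicate N [p, r])"
  have len: "length ?w = 2 * N" by (induction N) auto
  have w: "?w \<in> lists X" using pr by (induction N) auto
  \<comment> \<open>\<open>F\<close> collects all powers of the root vector and has infinite
    support; its part of degree \<open>2 * N\<close> is a genuine tensor with the same symmetrizer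
    at \<open>?w\<close>.\<close>
  let ?f = "\<lambda>w. if w \<in> lists X \<and> length w = 2 * N then F w else 0"
  have "finite {w. set w \<subseteq> X \<and> length w = 2 * N}" by (rule finite_lists_length_eq[OF finite])
  then have "finite {w. ?f w \<noteq> 0}" by (rule rev_finite_subset) (auto simp: lists_eq_set)
  then have f: "?f \<in> carrier T" by (auto simp: carrier_tensor_algebra)
  have "Q ?f ?w = Q F ?w"
    using w len by (intro quantum_symmetrizer_agree) (auto simp: agree_def)
  then show "\<exists>f\<in>carrier T. \<exists>w\<in>lists X. N \<le> length w \<and> Q f w \<noteq> 0"
    using f w len quantum_symmetrizer_root_power[of N]
    by (intro bexI[of _ ?f] bexI[of _ ?w]) simp_all
qed

end

subsection \<open>Irreducible representations\<close>

lemma hom_units_of_iff: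
  "\<rho> \<in> hom (G\<lparr>carrier := H\<rparr>) (units_of R) \<longleftrightarrow>
     (\<forall>h\<in>H. \<rho> h \<in> Units R) \<and> (\<forall>h\<in>H. \<forall>k\<in>H. \<rho> (h \<otimes>\<^bsub>G\<^esub> k) = \<rho> h \<otimes>\<^bsub>R\<^esub> \<rho> k)"
  by (auto simp: hom_def units_of_def Pi_def)

lemma Units_ring_matD:
  assumes "A \<in> Units (ring_mat TYPE(complex) d ())"
  obtains B where "A \<in> carrier_mat d d" "B \<in> carrier_mat d d" "A * B = 1\<^sub>m d" "B * A = 1\<^sub>m d"
  using assms by (auto simp: Units_def ring_mat_def)

lemma Units_complex_ring: "Units complex_ring = {a. a \<noteq> 0}"
proof (rule Set.set_eqI)
  fix a show "a \<in> Units complex_ring \<longleftrightarrow> a \<in> {a. a \<noteq> 0}"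
    by (auto simp: Units_def intro: exI[of _ "inverse a"])
qed

lemma representation_iff:
  "representation G H d \<rho> \<longleftrightarrow> (\<forall>h\<in>H. \<rho> h \<in> Units (ring_mat TYPE(complex) d ())) \<and>
     (\<forall>h\<in>H. \<forall>k\<in>H. \<rho> (h \<otimes>\<^bsub>G\<^esub> k) = \<rho> h * \<rho> k)"
  by (simp add: representation_def hom_units_of_iff) (simp add: ring_mat_def)

lemma representation_carrier: "representation G H d \<rho> \<Longrightarrow> h \<in> H \<Longrightarrow> \<rho> h \<in> carrier_mat d d"
  by (auto simp: representation_iff elim: Units_ring_matD)

lemma representation_mult:
  "representation G H d \<rho> \<Longrightarrow> h \<in> H \<Longrightarrow> k \<in> H \<Longrightarrow> \<rho> (h \<otimes>\<^bsub>G\<^esub> k) = \<rho> h * \<rho> k"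
  by (auto simp: representation_iff)

lemma representation_one:
  assumes "group G" "representation G H d \<rho>" "\<one>\<^bsub>G\<^esub> \<in> H"
  shows "\<rho> \<one>\<^bsub>G\<^esub> = 1\<^sub>m d"
proof -
  interpret group G by (rule assms)
  have idem: "\<rho> \<one>\<^bsub>G\<^esub> * \<rho> \<one>\<^bsub>G\<^esub> = \<rho> \<one>\<^bsub>G\<^esub>" using representation_mult[OF assms(2,3,3)] by simp
  have "\<rho> \<one>\<^bsub>G\<^esub> \<in> Units (ring_mat TYPE(complex) d ())" using assms by (simp add: representation_iff)
  then obtain B where B: "\<rho> \<one>\<^bsub>G\<^esub> \<in> carrier_mat d d" "B \<in> carrier_mat d d" "B * \<rho> \<one>\<^bsub>G\<^esub> = 1\<^sub>m d"
    by (elim Units_ring_matD)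
  have "\<rho> \<one>\<^bsub>G\<^esub> = (B * \<rho> \<one>\<^bsub>G\<^esub>) * \<rho> \<one>\<^bsub>G\<^esub>" using B by simp
  also have "\<dots> = B * (\<rho> \<one>\<^bsub>G\<^esub> * \<rho> \<one>\<^bsub>G\<^esub>)" using B by (intro assoc_mult_mat) auto
  also have "\<dots> = 1\<^sub>m d" using B idem by simp
  finally show ?thesis .
qed

lemma submodule_module_vecI:
  assumes "W \<subseteq> carrier_vec d" "0\<^sub>v d \<in> W" "\<And>v w. v \<in> W \<Longrightarrow> w \<in> W \<Longrightarrow> v + w \<in> W"
    and smult: "\<And>a v. v \<in> W \<Longrightarrow> a \<cdot>\<^sub>v v \<in> W"
  shows "submodule W complex_ring (module_vec TYPE(complex) d)"
proof (intro submodule.intro subgroup.intro submodule_axioms.intro)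
  fix v assume v: "v \<in> W"
  then have vd: "v \<in> carrier_vec d" using assms by auto
  have "inv\<^bsub>add_monoid (module_vec TYPE(complex) d)\<^esub> v = -1 \<cdot>\<^sub>v v"
    unfolding m_inv_def
  proof (rule the_equality)
    show "-1 \<cdot>\<^sub>v v \<in> carrier (add_monoid (module_vec TYPE(complex) d)) \<and>
        v \<otimes>\<^bsub>add_monoid (module_vec TYPE(complex) d)\<^esub> (-1 \<cdot>\<^sub>v v) = \<one>\<^bsub>add_monoid (module_vec TYPE(complex) d)\<^esub> \<and>
        -1 \<cdot>\<^sub>v v \<otimes>\<^bsub>add_monoid (module_vec TYPE(complex) d)\<^esub> v = \<one>\<^bsub>add_monoid (module_vec TYPE(complex) d)\<^esub>"
      using vd by (auto simp: module_vec_def intro!: eq_vecI)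
    fix w
    assume w: "w \<in> carrier (add_monoid (module_vec TYPE(complex) d)) \<and>
        v \<otimes>\<^bsub>add_monoid (module_vec TYPE(complex) d)\<^esub> w = \<one>\<^bsub>add_monoid (module_vec TYPE(complex) d)\<^esub> \<and>
        w \<otimes>\<^bsub>add_monoid (module_vec TYPE(complex) d)\<^esub> v = \<one>\<^bsub>add_monoid (module_vec TYPE(complex) d)\<^esub>"
    then have wd: "w \<in> carrier_vec d" "v + w = 0\<^sub>v d" by (auto simp: module_vec_def)
    show "w = -1 \<cdot>\<^sub>v v"
    proof (rule eq_vecI)
      fix i assume "i < dim_vec (-1 \<cdot>\<^sub>v v)"
      then have i: "i < d" using vd by simp
      have "(v + w) $ i = 0" unfolding wd(2) using i by simp
      then show "w $ i = (-1 \<cdot>\<^sub>v v) $ i" using i vd wd(1) by (simp add: add_eq_0_iff)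
    qed (use vd wd(1) in simp)
  qed
  then show "inv\<^bsub>add_monoid (module_vec TYPE(complex) d)\<^esub> v \<in> W"
    using smult[OF v, of "-1"] by simp
qed (use assms in \<open>auto simp: module_vec_def\<close>)

text \<open>Schur's lemma: over the complex numbers \<open>\<rho> z\<close> has an eigenvalue, and
  because \<open>z\<close> commutes with \<open>H\<close> the eigenspace is invariant, hence the
  whole space.\<close>

lemma central_rep_scalar:
  assumes irr: "irreducible_rep G H d \<rho>" and z: "z \<in> H"
    and central: "\<And>h. h \<in> H \<Longrightarrow> h \<otimes>\<^bsub>G\<^esub> z = z \<otimes>\<^bsub>G\<^esub> h"
  shows "\<exists>q. \<rho> z = q \<cdot>\<^sub>m 1\<^sub>m d"
proof -
  have rep: "representation G H d \<rho>" and d: "d > 0"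
    using irr by (simp_all add: irreducible_rep_def)
  have zc: "\<rho> z \<in> carrier_mat d d" by (rule representation_carrier[OF rep z])
  have "degree (char_poly (\<rho> z)) = d" using degree_monic_char_poly[OF zc] by simp
  then have "\<not> constant (poly (char_poly (\<rho> z)))" using d by (simp add: constant_degree)
  then obtain q where "poly (char_poly (\<rho> z)) q = 0"
    using fundamental_theorem_of_algebra by blast
  then have "eigenvalue (\<rho> z) q" using eigenvalue_root_char_poly[OF zc] by simp
  then obtain v where v: "v \<in> carrier_vec d" "v \<noteq> 0\<^sub>v d" "\<rho> z *\<^sub>v v = q \<cdot>\<^sub>v v"
    using zc by (auto simp: eigenvalue_def eigenvector_def)
  let ?W = "{v \<in> carrier_vec d. \<rho> z *\<^sub>v v = q \<cdot>\<^sub>v v}"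
  have "submodule ?W complex_ring (module_vec TYPE(complex) d)"
    using zc by (intro submodule_module_vecI)
      (auto simp: mult_add_distrib_mat_vec smult_add_distrib_vec mult_mat_vec smult_smult_assoc mult.commute)
  moreover have "\<rho> h *\<^sub>v w \<in> ?W" if h: "h \<in> H" and w: "w \<in> ?W" for h w
  proof -
    have hc: "\<rho> h \<in> carrier_mat d d" by (rule representation_carrier[OF rep h])
    have "\<rho> z *\<^sub>v (\<rho> h *\<^sub>v w) = (\<rho> z * \<rho> h) *\<^sub>v w"
      using w hc zc by (intro assoc_mult_mat_vec[symmetric]) auto
    also have "\<rho> z * \<rho> h = \<rho> h * \<rho> z"
      using central[OF h] representation_mult[OF rep] h z by metis
    also have "(\<rho> h * \<rho> z) *\<^sub>v w = \<rho> h *\<^sub>v (\<rho> z *\<^sub>v w)"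
      using w hc zc by (intro assoc_mult_mat_vec) auto
    also have "\<dots> = q \<cdot>\<^sub>v (\<rho> h *\<^sub>v w)" using w hc by (simp add: mult_mat_vec)
    finally show ?thesis using w hc by auto
  qed
  ultimately have "?W = {0\<^sub>v d} \<or> ?W = carrier_vec d"
    using irr unfolding irreducible_rep_def by blast
  moreover have "v \<in> ?W" using v by simp
  ultimately have W: "?W = carrier_vec d" using v(2) by auto
  have "\<rho> z = q \<cdot>\<^sub>m 1\<^sub>m d"
  proof (rule eq_matI)
    fix i j assume "i < dim_row (q \<cdot>\<^sub>m 1\<^sub>m d)" "j < dim_col (q \<cdot>\<^sub>m 1\<^sub>m d)"
    then have ij: "i < d" "j < d" by auto
    have "unit_vec d j \<in> ?W" unfolding W by simp
    then have "(\<rho> z *\<^sub>v unit_vec d j) $ i = (q \<cdot>\<^sub>v unit_vec d j) $ i" by simp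
    then show "\<rho> z $$ (i, j) = (q \<cdot>\<^sub>m 1\<^sub>m d) $$ (i, j)"
      using ij zc by (simp add: scalar_prod_right_unit)
  qed (use zc in auto)
  then show ?thesis by blast
qed

text \<open>By \<open>central_rep_scalar\<close> every element acts by a scalar, so the line spanned
  by the first unit vector is invariant.\<close>

lemma abelian_irreducible_dim:
  assumes irr: "irreducible_rep G H d \<rho>"
    and comm: "\<And>h k. h \<in> H \<Longrightarrow> k \<in> H \<Longrightarrow> h \<otimes>\<^bsub>G\<^esub> k = k \<otimes>\<^bsub>G\<^esub> h"
  shows "d = 1"
proof -
  have d: "d > 0" using irr by (simp add: irreducible_rep_def)
  let ?W = "{a \<cdot>\<^sub>v unit_vec d 0 | a :: complex. True}"
  have "submodule ?W complex_ring (module_vec TYPE(complex) d)"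
  proof (rule submodule_module_vecI)
    show "0\<^sub>v d \<in> ?W" by (auto intro!: exI[of _ 0])
    show "v + w \<in> ?W" if vw: "v \<in> ?W" "w \<in> ?W" for v w
    proof -
      obtain a b where "v = a \<cdot>\<^sub>v unit_vec d 0" "w = b \<cdot>\<^sub>v unit_vec d 0" using vw by auto
      then have "v + w = (a + b) \<cdot>\<^sub>v unit_vec d 0" by (simp add: add_smult_distrib_vec)
      then show ?thesis by blast
    qed
    show "a \<cdot>\<^sub>v v \<in> ?W" if "v \<in> ?W" for a v
      using that by (auto simp: smult_smult_assoc)
  qed auto
  moreover have "\<rho> h *\<^sub>v w \<in> ?W" if h: "h \<in> H" and w: "w \<in> ?W" for h w
  proof -
    obtain q where q: "\<rho> h = q \<cdot>\<^sub>m 1\<^sub>m d"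
      using central_rep_scalar[OF irr h] comm h by blast
    obtain a where a: "w = a \<cdot>\<^sub>v unit_vec d 0" using w by auto
    have "\<rho> h *\<^sub>v w = (q * a) \<cdot>\<^sub>v unit_vec d 0"
      unfolding q a by (intro eq_vecI) auto
    then show ?thesis by blast
  qed
  ultimately have "?W = {0\<^sub>v d} \<or> ?W = carrier_vec d"
    using irr unfolding irreducible_rep_def by blast
  moreover have "unit_vec d 0 \<in> ?W" by (auto intro!: exI[of _ 1])
  moreover have "unit_vec d 0 \<noteq> (0\<^sub>v d :: complex vec)" using d by simp
  ultimately have W: "?W = carrier_vec d" by blast
  show "d = 1"
  proof (rule ccontr)
    assume "d \<noteq> 1"
    then have d1: "1 < d" using d by simp
    have "unit_vec d 1 \<in> ?W" unfolding W by simp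
    then obtain a where a: "unit_vec d 1 = a \<cdot>\<^sub>v (unit_vec d 0 :: complex vec)" by auto
    have "(unit_vec d 1 :: complex vec) $ 1 = (a \<cdot>\<^sub>v unit_vec d 0) $ 1" by (simp only: a)
    then show False using d1 by simp
  qed
qed

subsection \<open>Braidings of Yetter-Drinfeld modules\<close>

context group
begin

lemma cancel_inv [simp]:
  assumes "a \<in> carrier G" "b \<in> carrier G"
  shows "a \<otimes> (inv a \<otimes> b) = b" "inv a \<otimes> (a \<otimes> b) = b"
  using assms by (simp_all add: m_assoc[symmetric])

lemma centralizer_closed:
  assumes "s \<in> carrier G"
  shows "\<one> \<in> centralizer G s"
    and "h \<in> centralizer G s \<Longrightarrow> k \<in> centralizer G s \<Longrightarrow> h \<otimes> k \<in> centralizer G s"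
    and "h \<in> centralizer G s \<Longrightarrow> inv h \<in> centralizer G s"
    and "s \<in> centralizer G s"
proof -
  show "h \<otimes> k \<in> centralizer G s" if "h \<in> centralizer G s" "k \<in> centralizer G s"
    using that assms unfolding centralizer_def by (simp add: m_assoc) (simp add: m_assoc[symmetric])
  show "inv h \<in> centralizer G s" if h: "h \<in> centralizer G s"
  proof -
    have hc: "h \<in> carrier G" "h \<otimes> s = s \<otimes> h" using h by (auto simp: centralizer_def)
    have "inv h \<otimes> s = inv h \<otimes> (s \<otimes> h) \<otimes> inv h" using hc assms by (simp add: m_assoc)
    also have "\<dots> = inv h \<otimes> (h \<otimes> s) \<otimes> inv h" by (simp only: hc)
    also have "\<dots> = s \<otimes> inv h" using hc(1) assms by (simp add: m_assoc)
    finally show ?thesis using hc by (simp add: centralizer_def)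
  qed
qed (use assms in \<open>auto simp: centralizer_def\<close>)

end

lemma mult_mat_1_1:
  assumes "A \<in> carrier_mat 1 1" "B \<in> carrier_mat 1 1"
  shows "(A * B) $$ (0, 0) = A $$ (0, 0) * B $$ (0, 0)"
  using assms by (simp add: scalar_prod_def)

text \<open>A commuting class gives \<open>L v u = u\<close> only on \<open>X\<close>, whereas
  \<open>affine_braiding\<close> is stated for the projection itself; the axioms constrain
  \<open>L\<close> only on \<open>X\<close>.\<close>

lemma monomial_braiding_diagonal:
  assumes "monomial_braiding X C c L" "\<And>u v. u \<in> X \<Longrightarrow> v \<in> X \<Longrightarrow> L v u = u"
  shows "monomial_braiding X C c (\<lambda>_ u. u)"
proof -
  interpret monomial_braiding X C c L by (rule assms)
  show ?thesis
    by unfold_locales (use finite C_eq assms(2) in \<open>auto\<close>)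
qed

locale yd_module = group G for G :: "('g, 'b) monoid_scheme" (structure) +
  fixes s :: 'g and d :: nat and \<rho> :: "'g \<Rightarrow> complex mat" and g :: "'g \<Rightarrow> 'g"
  assumes s: "s \<in> carrier G" and fin: "finite (carrier G)"
    and rep: "representation G (centralizer G s) d \<rho>"
    and sec: "class_section G s g"
begin

abbreviation "\<O> \<equiv> conj_class G s"

lemma class_carrier: "t \<in> \<O> \<Longrightarrow> t \<in> carrier G"
  using s by (auto simp: conj_class_def)

lemma class_conj: "t \<in> \<O> \<Longrightarrow> h \<in> carrier G \<Longrightarrow> h \<otimes> t \<otimes> inv h \<in> \<O>"
proof -
  assume "t \<in> \<O>" and h: "h \<in> carrier G"
  then obtain k where k: "k \<in> carrier G" "t = k \<otimes> s \<otimes> inv k" by (auto simp: conj_class_def)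
  then have "h \<otimes> t \<otimes> inv h = (h \<otimes> k) \<otimes> s \<otimes> inv (h \<otimes> k)"
    using h s by (simp add: m_assoc inv_mult_group)
  then show ?thesis using h k unfolding conj_class_def by blast
qed

lemma class_conj': "t \<in> \<O> \<Longrightarrow> h \<in> carrier G \<Longrightarrow> inv h \<otimes> t \<otimes> h \<in> \<O>"
  using class_conj[of t "inv h"] by simp

lemma s_class: "s \<in> \<O>"
  using s unfolding conj_class_def by (auto intro!: exI[of _ \<one>])

lemma finite_class: "finite \<O>"
  using class_carrier by (intro finite_subset[OF _ fin]) auto

lemma g_carrier: "t \<in> \<O> \<Longrightarrow> g t \<in> carrier G"
  and g_conj: "t \<in> \<O> \<Longrightarrow> g t \<otimes> s \<otimes> inv (g t) = t"
  using sec by (auto simp: class_section_def)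

lemma g_conj': "t \<in> \<O> \<Longrightarrow> inv (g t) \<otimes> t \<otimes> g t = s"
proof -
  assume t: "t \<in> \<O>"
  have "inv (g t) \<otimes> (g t \<otimes> s \<otimes> inv (g t)) \<otimes> g t = s"
    using g_carrier[OF t] s by (simp add: m_assoc)
  then show ?thesis by (simp only: g_conj[OF t])
qed

lemma cocycle_centralizer:
  assumes "h \<in> carrier G" "t \<in> \<O>" "u = h \<otimes> t \<otimes> inv h"
  shows "inv (g u) \<otimes> h \<otimes> g t \<in> centralizer G s"
proof -
  have u: "u \<in> \<O>" using assms class_conj by simp
  note [simp] = g_carrier class_carrier
  have gt: "g t \<otimes> s = t \<otimes> g t"
  proof -
    have "t \<otimes> g t = (g t \<otimes> s \<otimes> inv (g t)) \<otimes> g t" using g_conj assms by simp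
    also have "\<dots> = g t \<otimes> s" using assms s by (simp add: m_assoc)
    finally show ?thesis by simp
  qed
  have gu: "inv (g u) \<otimes> u = s \<otimes> inv (g u)"
  proof -
    have "inv (g u) \<otimes> u = inv (g u) \<otimes> (g u \<otimes> s \<otimes> inv (g u))" using g_conj u by simp
    also have "\<dots> = s \<otimes> inv (g u)" using u s by (simp add: m_assoc)
    finally show ?thesis by simp
  qed
  have hu: "h \<otimes> t = u \<otimes> h" using assms by (simp add: m_assoc)
  have "inv (g u) \<otimes> h \<otimes> g t \<otimes> s = inv (g u) \<otimes> h \<otimes> (g t \<otimes> s)"
    using assms u s by (simp add: m_assoc)
  also have "\<dots> = inv (g u) \<otimes> (h \<otimes> t) \<otimes> g t" unfolding gt using assms u by (simp add: m_assoc)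
  also have "\<dots> = (inv (g u) \<otimes> u) \<otimes> (h \<otimes> g t)" unfolding hu using assms u by (simp add: m_assoc)
  also have "\<dots> = s \<otimes> (inv (g u) \<otimes> h \<otimes> g t)" unfolding gu using assms u s by (simp add: m_assoc)
  finally show ?thesis using assms u by (simp add: centralizer_def)
qed

lemma rep_one: "\<rho> \<one> = 1\<^sub>m d"
  by (rule representation_one[OF is_group rep centralizer_closed(1)[OF s]])

lemma finite_yd_basis: "finite (yd_basis G d s)"
  by (simp add: yd_basis_def finite_class)

text \<open>Scalar matrices do not mix the vector index, so this holds for every \<open>d\<close>.
  It serves \<open>\<epsilon> = 1\<close> for central \<open>s\<close> and
  \<open>\<epsilon> = -1\<close> for the exterior algebras.\<close>

lemma scalar_flip:
  assumes comm: "\<And>t u. t \<in> \<O> \<Longrightarrow> u \<in> \<O> \<Longrightarrow> t \<otimes> u = u \<otimes> t"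
    and scal: "\<And>t u. t \<in> \<O> \<Longrightarrow> u \<in> \<O> \<Longrightarrow> \<rho> (inv (g u) \<otimes> t \<otimes> g u) = \<epsilon> \<cdot>\<^sub>m 1\<^sub>m d"
  shows "monomial_braiding (yd_basis G d s) (yd_braiding G d \<rho> g) (\<lambda>_ _. \<epsilon>) (\<lambda>_ u. u)"
proof
  fix p q u v assume p: "p \<in> yd_basis G d s" and q: "q \<in> yd_basis G d s"
  obtain t a where ta: "p = (t, a)" by (cases p)
  obtain t' a' where ta': "q = (t', a')" by (cases q)
  have t: "t \<in> \<O>" "a < d" "t' \<in> \<O>" "a' < d" using p q ta ta' by (auto simp: yd_basis_def)
  have "t \<otimes> t' \<otimes> inv t = t'"
    using comm[of t t'] t class_carrier by (simp add: m_assoc)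
  then show "yd_braiding G d \<rho> g p q (u, v) =
    (if u \<in> yd_basis G d s \<and> v \<in> yd_basis G d s \<and> p = v \<and> q = u then \<epsilon> else 0)"
    using t scal[of t t'] p q
    by (cases u) (auto simp: yd_braiding_def yd_action_def ta ta' yd_basis_def)
qed (auto simp: finite_yd_basis)

text \<open>The inverse of the action: given the output \<open>(u, v)\<close> of the braiding, the
  first input is \<open>v\<close> and the second is found by conjugating \<open>u\<close> with the
  inverse of the degree of \<open>v\<close>. The index 0 reflects \<open>d = 1\<close>.\<close>

definition back_act :: "'g \<times> nat \<Rightarrow> 'g \<times> nat \<Rightarrow> 'g \<times> nat" where
  "back_act v u = (inv (fst v) \<otimes> fst u \<otimes> fst v, 0)"

definition braid_coeff :: "'g \<times> nat \<Rightarrow> 'g \<times> nat \<Rightarrow> complex" where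
  "braid_coeff u v = \<rho> (inv (g (fst u)) \<otimes> fst v \<otimes> g (fst (back_act v u))) $$ (0, 0)"

lemma rep_mult_1:
  assumes "d = 1" "h \<in> centralizer G s" "k \<in> centralizer G s"
  shows "\<rho> (h \<otimes> k) $$ (0, 0) = \<rho> h $$ (0, 0) * \<rho> k $$ (0, 0)"
  using assms representation_mult[OF rep] representation_carrier[OF rep]
  by (simp add: mult_mat_1_1)

text \<open>The centralizer parts of two successive actions multiply because the inner
  \<open>g u\<close> cancels; this is the source of \<open>c_braid\<close>.\<close>

lemma cocycle_mult:
  assumes "d = 1" and t: "t \<in> \<O>" and h: "h \<in> carrier G" "k \<in> carrier G"
    and u: "u = inv h \<otimes> t \<otimes> h" and v: "v = inv k \<otimes> u \<otimes> k"
  shows "\<rho> (inv (g t) \<otimes> h \<otimes> g u) $$ (0, 0) * \<rho> (inv (g u) \<otimes> k \<otimes> g v) $$ (0, 0) =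
    \<rho> (inv (g t) \<otimes> (h \<otimes> k) \<otimes> g v) $$ (0, 0)"
proof -
  have uO: "u \<in> \<O>" "v \<in> \<O>" using class_conj' t h u v by auto
  note [simp] = g_carrier class_carrier
  have "t = h \<otimes> u \<otimes> inv h" "u = k \<otimes> v \<otimes> inv k"
    using t h uO(1) by (simp_all add: u v m_assoc)
  then have "inv (g t) \<otimes> h \<otimes> g u \<in> centralizer G s" "inv (g u) \<otimes> k \<otimes> g v \<in> centralizer G s"
    using cocycle_centralizer h uO by blast+
  from rep_mult_1[OF assms(1) this]
  have "\<rho> ((inv (g t) \<otimes> h \<otimes> g u) \<otimes> (inv (g u) \<otimes> k \<otimes> g v)) $$ (0, 0) =
    \<rho> (inv (g t) \<otimes> h \<otimes> g u) $$ (0, 0) * \<rho> (inv (g u) \<otimes> k \<otimes> g v) $$ (0, 0)" .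
  moreover have "(inv (g t) \<otimes> h \<otimes> g u) \<otimes> (inv (g u) \<otimes> k \<otimes> g v) = inv (g t) \<otimes> (h \<otimes> k) \<otimes> g v"
    using t h uO by (simp add: m_assoc)
  ultimately show ?thesis by simp
qed

lemma monomial_braiding_1:
  assumes d: "d = 1"
  shows "monomial_braiding (yd_basis G d s) (yd_braiding G d \<rho> g) braid_coeff back_act"
proof
  let ?X = "yd_basis G d s"
  have X: "u \<in> ?X \<longleftrightarrow> fst u \<in> \<O> \<and> snd u = 0" for u
    by (cases u) (auto simp: yd_basis_def d)
  note [simp] = class_carrier
  show "finite ?X" by (rule finite_yd_basis)
  show "back_act y x \<in> ?X" if "x \<in> ?X" "y \<in> ?X" for x y
    using that class_conj' by (simp add: X back_act_def)
  show "yd_braiding G d \<rho> g p q (u, v) =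
    (if u \<in> ?X \<and> v \<in> ?X \<and> p = v \<and> q = back_act v u then braid_coeff u v else 0)"
    if pq: "p \<in> ?X" "q \<in> ?X" for p q u v
  proof (cases "p = v \<and> q = back_act v u \<and> u \<in> ?X")
    case True
    then have "fst u = fst p \<otimes> fst q \<otimes> inv (fst p)" and vp: "v = p" and u0: "snd u = 0"
      using pq by (simp_all add: X back_act_def m_assoc)
    then have "yd_braiding G d \<rho> g p q (u, v) =
        \<rho> (inv (g (fst u)) \<otimes> fst p \<otimes> g (fst q)) $$ (snd u, snd q)"
      using d by (simp add: yd_braiding_def yd_action_def split_def)
    also have "\<dots> = braid_coeff u v"
      using True pq u0 vp by (simp add: braid_coeff_def X)
    finally show ?thesis using True pq by simp
  next
    case False
    have "yd_braiding G d \<rho> g p q (u, v) = 0"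
    proof (cases "p = v \<and> fst u = fst p \<otimes> fst q \<otimes> inv (fst p) \<and> snd u < d")
      case True
      have "fst p \<in> \<O>" "fst q \<in> \<O>" using pq by (simp_all add: X)
      then have "fst p \<otimes> fst q \<otimes> inv (fst p) \<in> \<O>" by (intro class_conj class_carrier)
      then have "fst u \<in> \<O>" "snd u = 0" using True d by simp_all
      then have "u \<in> ?X" by (simp add: X)
      moreover have "q = back_act v u"
        using True pq by (simp add: X back_act_def m_assoc prod_eq_iff)
      ultimately show ?thesis using False True by simp
    qed (auto simp: yd_braiding_def yd_action_def split_def)
    with False show ?thesis by auto
  qed
  show "back_act z (back_act y x) = back_act (back_act z y) (back_act z x)" if "x \<in> ?X" "y \<in> ?X" "z \<in> ?X" for x y z
    using that by (simp add: back_act_def X m_assoc inv_mult_group)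
  show "braid_coeff x y * braid_coeff (back_act y x) z = braid_coeff x z * braid_coeff (back_act z x) (back_act z y)"
    if xyz: "x \<in> ?X" "y \<in> ?X" "z \<in> ?X" for x y z
  proof -
    let ?x = "fst x" and ?y = "fst y" and ?z = "fst z"
    have c: "?x \<in> \<O>" "?x \<in> carrier G" "?y \<in> carrier G" "?z \<in> carrier G"
      using xyz by (simp_all add: X)
    have "braid_coeff x y * braid_coeff (back_act y x) z = \<rho> (inv (g ?x) \<otimes> (?y \<otimes> ?z) \<otimes> g (fst (back_act z (back_act y x)))) $$ (0, 0)"
      unfolding braid_coeff_def by (rule cocycle_mult[OF d c(1)]) (use c in \<open>simp_all add: back_act_def\<close>)
    moreover have "braid_coeff x z * braid_coeff (back_act z x) (back_act z y) =
      \<rho> (inv (g ?x) \<otimes> (?z \<otimes> fst (back_act z y)) \<otimes> g (fst (back_act (back_act z y) (back_act z x)))) $$ (0, 0)"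
      unfolding braid_coeff_def by (rule cocycle_mult[OF d c(1)]) (use c in \<open>simp_all add: back_act_def\<close>)
    \<comment> \<open>Both sides are now the action of a product of two degrees, and these products
      agree because \<open>y z = z (z^-1 y z)\<close>.\<close>
    moreover have "back_act (back_act z y) (back_act z x) = back_act z (back_act y x)" "?z \<otimes> fst (back_act z y) = ?y \<otimes> ?z"
      using c by (simp_all add: back_act_def m_assoc inv_mult_group)
    ultimately show ?thesis by simp
  qed
qed

text \<open>Either alternative makes the braiding monomial, and \<open>(s, 0)\<close> then braids
  with itself by the scalar 1. In a dihedral group every irreducible pair satisfies one of
  them.\<close>

lemma not_finite_dim_trivial:
  assumes d: "d > 0" and one: "\<rho> s = 1\<^sub>m d"
    and "d = 1 \<or> (\<forall>h\<in>carrier G. h \<otimes> s = s \<otimes> h)"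
  shows "\<not> yd_finite_dim_nichols G d s \<rho> g"
  using assms(3)
proof
  assume d1: "d = 1"
  interpret monomial_braiding "yd_basis G d s" "yd_braiding G d \<rho> g" braid_coeff back_act
    by (rule monomial_braiding_1[OF d1])
  have "back_act (s, 0) (s, 0) = (s, 0)" using s by (simp add: back_act_def)
  then show ?thesis
    unfolding yd_finite_dim_nichols_def
    using g_conj'[OF s_class] one d1 s_class
    by (intro not_finite_dim_nichols_fixed_point[of "(s, 0)"]) (simp_all add: braid_coeff_def yd_basis_def)
next
  assume central: "\<forall>h\<in>carrier G. h \<otimes> s = s \<otimes> h"
  then have eq_s: "t = s" if "t \<in> \<O>" for t
    using that s by (auto simp: conj_class_def m_assoc)
  have "1 \<cdot>\<^sub>m 1\<^sub>m d = (1\<^sub>m d :: complex mat)" by (intro eq_matI) auto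
  interpret monomial_braiding "yd_basis G d s" "yd_braiding G d \<rho> g" "\<lambda>_ _. 1" "\<lambda>_ u. u"
  proof (intro scalar_flip)
    fix t u assume "t \<in> \<O>" "u \<in> \<O>"
    with eq_s[of t] eq_s[of u] have tu: "t = u" "u = s" by simp_all
    show "t \<otimes> u = u \<otimes> t" by (simp add: tu(1))
    show "\<rho> (inv (g u) \<otimes> t \<otimes> g u) = 1 \<cdot>\<^sub>m 1\<^sub>m d"
      using \<open>1 \<cdot>\<^sub>m 1\<^sub>m d = 1\<^sub>m d\<close> g_conj'[OF \<open>u \<in> \<O>\<close>] one tu(2) unfolding tu(1) by simp
  qed
  show ?thesis
    unfolding yd_finite_dim_nichols_def
    using s_class d by (intro not_finite_dim_nichols_fixed_point[of "(s, 0)"]) (simp_all add: yd_basis_def)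
qed

section \<open>Classes contained in \<open>{s, inv s}\<close>\<close>

lemma rep_inv_scalar:
  assumes "\<rho> s = q \<cdot>\<^sub>m 1\<^sub>m d"
  shows "q \<cdot>\<^sub>m \<rho> (inv s) = 1\<^sub>m d"
proof -
  have "\<rho> s * \<rho> (inv s) = \<rho> \<one>"
    using representation_mult[OF rep, of s "inv s"] centralizer_closed(3,4)[OF s] s by simp
  moreover have "\<rho> (inv s) \<in> carrier_mat d d"
    using representation_carrier[OF rep] centralizer_closed(3,4)[OF s] by simp
  ultimately show ?thesis
    unfolding assms rep_one by (simp add: mult_smult_assoc_mat[of _ d d])
qed

text \<open>Two distinct elements of the class are mutually inverse, and conjugation back by
  \<open>g u\<close> takes \<open>u\<close> to \<open>s\<close>, hence the inverse of
  \<open>u\<close> to that of \<open>s\<close>.\<close>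

lemma conj_by_g:
  assumes "\<O> \<subseteq> {s, inv s}" "t \<in> \<O>" "u \<in> \<O>"
  shows "inv (g u) \<otimes> t \<otimes> g u = (if t = u then s else inv s)"
proof (cases "t = u")
  case True
  then show ?thesis using g_conj' assms by simp
next
  case False
  have "t = s \<or> t = inv s" "u = s \<or> u = inv s" using assms by auto
  then have tu: "t = inv u" using False s by (elim disjE) simp_all
  have "inv (g u) \<otimes> inv u \<otimes> g u = inv (inv (g u) \<otimes> u \<otimes> g u)"
    using g_carrier class_carrier assms by (simp add: inv_mult_group m_assoc)
  with False show ?thesis using g_conj' assms tu by simp
qed

text \<open>As -1 is its own inverse, \<open>s\<close> and \<open>inv s\<close> act by the same
  scalar, so the braiding is minus the flip for every \<open>d\<close>.\<close>

lemma finite_dim_minus_one: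
  assumes cls: "\<O> \<subseteq> {s, inv s}" and m1: "\<rho> s = (-1) \<cdot>\<^sub>m 1\<^sub>m d"
  shows "yd_finite_dim_nichols G d s \<rho> g"
proof -
  have ic: "\<rho> (inv s) \<in> carrier_mat d d"
    using representation_carrier[OF rep] centralizer_closed(3,4)[OF s] by simp
  have "\<rho> (inv s) = (-1) \<cdot>\<^sub>m ((-1) \<cdot>\<^sub>m \<rho> (inv s))"
    using ic by (intro eq_matI) auto
  then have inv: "\<rho> (inv s) = (-1) \<cdot>\<^sub>m 1\<^sub>m d" unfolding rep_inv_scalar[OF m1] .
  interpret negative_flip "yd_basis G d s" "yd_braiding G d \<rho> g"
    unfolding negative_flip_def
  proof (rule scalar_flip)
    show "t \<otimes> u = u \<otimes> t" if "t \<in> \<O>" "u \<in> \<O>" for t u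
    proof -
      have "t = s \<or> t = inv s" "u = s \<or> u = inv s" using that cls by auto
      then show ?thesis using s by (elim disjE) simp_all
    qed
    show "\<rho> (inv (g u) \<otimes> t \<otimes> g u) = -1 \<cdot>\<^sub>m 1\<^sub>m d" if "t \<in> \<O>" "u \<in> \<O>" for t u
      using conj_by_g[OF cls that] inv m1 by simp
  qed
  show ?thesis unfolding yd_finite_dim_nichols_def by (rule finite_dim_nichols_flip)
qed

lemma not_finite_dim_affine:
  assumes cls: "\<O> = {s, inv s}" and ne: "s \<noteq> inv s" and d: "d = 1"
    and q: "\<rho> s = q \<cdot>\<^sub>m 1\<^sub>m d" "q\<^sup>2 \<noteq> 1"
  shows "\<not> yd_finite_dim_nichols G d s \<rho> g"
proof -
  let ?X = "yd_basis G d s"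
  have X: "?X = {(s, 0), (inv s, 0)}" by (auto simp: yd_basis_def cls d)
  have ic: "\<rho> (inv s) \<in> carrier_mat d d"
    using representation_carrier[OF rep] centralizer_closed(3,4)[OF s] by simp
  have "(q \<cdot>\<^sub>m \<rho> (inv s)) $$ (0, 0) = 1" unfolding rep_inv_scalar[OF q(1)] by (simp add: d)
  then have qi: "q * \<rho> (inv s) $$ (0, 0) = 1" using ic d by simp
  then have q0: "q \<noteq> 0" and inv: "\<rho> (inv s) $$ (0, 0) = inverse q"
    by (auto simp: inverse_unique)
  have L: "back_act v u = u" if "u \<in> ?X" "v \<in> ?X" for u v
    using that s unfolding X by (auto simp: back_act_def m_assoc)
  have c: "braid_coeff (t, 0) (u, 0) = (if t = u then q else inverse q)" if "t \<in> \<O>" "u \<in> \<O>" for t u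
  proof -
    have "back_act (u, 0) (t, 0) = (t, 0)" using that by (intro L) (auto simp: yd_basis_def d)
    then have "braid_coeff (t, 0) (u, 0) = \<rho> (inv (g t) \<otimes> u \<otimes> g t) $$ (0, 0)" by (simp add: braid_coeff_def)
    then show ?thesis using conj_by_g[of u t] that cls inv q(1) d by auto
  qed
  interpret affine_braiding ?X "yd_braiding G d \<rho> g" braid_coeff "(s, 0)" "(inv s, 0)" q
  proof (intro affine_braiding.intro affine_braiding_axioms.intro)
    show "monomial_braiding ?X (yd_braiding G d \<rho> g) braid_coeff (\<lambda>_ u. u)"
      using monomial_braiding_1[OF d] L by (rule monomial_braiding_diagonal)
  qed (use c cls ne q0 q(2) X in auto)
  show ?thesis unfolding yd_finite_dim_nichols_def by (rule not_finite_dim_nichols_affine)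
qed

end

subsection \<open>The dihedral group\<close>

context group
begin

lemma generate_involution:
  assumes a: "a \<in> carrier G" "a \<otimes> a = \<one>"
  shows "generate G {a} = {\<one>, a}"
proof -
  have inv: "inv a = a" using inv_equality[OF a(2) a(1) a(1)] .
  show ?thesis
  proof
    show "generate G {a} \<subseteq> {\<one>, a}"
    proof
      fix h assume "h \<in> generate G {a}"
      then show "h \<in> {\<one>, a}"
        by induction (use a inv in auto)
    qed
    show "{\<one>, a} \<subseteq> generate G {a}" by (auto intro: generate.intros)
  qed
qed

lemma involution_iso_Z2:
  assumes a: "a \<in> carrier G" "a \<otimes> a = \<one>" "a \<noteq> \<one>"
  shows "G\<lparr>carrier := {\<one>, a}\<rparr> \<cong> integer_mod_group 2"
proof -
  let ?f = "\<lambda>h. if h = a then 1 else 0 :: int"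
  have c2: "carrier (integer_mod_group 2) = {0, 1}"
    by (auto simp: carrier_integer_mod_group)
  have "?f \<in> iso (G\<lparr>carrier := {\<one>, a}\<rparr>) (integer_mod_group 2)"
  proof (rule isoI)
    show "?f \<in> hom (G\<lparr>carrier := {\<one>, a}\<rparr>) (integer_mod_group 2)"
      by (rule homI) (use a in \<open>auto simp: c2 mult_integer_mod_group\<close>)
    show "bij_betw ?f (carrier (G\<lparr>carrier := {\<one>, a}\<rparr>)) (carrier (integer_mod_group 2))"
      unfolding bij_betw_def c2 using a by (auto simp: inj_on_def)
  qed
  then show ?thesis by (auto simp: is_iso_def)
qed

lemma klein_direct_sumI:
  assumes a: "a \<in> carrier G" "a \<otimes> a = \<one>" "a \<noteq> \<one>" and z: "z \<in> carrier G" "z \<otimes> z = \<one>" "z \<noteq> \<one>"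
    and az: "a \<otimes> z = z \<otimes> a" "a \<noteq> z"
  shows "klein_direct_sum G {\<one>, a, z, a \<otimes> z} a z"
proof -
  let ?H = "{\<one>, a, z, a \<otimes> z}"
  have ne: "a \<otimes> z \<noteq> \<one>" "a \<otimes> z \<noteq> a" "a \<otimes> z \<noteq> z"
  proof -
    have "a \<otimes> (a \<otimes> z) = z" using a z by (simp add: m_assoc[symmetric])
    then show "a \<otimes> z \<noteq> \<one>" using a z az by auto
  qed (use a z in auto)
  have [simp]: "a \<otimes> (a \<otimes> h) = h" "z \<otimes> (z \<otimes> h) = h" "z \<otimes> (a \<otimes> h) = a \<otimes> (z \<otimes> h)"
    if "h \<in> carrier G" for h
    using a z az that by (simp_all add: m_assoc[symmetric])
  let ?Z = "integer_mod_group 2"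
  have c2: "carrier ?Z = {0, 1}"
    by (auto simp: carrier_integer_mod_group)
  let ?f = "\<lambda>(i, j). (if i = (1::int) then a else \<one>) \<otimes> (if j = (1::int) then z else \<one>)"
  have cc: "carrier (?Z \<times>\<times> ?Z) = {(0, 0), (0, 1), (1, 0), (1, 1)}" by (auto simp: DirProd_def c2)
  have "?f \<in> iso (?Z \<times>\<times> ?Z) (G\<lparr>carrier := ?H\<rparr>)"
  proof (rule isoI)
    show "?f \<in> hom (?Z \<times>\<times> ?Z) (G\<lparr>carrier := ?H\<rparr>)"
    proof (rule homI)
      fix u v assume "u \<in> carrier (?Z \<times>\<times> ?Z)" "v \<in> carrier (?Z \<times>\<times> ?Z)"
      then show "?f (u \<otimes>\<^bsub>?Z \<times>\<times> ?Z\<^esub> v) = ?f u \<otimes>\<^bsub>G\<lparr>carrier := ?H\<rparr>\<^esub> ?f v"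
        unfolding cc by (elim insertE emptyE)
          (use a z in \<open>simp_all add: DirProd_def mult_integer_mod_group m_assoc az(1)[symmetric]\<close>)
    qed (use a z in \<open>auto simp: c2\<close>)
    show "bij_betw ?f (carrier (?Z \<times>\<times> ?Z)) (carrier (G\<lparr>carrier := ?H\<rparr>))"
      unfolding bij_betw_def cc using a z az ne by (auto simp: inj_on_def)
  qed
  then have "?Z \<times>\<times> ?Z \<cong> G\<lparr>carrier := ?H\<rparr>" by (auto simp: is_iso_def)
  then have "G\<lparr>carrier := ?H\<rparr> \<cong> ?Z \<times>\<times> ?Z"
    by (rule group.iso_sym[OF DirProd_group[OF group_integer_mod_group group_integer_mod_group]])
  then show ?thesis
    using a z az ne
    by (auto simp: klein_direct_sum_def generate_involution set_mult_def)
qed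

end

section \<open>Normal forms of rotations and reflections\<close>

locale dihedral = group G for G :: "('g, 'b) monoid_scheme" (structure) +
  fixes n :: nat and x y :: 'g
  assumes n: "n \<ge> 3" and dihedral: "dihedral_group n G x y"
begin

lemma x_closed [simp]: "x \<in> carrier G" and y_closed [simp]: "y \<in> carrier G"
  and xx: "x \<otimes> x = \<one>" and yn: "y [^] n = \<one>" and xyx: "x \<otimes> y \<otimes> x = inv y"
  and order: "Coset.order G = 2 * n" and gen: "generate G {x, y} = carrier G"
  using dihedral by (auto simp: dihedral_group_def numeral_2_eq_2)

lemma finite_carrier: "finite (carrier G)"
  using order n by (simp add: Coset.order_def card_ge_0_finite)

text \<open>Integer exponents turn inversion and conjugation by reflections into negation;
  \<open>rot_eq_iff\<close> then reduces equality to divisibility by \<open>n\<close>.\<close>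

definition rot :: "int \<Rightarrow> 'g" where
  "rot k = y [^] k"

definition refln :: "int \<Rightarrow> 'g" where
  "refln k = x \<otimes> rot k"

lemma rot_closed [simp]: "rot k \<in> carrier G" and refl_closed [simp]: "refln k \<in> carrier G"
  by (simp_all add: rot_def refln_def)

lemma rot_rot [simp]: "rot i \<otimes> rot j = rot (i + j)"
  by (simp add: rot_def int_pow_mult)

lemma rot_0 [simp]: "rot 0 = \<one>"
  by (simp add: rot_def)

lemma inv_rot [simp]: "inv (rot k) = rot (- k)"
  by (simp add: rot_def int_pow_neg)

lemma rot_nat: "y [^] (k::nat) = rot (int k)"
  by (simp add: rot_def int_pow_int)

lemma rot_1: "rot 1 = y"
  by (simp add: rot_def)

lemma rot_x: "rot k \<otimes> x = x \<otimes> rot (- k)"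
proof -
  have "x \<otimes> (x \<otimes> y \<otimes> x) = y \<otimes> x" by (simp add: m_assoc[symmetric] xx)
  then have yx: "rot 1 \<otimes> x = x \<otimes> rot (-1)" using xyx inv_rot[of 1] by (simp add: rot_1)
  have "(x \<otimes> y \<otimes> x) \<otimes> x = x \<otimes> y" by (simp add: m_assoc xx)
  then have yx': "rot (-1) \<otimes> x = x \<otimes> rot 1" using xyx inv_rot[of 1] by (simp add: rot_1)
  show ?thesis
  proof (induction k rule: int_induct[where k = 0])
    case base
    show ?case by simp
  next
    case (step1 i)
    have "rot (i + 1) \<otimes> x = rot i \<otimes> (rot 1 \<otimes> x)" by (simp add: m_assoc[symmetric])
    also have "\<dots> = (rot i \<otimes> x) \<otimes> rot (-1)" unfolding yx by (simp add: m_assoc)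
    also have "\<dots> = x \<otimes> rot (- (i + 1))" unfolding step1.IH by (simp add: m_assoc)
    finally show ?case .
  next
    case (step2 i)
    have "rot (i - 1) \<otimes> x = rot i \<otimes> (rot (-1) \<otimes> x)" by (simp add: m_assoc[symmetric])
    also have "\<dots> = (rot i \<otimes> x) \<otimes> rot 1" unfolding yx' by (simp add: m_assoc)
    also have "\<dots> = x \<otimes> rot (- (i - 1))" unfolding step2.IH by (simp add: m_assoc)
    finally show ?case .
  qed
qed

lemma refl_rot [simp]: "refln i \<otimes> rot j = refln (i + j)"
  by (simp add: refln_def m_assoc)

lemma rot_refl [simp]: "rot i \<otimes> refln j = refln (j - i)"
proof -
  have "rot i \<otimes> refln j = (rot i \<otimes> x) \<otimes> rot j" by (simp add: refln_def m_assoc)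
  also have "\<dots> = refln (j - i)" unfolding rot_x by (simp add: refln_def m_assoc)
  finally show ?thesis .
qed

lemma refl_refl [simp]: "refln i \<otimes> refln j = rot (j - i)"
proof -
  have "refln i \<otimes> refln j = x \<otimes> (rot i \<otimes> refln j)" by (simp add: refln_def[of i] m_assoc)
  also have "\<dots> = x \<otimes> refln (j - i)" by (simp only: rot_refl)
  also have "\<dots> = (x \<otimes> x) \<otimes> rot (j - i)" unfolding refln_def by (simp add: m_assoc)
  finally show ?thesis by (simp add: xx)
qed

lemma inv_refl [simp]: "inv (refln i) = refln i"
  by (rule inv_equality) simp_all

lemma refl_0: "refln 0 = x" and refl_1: "refln 1 = x \<otimes> y"
  by (simp_all add: refln_def rot_1)

lemma rot_mod: "rot (k mod int n) = rot k"
proof -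
  have "rot (int n) = \<one>" using yn by (simp add: rot_nat)
  then have "rot (int n * j) = \<one>" for j
    by (simp add: rot_def int_pow_pow[symmetric])
  then have "rot (int n * (k div int n)) \<otimes> rot (k mod int n) = rot (k mod int n)" by simp
  then show ?thesis by simp
qed

lemma refl_mod: "refln (k mod int n) = refln k"
  by (simp add: refln_def rot_mod)

lemma carrier_eq: "carrier G = range rot \<union> range refln"
proof
  show "carrier G \<subseteq> range rot \<union> range refln"
  proof
    fix h assume "h \<in> carrier G"
    then have "h \<in> generate G {x, y}" by (simp add: gen)
    then show "h \<in> range rot \<union> range refln"
    proof induction
      case one
      show ?case using rot_0 by (metis UnI1 rangeI)
    next
      case (incl h)
      then show ?case using refl_0 rot_1 by (metis UnI1 UnI2 insertE rangeI singletonD)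
    next
      case (inv h)
      then have "h = refln 0 \<or> h = rot 1" by (simp add: refl_0 rot_1)
      then show ?case by auto
    next
      case (eng h1 h2)
      then show ?case by auto
    qed
  qed
qed auto

text \<open>The relations alone only bound the group by \<open>2 * n\<close> normal forms. The order
  of the group forces all of them to be distinct.\<close>

lemma rot_refl_inj:
  "inj_on rot {0..<int n}" "rot ` {0..<int n} \<inter> refln ` {0..<int n} = {}"
proof -
  let ?I = "{0..<int n}"
  have np: "int n > 0" using n by simp
  have "rot k \<in> rot ` ?I" for k using np by (subst rot_mod[symmetric]) (intro imageI, simp)
  moreover have "refln k \<in> refln ` ?I" for k using np by (subst refl_mod[symmetric]) (intro imageI, simp)
  ultimately have "carrier G = rot ` ?I \<union> refln ` ?I" unfolding carrier_eq by auto
  then have "card (rot ` ?I \<union> refln ` ?I) = 2 * n" using order by (simp add: Coset.order_def)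
  moreover have "card (rot ` ?I \<union> refln ` ?I) + card (rot ` ?I \<inter> refln ` ?I) = card (rot ` ?I) + card (refln ` ?I)"
    by (rule card_Un_Int[symmetric]) simp_all
  moreover have "card (rot ` ?I) \<le> n" "card (refln ` ?I) \<le> n"
    using card_image_le[of ?I rot] card_image_le[of ?I refln] by simp_all
  ultimately have "card (rot ` ?I) = n" "card (refln ` ?I) = n" "card (rot ` ?I \<inter> refln ` ?I) = 0"
    by linarith+
  then show "inj_on rot ?I" "rot ` ?I \<inter> refln ` ?I = {}"
    by (auto intro: eq_card_imp_inj_on)
qed

lemma rot_eq_iff: "rot i = rot j \<longleftrightarrow> int n dvd i - j"
proof -
  have "rot i = rot j \<longleftrightarrow> rot (i mod int n) = rot (j mod int n)" by (simp only: rot_mod)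
  also have "\<dots> \<longleftrightarrow> i mod int n = j mod int n"
    using n by (intro inj_on_eq_iff[OF rot_refl_inj(1)]) auto
  finally show ?thesis by (simp add: mod_eq_dvd_iff)
qed

lemma refl_eq_iff: "refln i = refln j \<longleftrightarrow> int n dvd i - j"
  by (simp add: refln_def rot_eq_iff[symmetric])

lemma rot_neq_refl [simp]: "rot i \<noteq> refln j" "refln j \<noteq> rot i"
proof -
  have "rot (i mod int n) \<in> rot ` {0..<int n}" "refln (j mod int n) \<in> refln ` {0..<int n}"
    using n by auto
  then have "rot (i mod int n) \<noteq> refln (j mod int n)" using rot_refl_inj(2) by (metis IntI empty_iff)
  then show "rot i \<noteq> refln j" "refln j \<noteq> rot i" by (simp_all add: rot_mod refl_mod)
qed

lemma one_neq_refl [simp]: "refln j \<noteq> \<one>" "\<one> \<noteq> refln j"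
  using rot_neq_refl[of 0 j] by simp_all

lemma element_cases:
  assumes "h \<in> carrier G"
  obtains k where "h = rot k" | k where "h = refln k"
  using assms carrier_eq by auto

section \<open>Centralizers and conjugacy classes\<close>

lemma centralizer_rot:
  "rot i \<in> centralizer G (rot k)" "refln i \<in> centralizer G (rot k) \<longleftrightarrow> int n dvd 2 * k"
  by (simp_all add: centralizer_def refl_eq_iff add.commute)

lemma centralizer_refl:
  "rot i \<in> centralizer G (refln k) \<longleftrightarrow> int n dvd 2 * i"
  "refln i \<in> centralizer G (refln k) \<longleftrightarrow> int n dvd 2 * (k - i)"
proof -
  have "rot i \<in> centralizer G (refln k) \<longleftrightarrow> int n dvd (k - i) - (k + i)"
    by (simp add: centralizer_def refl_eq_iff)
  also have "(k - i) - (k + i) = - (2 * i)" by simp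
  finally show "rot i \<in> centralizer G (refln k) \<longleftrightarrow> int n dvd 2 * i" by (simp only: dvd_minus_iff)
  have "refln i \<in> centralizer G (refln k) \<longleftrightarrow> int n dvd (k - i) - (i - k)"
    by (simp add: centralizer_def rot_eq_iff)
  also have "(k - i) - (i - k) = 2 * (k - i)" by simp
  finally show "refln i \<in> centralizer G (refln k) \<longleftrightarrow> int n dvd 2 * (k - i)" .
qed

lemma conj_rot:
  assumes "c \<in> carrier G"
  shows "c \<otimes> rot k \<otimes> inv c \<in> {rot k, rot (- k)}"
  using assms by (cases rule: element_cases) simp_all

lemma conj_refl: "rot i \<otimes> refln k \<otimes> inv (rot i) = refln (k - 2 * i)"
  by simp

lemma conj_refl_refl:
  assumes "c \<in> carrier G"
  shows "\<exists>j. c \<otimes> refln k \<otimes> inv c = refln j"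
  using assms by (cases rule: element_cases) auto

lemma class_rot: "conj_class G (rot k) = {rot k, inv (rot k)}"
proof
  show "conj_class G (rot k) \<subseteq> {rot k, inv (rot k)}"
    using conj_rot by (auto simp: conj_class_def)
  have "rot k = rot 0 \<otimes> rot k \<otimes> inv (rot 0)" "inv (rot k) = refln 0 \<otimes> rot k \<otimes> inv (refln 0)"
    by simp_all
  then show "{rot k, inv (rot k)} \<subseteq> conj_class G (rot k)"
    unfolding conj_class_def using rot_closed refl_closed by blast
qed

lemma centralizer_rot_abelian:
  assumes "\<not> int n dvd 2 * k" "h \<in> centralizer G (rot k)"
  obtains i where "h = rot i"
proof -
  have "h \<in> carrier G" using assms by (simp add: centralizer_def)
  then show ?thesis
    by (cases rule: element_cases) (use assms that centralizer_rot in auto)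
qed

text \<open>A rotation that commutes with a reflection is central, and two reflections that commute
  with \<open>refln k\<close> differ by such a rotation.\<close>

lemma centralizer_refl_comm:
  assumes "h \<in> centralizer G (refln k)" "h' \<in> centralizer G (refln k)"
  shows "h \<otimes> h' = h' \<otimes> h"
proof -
  have comm: "int n dvd 2 * i \<Longrightarrow> rot i \<otimes> h = h \<otimes> rot i" if "h \<in> carrier G" for i h
    using that centralizer_refl(1)[of i] centralizer_rot(1)[of i]
    by (cases rule: element_cases) (auto simp: centralizer_def)
  have "h \<in> carrier G" "h' \<in> carrier G" using assms by (auto simp: centralizer_def)
  then consider i where "h = rot i" | i where "h' = rot i" | i j where "h = refln i" "h' = refln j"
    by (metis element_cases)
  then show ?thesis
  proof cases
    case (1 i)
    then show ?thesis using comm[of h' i] centralizer_refl assms \<open>h' \<in> carrier G\<close> by simp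
  next
    case (2 i)
    then show ?thesis using comm[of h i] centralizer_refl assms \<open>h \<in> carrier G\<close> by simp
  next
    case (3 i j)
    have "int n dvd 2 * (k - i) - 2 * (k - j)"
      using centralizer_refl assms 3 by (intro dvd_diff) simp_all
    also have "2 * (k - i) - 2 * (k - j) = (j - i) - (i - j)" by simp
    finally show ?thesis using 3 by (simp add: rot_eq_iff)
  qed
qed

lemma rot_central:
  assumes "int n dvd 2 * k" "h \<in> carrier G"
  shows "h \<otimes> rot k = rot k \<otimes> h"
  using assms(2) by (cases rule: element_cases)
    (use assms(1) centralizer_rot[of _ k] in \<open>auto simp: centralizer_def\<close>)

lemma odd_dvd_iff: "odd n \<Longrightarrow> int n dvd 2 * i \<longleftrightarrow> int n dvd i"
  by (rule coprime_dvd_mult_right_iff) (simp add: coprime_right_2_iff_odd)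

lemma centralizer_refl_odd:
  assumes "odd n"
  shows "centralizer G (refln k) = {\<one>, refln k}"
proof
  show "centralizer G (refln k) \<subseteq> {\<one>, refln k}"
  proof
    fix h assume h: "h \<in> centralizer G (refln k)"
    then have "h \<in> carrier G" by (simp add: centralizer_def)
    then show "h \<in> {\<one>, refln k}"
    proof (cases rule: element_cases)
      case (1 i)
      then have "int n dvd i" using h centralizer_refl odd_dvd_iff[OF assms] by simp
      then have "rot i = rot 0" unfolding rot_eq_iff by simp
      with 1 show ?thesis by simp
    next
      case (2 i)
      then have "int n dvd k - i" using h unfolding 2 centralizer_refl odd_dvd_iff[OF assms] by simp
      then have "refln k = refln i" by (simp add: refl_eq_iff)
      with 2 show ?thesis by simp
    qed
  qed
  show "{\<one>, refln k} \<subseteq> centralizer G (refln k)"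
    using centralizer_closed[of "refln k"] by simp
qed

lemma even_dvd:
  assumes "n = 2 * m"
  shows "int n dvd 2 * i \<longleftrightarrow> rot i \<in> {\<one>, rot (int m)}"
proof
  assume "int n dvd 2 * i"
  then obtain c where c: "i = int m * c" using assms by auto
  show "rot i \<in> {\<one>, rot (int m)}"
  proof (cases "even c")
    case True
    then have "int n dvd i - 0" using c assms by auto
    then have "rot i = rot 0" by (simp only: rot_eq_iff)
    then show ?thesis by simp
  next
    case False
    then obtain e where "c = 2 * e + 1" by (elim oddE)
    then have "i - int m = int n * e" using c assms by (simp add: algebra_simps)
    then have "int n dvd i - int m" by simp
    then show ?thesis by (simp add: rot_eq_iff)
  qed
next
  assume "rot i \<in> {\<one>, rot (int m)}"
  then have "int n dvd i - 0 \<or> int n dvd i - int m" unfolding rot_eq_iff[symmetric] by simp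
  then have "int n dvd i \<or> int n dvd i - int m" by simp
  then show "int n dvd 2 * i"
  proof
    assume "int n dvd i - int m"
    then have "int n dvd 2 * (i - int m) + int n" by (intro dvd_add dvd_mult) simp_all
    then show ?thesis using assms by (simp add: algebra_simps)
  qed simp
qed

lemma rot_m: "n = 2 * m \<Longrightarrow> rot (int m) \<noteq> \<one>"
  using n rot_eq_iff[of "int m" 0] zdvd_not_zless[of "int m" "int n"] by auto

lemma centralizer_refl_even:
  assumes "n = 2 * m"
  shows "centralizer G (refln k) = {\<one>, refln k, rot (int m), refln k \<otimes> rot (int m)}"
proof -
  have "h \<in> centralizer G (refln k) \<longleftrightarrow> h \<in> {\<one>, refln k, rot (int m), refln k \<otimes> rot (int m)}"
    if "h \<in> carrier G" for h
    using that
  proof (cases rule: element_cases)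
    case (1 i)
    then show ?thesis by (simp add: centralizer_refl even_dvd[OF assms])
  next
    case (2 i)
    have *: "refln i = refln j \<longleftrightarrow> rot (i - k) = rot (j - k)" for j
      by (simp add: refl_eq_iff rot_eq_iff)
    have "int n dvd 2 * (k - i) \<longleftrightarrow> int n dvd 2 * (i - k)"
      by (metis dvd_minus_iff minus_diff_eq mult_minus_right)
    then have "h \<in> centralizer G (refln k) \<longleftrightarrow> int n dvd 2 * (i - k)"
      by (simp only: 2 centralizer_refl)
    also have "\<dots> \<longleftrightarrow> rot (i - k) \<in> {\<one>, rot (int m)}" by (rule even_dvd[OF assms])
    also have "\<dots> \<longleftrightarrow> refln i \<in> {refln k, refln (k + int m)}"
      unfolding insert_iff * by simp
    finally show ?thesis using 2 by simp
  qed
  moreover have "centralizer G (refln k) \<subseteq> carrier G" by (auto simp: centralizer_def)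
  moreover have "{\<one>, refln k, rot (int m), refln k \<otimes> rot (int m)} \<subseteq> carrier G" by simp
  ultimately show ?thesis by blast
qed

lemma klein_centralizer_refl:
  assumes "n = 2 * m"
  shows "klein_direct_sum G (centralizer G (refln k)) (refln k) (rot (int m))"
  unfolding centralizer_refl_even[OF assms]
proof (rule klein_direct_sumI)
  have "rot (int m) \<otimes> rot (int m) = rot (int n)" using assms by simp
  also have "\<dots> = rot 0" by (simp only: rot_eq_iff) simp
  finally show "rot (int m) \<otimes> rot (int m) = \<one>" by simp
  show "refln k \<otimes> rot (int m) = rot (int m) \<otimes> refln k"
    using even_dvd[OF assms, of "int m"] by (intro rot_central) simp_all
qed (use rot_m[OF assms] in simp_all)

text \<open>Conjugation by rotations changes the index of a reflection by even numbers, so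
  \<open>k\<close> can be reduced to its parity; for odd \<open>n\<close> the number 2 is invertible
  modulo \<open>n\<close> and every index can be moved to 0.\<close>

lemma refl_conj_standard:
  shows "odd n \<Longrightarrow> \<exists>c\<in>carrier G. c \<otimes> refln k \<otimes> inv c = x"
    and "\<exists>c\<in>carrier G. c \<otimes> refln k \<otimes> inv c \<in> {x, x \<otimes> y}"
proof -
  show "\<exists>c\<in>carrier G. c \<otimes> refln k \<otimes> inv c \<in> {x, x \<otimes> y}"
  proof (cases "even k")
    case True
    then have "k - 2 * (k div 2) = 0" by simp
    then have "rot (k div 2) \<otimes> refln k \<otimes> inv (rot (k div 2)) = x"
      unfolding conj_refl by (simp only: refl_0)
    then show ?thesis using rot_closed by blast
  next
    case False
    then have "k - 2 * (k div 2) = 1" by (simp add: minus_mult_div_eq_mod mod_2_eq_odd)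
    then have "rot (k div 2) \<otimes> refln k \<otimes> inv (rot (k div 2)) = x \<otimes> y"
      unfolding conj_refl by (simp only: refl_1)
    then show ?thesis using rot_closed by blast
  qed
  assume "odd n"
  then obtain e where e: "int n = 2 * e + 1" by (metis even_of_nat oddE)
  \<comment> \<open>\<open>e + 1\<close> is the inverse of 2 modulo \<open>n = 2 * e + 1\<close>, so
    \<open>2 * ?i\<close> is congruent to \<open>k\<close>.\<close>
  let ?i = "k * (e + 1)"
  have "k - 2 * ?i - 0 = int n * (- k)" unfolding e by (simp add: algebra_simps)
  then have "int n dvd k - 2 * ?i - 0" by (simp only: dvd_triv_left)
  then have "refln (k - 2 * ?i) = refln 0" by (simp only: refl_eq_iff)
  then have "rot ?i \<otimes> refln k \<otimes> inv (rot ?i) = x" by (simp only: conj_refl refl_0)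
  then show "\<exists>c\<in>carrier G. c \<otimes> refln k \<otimes> inv c = x" using rot_closed by blast
qed

end

subsection \<open>Characters and pairs\<close>

lemma mem_characters:
  "\<phi> \<in> characters G H \<longleftrightarrow> (\<forall>h\<in>H. \<phi> h \<noteq> 0) \<and> (\<forall>h\<in>H. \<forall>k\<in>H. \<phi> (h \<otimes>\<^bsub>G\<^esub> k) = \<phi> h * \<phi> k)"
  unfolding characters_def hom_units_of_iff Units_complex_ring by simp

context group
begin

lemma centralizer_conj:
  assumes "c \<in> carrier G" "s \<in> carrier G"
  shows "h \<in> centralizer G (c \<otimes> s \<otimes> inv c) \<Longrightarrow> inv c \<otimes> h \<otimes> c \<in> centralizer G s"
proof -
  assume h: "h \<in> centralizer G (c \<otimes> s \<otimes> inv c)"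
  define a where "a = c \<otimes> s \<otimes> inv c"
  have hc: "h \<in> carrier G" "h \<otimes> a = a \<otimes> h" "a \<in> carrier G"
    using h assms by (auto simp: centralizer_def a_def)
  have "inv c \<otimes> h \<otimes> c \<otimes> s = inv c \<otimes> (h \<otimes> a) \<otimes> c"
    using assms hc(1) by (simp add: a_def m_assoc)
  also have "\<dots> = inv c \<otimes> (a \<otimes> h) \<otimes> c" by (simp only: hc)
  also have "\<dots> = s \<otimes> (inv c \<otimes> h \<otimes> c)"
    using assms hc(1) by (simp add: a_def m_assoc)
  finally show ?thesis using assms hc by (simp add: centralizer_def)
qed

lemma subgroup_centralizer: "s \<in> carrier G \<Longrightarrow> subgroup (centralizer G s) G"
  by (rule subgroupI) (use centralizer_closed in \<open>auto simp: centralizer_def\<close>)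

lemma character_pow:
  assumes \<phi>: "\<phi> \<in> characters G H" and H: "subgroup H G" and h: "h \<in> H"
  shows "\<phi> (h [^] (i::nat)) = \<phi> h ^ i"
proof -
  have hi: "h [^] (i::nat) \<in> H" for i
    by (induction i) (use H h in \<open>auto intro: subgroup.m_closed subgroup.one_closed\<close>)
  have one: "\<one> \<in> H" by (rule subgroup.one_closed[OF H])
  with \<phi> have "\<phi> (\<one> \<otimes> \<one>) = \<phi> \<one> * \<phi> \<one>" "\<phi> \<one> \<noteq> 0"
    unfolding mem_characters by blast+
  then have "\<phi> \<one> = 1" by simp
  then show ?thesis
    by (induction i) (use \<phi> hi h in \<open>simp_all add: mem_characters\<close>)
qed

lemma tensor_characterI:
  assumes a: "a \<in> carrier G" and \<phi>: "\<phi> \<in> characters G (centralizer G a)"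
    and z: "z \<in> centralizer G a" and "\<phi> a = - 1" "\<And>k. \<phi> z ^ k = \<beta> k"
  shows "tensor_character G (centralizer G a) a z Z2_sgn \<beta> \<phi>"
proof -
  note H = subgroup_centralizer[OF a]
  have pow: "h \<in> centralizer G a \<Longrightarrow> h [^] (i::nat) \<in> centralizer G a" for h i
    by (induction i) (use H in \<open>auto intro: subgroup.m_closed subgroup.one_closed\<close>)
  have "\<phi> (a [^] i \<otimes> z [^] k) = Z2_sgn i * \<beta> k" for i k :: nat
  proof -
    have "\<phi> (a [^] i \<otimes> z [^] k) = \<phi> (a [^] i) * \<phi> (z [^] k)"
      using \<phi> pow[OF centralizer_closed(4)[OF a]] pow[OF z] by (simp add: mem_characters)
    also have "\<phi> (a [^] i) = \<phi> a ^ i"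
      by (rule character_pow[OF \<phi> H]) (rule centralizer_closed(4)[OF a])
    also have "\<phi> (z [^] k) = \<phi> z ^ k" by (rule character_pow[OF \<phi> H z])
    finally show ?thesis using assms(4,5) by (simp add: Z2_sgn_def)
  qed
  with \<phi> show ?thesis by (simp add: tensor_character_def)
qed

end

lemma one_mat_Units: "1\<^sub>m d \<in> Units (ring_mat TYPE(complex) d ())"
  by (auto simp: Units_def ring_mat_def intro!: bexI[of _ "1\<^sub>m d"])

text \<open>The first \<open>n\<close> powers of \<open>\<omega>\<close> are distinct roots of
  unity, and there are only \<open>n\<close> such roots.\<close>

lemma primitive_root_powers:
  assumes \<omega>: "primitive_root_of_unity n \<omega>" and n: "n > 0" and a: "a ^ n = 1"
  obtains j where "a = \<omega> ^ j"
proof -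
  have inj: "inj_on (\<lambda>j. \<omega> ^ j) {..<n}"
  proof (rule linorder_inj_onI)
    fix i j assume ij: "i < j" "i \<in> {..<n}" "j \<in> {..<n}"
    have "\<omega> \<noteq> 0" using \<omega> n by (auto simp: primitive_root_of_unity_def power_0_left split: if_splits)
    show "\<omega> ^ i \<noteq> \<omega> ^ j"
    proof
      assume "\<omega> ^ i = \<omega> ^ j"
      also have "\<omega> ^ j = \<omega> ^ i * \<omega> ^ (j - i)" using ij by (simp add: power_add[symmetric])
      finally have "\<omega> ^ (j - i) = 1" using \<open>\<omega> \<noteq> 0\<close> by simp
      with \<omega> ij show False by (auto simp: primitive_root_of_unity_def)
    qed
  qed auto
  have "(\<lambda>j. \<omega> ^ j) ` {..<n} = {z. z ^ n = 1}"
  proof (rule card_subset_eq)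
    show "finite {z::complex. z ^ n = 1}" by (rule card_ge_0_finite) (simp add: card_roots_unity_eq n)
    show "(\<lambda>j. \<omega> ^ j) ` {..<n} \<subseteq> {z. z ^ n = 1}"
    proof clarify
      fix j
      have "(\<omega> ^ j) ^ n = (\<omega> ^ n) ^ j" by (simp add: power_mult[symmetric] mult.commute)
      then show "(\<omega> ^ j) ^ n = 1" using \<omega> by (simp add: primitive_root_of_unity_def)
    qed
    show "card ((\<lambda>j. \<omega> ^ j) ` {..<n}) = card {z::complex. z ^ n = 1}"
      by (simp add: card_image inj card_roots_unity_eq n)
  qed
  with a that show ?thesis by blast
qed

context yd_module
begin

text \<open>A scalar matrix is unchanged by the intertwiner \<open>P\<close>, so the scalar by which
  \<open>s\<close> acts is an invariant of the pair.\<close>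

lemma same_pair_scalar:
  assumes "same_pair G d s \<rho> d' s' \<rho>'" "\<rho>' s' = q \<cdot>\<^sub>m 1\<^sub>m d'"
  shows "\<rho> s = q \<cdot>\<^sub>m 1\<^sub>m d"
proof -
  from assms obtain k P where k: "k \<in> carrier G" "k \<otimes> s \<otimes> inv k = s'"
    and P: "P \<in> Units (ring_mat TYPE(complex) d ())"
    and PP: "\<And>h. h \<in> centralizer G s \<Longrightarrow> P * \<rho> h = \<rho>' (k \<otimes> h \<otimes> inv k) * P" and d: "d = d'"
    unfolding same_pair_def by blast
  obtain P' where P': "P \<in> carrier_mat d d" "P' \<in> carrier_mat d d" "P' * P = 1\<^sub>m d"
    using P by (rule Units_ring_matD)
  have rc: "\<rho> s \<in> carrier_mat d d"
    using representation_carrier[OF rep] centralizer_closed(4)[OF s] by simp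
  have "\<rho> s = (P' * P) * \<rho> s" using P' rc by simp
  also have "\<dots> = P' * (P * \<rho> s)" using P' rc by (intro assoc_mult_mat)
  also have "P * \<rho> s = (q \<cdot>\<^sub>m 1\<^sub>m d) * P"
    using PP[OF centralizer_closed(4)[OF s]] k assms(2) d by simp
  also have "\<dots> = q \<cdot>\<^sub>m P" using P' by (simp add: mult_smult_assoc_mat[of _ d d])
  also have "P' * (q \<cdot>\<^sub>m P) = q \<cdot>\<^sub>m (P' * P)" using P' by (intro mult_smult_distrib)
  finally show ?thesis by (simp add: P')
qed

lemma same_pair_char:
  assumes d: "d = 1" and c: "c \<in> carrier G"
    and \<phi>: "\<And>h. h \<in> centralizer G s \<Longrightarrow> \<phi> (c \<otimes> h \<otimes> inv c) = \<rho> h $$ (0, 0)"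
  shows "same_pair G d s \<rho> 1 (c \<otimes> s \<otimes> inv c) (char_rep \<phi>)"
proof -
  have "1\<^sub>m d * \<rho> h = char_rep \<phi> (c \<otimes> h \<otimes> inv c) * 1\<^sub>m d" if h: "h \<in> centralizer G s" for h
  proof -
    have rc: "\<rho> h \<in> carrier_mat 1 1" using representation_carrier[OF rep h] d by simp
    have "char_rep \<phi> (c \<otimes> h \<otimes> inv c) = \<rho> h"
      using rc \<phi>[OF h] by (intro eq_matI) (auto simp: char_rep_def)
    then show ?thesis using rc d by simp
  qed
  then show ?thesis
    unfolding same_pair_def using d c one_mat_Units[of d] by blast
qed

text \<open>The transport of a one-dimensional \<open>\<rho>\<close> to the centralizer of the
  conjugate of \<open>s\<close> by \<open>c\<close>; it replaces \<open>s\<close> by a standard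
  representative of its class.\<close>

definition conj_char :: "'g \<Rightarrow> 'g \<Rightarrow> complex" where
  "conj_char c h = \<rho> (inv c \<otimes> h \<otimes> c) $$ (0, 0)"

lemma conj_char:
  assumes d: "d = 1" and c: "c \<in> carrier G" and a: "c \<otimes> s \<otimes> inv c = a"
  shows "conj_char c \<in> characters G (centralizer G a)"
    and "same_pair G d s \<rho> 1 a (char_rep (conj_char c))"
    and "conj_char c a = \<rho> s $$ (0, 0)"
proof -
  have cent: "inv c \<otimes> h \<otimes> c \<in> centralizer G s" if "h \<in> centralizer G a" for h
    using centralizer_conj[OF c s] that a by simp
  show "conj_char c \<in> characters G (centralizer G a)"
    unfolding mem_characters
  proof (intro conjI ballI)
    fix h assume "h \<in> centralizer G a"
    then have "\<rho> (inv c \<otimes> h \<otimes> c) \<in> Units (ring_mat TYPE(complex) d ())"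
      using cent rep by (simp add: representation_iff)
    then obtain B where B: "\<rho> (inv c \<otimes> h \<otimes> c) \<in> carrier_mat 1 1" "B \<in> carrier_mat 1 1"
      "\<rho> (inv c \<otimes> h \<otimes> c) * B = 1\<^sub>m 1"
      unfolding d by (elim Units_ring_matD)
    then have "conj_char c h * B $$ (0, 0) = 1\<^sub>m 1 $$ (0, 0)"
      unfolding conj_char_def B(3)[symmetric] by (simp only: mult_mat_1_1)
    then show "conj_char c h \<noteq> 0" by auto
  next
    fix h k assume hk: "h \<in> centralizer G a" "k \<in> centralizer G a"
    then have "h \<in> carrier G" "k \<in> carrier G" by (auto simp: centralizer_def)
    then have "inv c \<otimes> (h \<otimes> k) \<otimes> c = (inv c \<otimes> h \<otimes> c) \<otimes> (inv c \<otimes> k \<otimes> c)"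
      using c by (simp add: m_assoc)
    then show "conj_char c (h \<otimes> k) = conj_char c h * conj_char c k"
      unfolding conj_char_def using rep_mult_1[OF d cent cent] hk by simp
  qed
  have *: "conj_char c (c \<otimes> h \<otimes> inv c) = \<rho> h $$ (0, 0)" if "h \<in> carrier G" for h
    using c that by (simp add: conj_char_def m_assoc)
  then show "same_pair G d s \<rho> 1 a (char_rep (conj_char c))"
    unfolding a[symmetric] by (intro same_pair_char d c) (simp add: centralizer_def)
  show "conj_char c a = \<rho> s $$ (0, 0)" using *[OF s] by (simp only: a)
qed

end

subsection \<open>Pairs over the dihedral group\<close>

locale yd_dihedral = yd_module G s d \<rho> g + dihedral G n x y
  for G :: "('g, 'b) monoid_scheme" (structure) and s d \<rho> g n x y +
  assumes irr: "irreducible_rep G (centralizer G s) d \<rho>"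
begin

lemma d_pos: "d > 0"
  using irr by (simp add: irreducible_rep_def)

lemma rep_scalar: "\<exists>q. \<rho> s = q \<cdot>\<^sub>m 1\<^sub>m d"
  by (rule central_rep_scalar[OF irr]) (auto simp: centralizer_closed s centralizer_def)

lemma scalar_square:
  assumes "\<rho> s = q \<cdot>\<^sub>m 1\<^sub>m d" "s \<otimes> s = \<one>"
  shows "q = 1 \<or> q = - 1"
proof -
  have "\<rho> s * \<rho> s = \<rho> \<one>"
    using representation_mult[OF rep] centralizer_closed(4)[OF s] assms(2) by metis
  moreover have "\<rho> s * \<rho> s = (q * q) \<cdot>\<^sub>m 1\<^sub>m d"
    unfolding assms(1) by (intro eq_matI) (auto simp: mult_smult_assoc_mat[of _ d d])
  ultimately have "((q * q) \<cdot>\<^sub>m 1\<^sub>m d) $$ (0, 0) = (1\<^sub>m d :: complex mat) $$ (0, 0)"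
    by (simp add: rep_one)
  then have "q\<^sup>2 = 1" using d_pos by (simp add: power2_eq_square)
  then show ?thesis by (simp add: power2_eq_1_iff)
qed

lemma one_scalar: "1 \<cdot>\<^sub>m 1\<^sub>m d = (1\<^sub>m d :: complex mat)"
  by (intro eq_matI) auto

section \<open>Necessary conditions\<close>

lemma reflection_case:
  assumes "s = refln k" "yd_finite_dim_nichols G d s \<rho> g"
  shows "d = 1" "\<rho> s = (-1) \<cdot>\<^sub>m 1\<^sub>m d"
proof -
  show d: "d = 1"
    by (rule abelian_irreducible_dim[OF irr]) (use centralizer_refl_comm assms(1) in simp)
  obtain q where q: "\<rho> s = q \<cdot>\<^sub>m 1\<^sub>m d" using rep_scalar by blast
  have "q = 1 \<or> q = - 1" by (rule scalar_square[OF q]) (simp add: assms(1))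
  moreover have "q \<noteq> 1"
    using not_finite_dim_trivial[OF d_pos] q d assms(2) one_scalar by auto
  ultimately show "\<rho> s = (-1) \<cdot>\<^sub>m 1\<^sub>m d" using q by auto
qed

text \<open>For odd \<open>n\<close> the only such rotation is the identity, which acts by 1 and is
  already excluded. The first conclusion thus keeps this case out of part (a).\<close>

lemma central_case:
  assumes k: "s = rot k" "int n dvd 2 * k" and fd: "yd_finite_dim_nichols G d s \<rho> g"
  shows "\<exists>m. n = 2 * m" "n = 2 * m \<Longrightarrow> central_pair G y m d s \<rho>"
proof -
  have central: "h \<otimes> s = s \<otimes> h" if "h \<in> carrier G" for h
    using rot_central[OF k(2) that] k(1) by simp
  have ss: "s \<otimes> s = \<one>"
  proof -
    have "rot (k + k) = rot 0" unfolding rot_eq_iff using k(2) by simp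
    then show ?thesis by (simp add: k(1))
  qed
  obtain q where q: "\<rho> s = q \<cdot>\<^sub>m 1\<^sub>m d" using rep_scalar by blast
  have "q \<noteq> 1"
    using not_finite_dim_trivial[OF d_pos] q central fd one_scalar by auto
  with scalar_square[OF q ss] have m1: "q = - 1" by blast
  have s1: "s \<noteq> \<one>"
  proof
    assume "s = \<one>"
    then have "(q \<cdot>\<^sub>m 1\<^sub>m d) $$ (0, 0) = (1\<^sub>m d :: complex mat) $$ (0, 0)" using q rep_one by simp
    then show False using m1 d_pos by simp
  qed
  have nd: "\<not> int n dvd k" using s1 rot_eq_iff[of k 0] k(1) by auto
  then have "even n" using k(2) odd_dvd_iff by blast
  then show "\<exists>m. n = 2 * m" by (auto elim: evenE)
  assume n2: "n = 2 * m"
  then have sm: "s = y [^] m" using even_dvd[OF n2, of k] k s1 by (simp add: rot_nat)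
  have cG: "centralizer G s = carrier G" using central by (auto simp: centralizer_def)
  have "\<rho> (y [^] m) = - 1\<^sub>m d"
    unfolding sm[symmetric] q m1 by (intro eq_matI) auto
  moreover have "same_pair G d s \<rho> d (y [^] m) \<rho>"
    unfolding same_pair_def sm[symmetric]
  proof (intro conjI refl bexI[of _ \<one>] bexI[of _ "1\<^sub>m d"] ballI one_mat_Units one_closed)
    show "\<one> \<otimes> s \<otimes> inv \<one> = s" using s by simp
    fix h assume h: "h \<in> centralizer G s"
    then have "h \<in> carrier G" by (simp add: centralizer_def)
    then show "1\<^sub>m d * \<rho> h = \<rho> (\<one> \<otimes> h \<otimes> inv \<one>) * 1\<^sub>m d"
      using representation_carrier[OF rep h] by simp
  qed
  ultimately show "central_pair G y m d s \<rho>"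
    unfolding central_pair_def using irr cG by auto
qed

lemma rotation_case:
  assumes k: "s = rot k" "\<not> int n dvd 2 * k" and fd: "yd_finite_dim_nichols G d s \<rho> g"
    and \<omega>: "primitive_root_of_unity n \<omega>" and \<chi>: "\<chi> \<in> characters G (generate G {y})" "\<chi> y = \<omega>"
  shows "\<exists>m. n = 2 * m" "n = 2 * m \<Longrightarrow> rotation_pair G y n m \<omega> \<chi> d s \<rho>"
proof -
  have cent: "\<exists>i. h = rot i" if "h \<in> centralizer G s" for h
    using centralizer_rot_abelian[OF k(2)] that k(1) by metis
  have d: "d = 1"
  proof (rule abelian_irreducible_dim[OF irr])
    fix h h' assume "h \<in> centralizer G s" "h' \<in> centralizer G s"
    then obtain i j where "h = rot i" "h' = rot j" using cent by blast
    then show "h \<otimes> h' = h' \<otimes> h" by (simp add: add.commute)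
  qed
  obtain q where q: "\<rho> s = q \<cdot>\<^sub>m 1\<^sub>m d" using rep_scalar by blast
  have ne: "s \<noteq> inv s" using k by (simp add: rot_eq_iff)
  have "q\<^sup>2 = 1"
    using not_finite_dim_affine[OF _ ne d q] class_rot[of k] k(1) fd by auto
  moreover have "q \<noteq> 1"
    using not_finite_dim_trivial[OF d_pos] q d fd one_scalar by auto
  ultimately have m1: "q = - 1" by (simp add: power2_eq_1_iff)
  let ?\<phi> = "conj_char \<one>"
  have "\<one> \<otimes> s \<otimes> inv \<one> = s" using s by simp
  note \<phi> = conj_char[OF d one_closed this]
  have \<phi>s: "?\<phi> s = - 1" using \<phi>(3) by (simp add: q m1 d)
  have ys: "y \<in> centralizer G s" using centralizer_rot(1)[of 1 k] by (simp add: rot_1 k(1))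
  have \<phi>pow: "?\<phi> (y [^] (l::nat)) = ?\<phi> y ^ l" for l
    by (rule character_pow[OF \<phi>(1) subgroup_centralizer[OF s] ys])
  have \<chi>pow: "\<chi> (y [^] (l::nat)) = \<omega> ^ l" for l
    unfolding \<chi>(2)[symmetric]
    by (rule character_pow[OF \<chi>(1) generate_is_subgroup]) (auto intro: generate.intros)
  \<comment> \<open>The identity is written as a zeroth power, so that \<open>character_pow\<close>
    evaluates the character there to 1.\<close>
  have "?\<phi> y ^ n = ?\<phi> (y [^] (0::nat))" using \<phi>pow[of n] yn by simp
  also have "\<dots> = 1" unfolding \<phi>pow by simp
  finally have "?\<phi> y ^ n = 1" .
  \<comment> \<open>A character of a cyclic group is determined by its value at the generator, so
    this exponent makes \<open>?\<phi>\<close> the power \<open>\<chi>^j\<close>.\<close>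
  then obtain j where j: "?\<phi> y = \<omega> ^ j"
    using primitive_root_powers[OF \<omega>] n by (metis gr_zeroI not_numeral_le_zero)
  have nat_pow: "rot i = y [^] nat (i mod int n)" for i
    using n by (simp add: rot_nat rot_mod)
  define h where "h = nat (k mod int n)"
  have sh: "s = y [^] h" by (simp add: k(1) nat_pow h_def)
  have "\<omega> ^ (h * j) = (\<omega> ^ j) ^ h" by (simp add: power_mult[symmetric] mult.commute)
  then have hj: "\<omega> ^ (h * j) = - 1" using \<phi>s \<phi>pow[of h] j by (simp add: sh)
  show "\<exists>m. n = 2 * m"
  proof (rule ccontr)
    assume "\<nexists>m. n = 2 * m"
    then have "odd n" by (auto elim!: evenE)
    \<comment> \<open>An odd power of -1 is -1, whereas every power of \<open>\<omega>\<close> is an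
      \<open>n\<close>-th root of unity.\<close>
    then have "(\<omega> ^ (h * j)) ^ n = - 1" unfolding hj by simp
    moreover have "(\<omega> ^ (h * j)) ^ n = (\<omega> ^ n) ^ (h * j)"
      by (simp add: power_mult[symmetric] mult.commute)
    ultimately show False using \<omega> by (simp add: primitive_root_of_unity_def)
  qed
  assume n2: "n = 2 * m"
  have h1: "1 \<le> h"
  proof (rule ccontr)
    assume "\<not> 1 \<le> h"
    then have "h = 0" by simp
    then have "rot k = rot 0" using sh k(1) by simp
    then show False using k(2) unfolding rot_eq_iff by simp
  qed
  have hn: "h \<le> n - 1" using n by (simp add: h_def nat_le_iff)
  have hm: "h \<noteq> m"
  proof
    assume "h = m"
    then have "rot k \<in> {\<one>, rot (int m)}" using sh k(1) by (simp add: rot_nat)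
    then show False using k(2) even_dvd[OF n2] by blast
  qed
  have "same_pair G d s \<rho> 1 (\<one> \<otimes> s \<otimes> inv \<one>) (char_rep (\<lambda>k. \<chi> k ^ j))"
  proof (rule same_pair_char[OF d one_closed])
    fix h' assume h': "h' \<in> centralizer G s"
    then obtain i where "h' = rot i" using cent by blast
    then obtain l :: nat where l: "h' = y [^] l" using nat_pow by blast
    have "\<rho> h' $$ (0, 0) = ?\<phi> h'" by (simp add: conj_char_def l)
    also have "\<dots> = \<chi> h' ^ j"
      unfolding l \<phi>pow \<chi>pow j by (simp add: power_mult[symmetric] mult.commute)
    finally show "\<chi> (\<one> \<otimes> h' \<otimes> inv \<one>) ^ j = \<rho> h' $$ (0, 0)" by (simp add: l)
  qed
  then have "same_pair G d s \<rho> 1 (y [^] h) (char_rep (\<lambda>k. \<chi> k ^ j))"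
    using s sh by simp
  then show "rotation_pair G y n m \<omega> \<chi> d s \<rho>"
    unfolding rotation_pair_def using h1 hn hm hj by blast
qed

lemma sgn_pair_reflection:
  assumes "s = refln k" "odd n" "d = 1" "\<rho> s = (-1) \<cdot>\<^sub>m 1\<^sub>m d"
  shows "sgn_pair G x d s \<rho>"
proof -
  obtain c where c: "c \<in> carrier G" "c \<otimes> s \<otimes> inv c = x"
    using refl_conj_standard(1)[OF assms(2), of k] assms(1) by blast
  note \<phi> = conj_char[OF assms(3) c]
  have "conj_char c x \<noteq> 1" using \<phi>(3) assms by simp
  moreover have "x \<in> centralizer G x" by (rule centralizer_closed(4)) simp
  ultimately show ?thesis unfolding sgn_pair_def using \<phi>(1,2) by blast
qed

lemma reflection_pair_reflection:
  assumes s: "s = refln k" and n2: "n = 2 * m" and d: "d = 1" and "\<rho> s = (-1) \<cdot>\<^sub>m 1\<^sub>m d"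
  shows "reflection_pair G x (y [^] m) d s \<rho> \<or> reflection_pair G (x \<otimes> y) (y [^] m) d s \<rho>"
proof -
  obtain c a where c: "c \<in> carrier G" "c \<otimes> s \<otimes> inv c = a" and a: "a \<in> {x, x \<otimes> y}"
    using refl_conj_standard(2)[of k] s by blast
  have aG: "a \<in> carrier G" using a x_closed y_closed m_closed by blast
  let ?z = "y [^] m" and ?\<phi> = "conj_char c"
  note \<phi> = conj_char[OF d c]
  have \<phi>a: "?\<phi> a = - 1" using \<phi>(3) assms by simp
  have z: "int n dvd 2 * int m" using n2 by simp
  have zC: "?z \<in> centralizer G a"
    using rot_central[OF z aG] aG by (simp add: centralizer_def rot_nat)
  \<comment> \<open>\<open>?z\<close> is an involution, so its value is a sign, and the two signs
    give the two characters of the conclusion.\<close>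
  have "?\<phi> ?z ^ 2 = ?\<phi> (?z [^] (2::nat))"
    by (rule character_pow[OF \<phi>(1) subgroup_centralizer[OF aG] zC, symmetric])
  also have "?z [^] (2::nat) = a [^] (0::nat)"
    using yn n2 by (simp add: nat_pow_pow mult.commute)
  also have "?\<phi> (a [^] (0::nat)) = ?\<phi> a ^ 0"
    by (rule character_pow[OF \<phi>(1) subgroup_centralizer[OF aG]]) (rule centralizer_closed(4)[OF aG])
  finally have "?\<phi> ?z = 1 \<or> ?\<phi> ?z = - 1" by (simp add: power2_eq_1_iff)
  then have "tensor_character G (centralizer G a) a ?z Z2_sgn Z2_sgn ?\<phi> \<or>
      tensor_character G (centralizer G a) a ?z Z2_sgn Z2_triv ?\<phi>"
  proof
    assume "?\<phi> ?z = 1"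
    then show ?thesis
      by (intro disjI2 tensor_characterI aG \<phi>(1) zC \<phi>a) (simp add: Z2_triv_def)
  next
    assume "?\<phi> ?z = - 1"
    then show ?thesis
      by (intro disjI1 tensor_characterI aG \<phi>(1) zC \<phi>a) (simp add: Z2_sgn_def)
  qed
  then have "reflection_pair G a ?z d s \<rho>"
    unfolding reflection_pair_def using \<phi>(2) by blast
  with a show ?thesis by auto
qed

section \<open>The converse for rotations, and negative braidings for reflections\<close>

lemma finite_dim_central_pair:
  assumes n2: "n = 2 * m" and cp: "central_pair G y m d s \<rho>"
  shows "yd_finite_dim_nichols G d s \<rho> g"
proof -
  obtain \<rho>' where \<rho>': "\<rho>' (y [^] m) = - 1\<^sub>m d" "same_pair G d s \<rho> d (y [^] m) \<rho>'"
    using cp by (auto simp: central_pair_def)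
  have m1: "\<rho> s = (-1) \<cdot>\<^sub>m 1\<^sub>m d"
    by (rule same_pair_scalar[OF \<rho>'(2)]) (unfold \<rho>'(1), intro eq_matI, auto)
  obtain c where c: "c \<in> carrier G" "c \<otimes> s \<otimes> inv c = rot (int m)"
    using \<rho>'(2) by (auto simp: same_pair_def rot_nat)
  then have "s = inv c \<otimes> rot (int m) \<otimes> inv (inv c)" using s by (simp add: c(2)[symmetric] m_assoc)
  then have "s \<in> {rot (int m), rot (- int m)}" using conj_rot[of "inv c" "int m"] c by simp
  then obtain j where "s = rot j" by blast
  then show ?thesis using finite_dim_minus_one[OF _ m1] class_rot[of j] by simp
qed

lemma finite_dim_rotation_pair:
  assumes \<chi>: "\<chi> \<in> characters G (generate G {y})" "\<chi> y = \<omega>"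
    and rp: "rotation_pair G y n m \<omega> \<chi> d s \<rho>"
  shows "yd_finite_dim_nichols G d s \<rho> g"
proof -
  obtain h j where hj: "\<omega> ^ (h * j) = - 1"
    and sp: "same_pair G d s \<rho> 1 (y [^] (h::nat)) (char_rep (\<lambda>k. \<chi> k ^ j))"
    using rp by (auto simp: rotation_pair_def)
  have "\<chi> (y [^] h) = \<omega> ^ h"
    unfolding \<chi>(2)[symmetric]
    by (rule character_pow[OF \<chi>(1) generate_is_subgroup]) (auto intro: generate.intros)
  then have "char_rep (\<lambda>k. \<chi> k ^ j) (y [^] h) = (-1) \<cdot>\<^sub>m 1\<^sub>m 1"
    using hj by (intro eq_matI) (auto simp: char_rep_def power_mult)
  from same_pair_scalar[OF sp this] have m1: "\<rho> s = (-1) \<cdot>\<^sub>m 1\<^sub>m d" .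
  obtain c where c: "c \<in> carrier G" "c \<otimes> s \<otimes> inv c = rot (int h)"
    using sp by (auto simp: same_pair_def rot_nat)
  then have "s = inv c \<otimes> rot (int h) \<otimes> inv (inv c)" using s by (simp add: c(2)[symmetric] m_assoc)
  then have "s \<in> {rot (int h), rot (- int h)}" using conj_rot[of "inv c" "int h"] c by simp
  then obtain i where "s = rot i" by blast
  then show ?thesis using finite_dim_minus_one[OF _ m1] class_rot[of i] by simp
qed

text \<open>Commuting reflections differ by a central rotation \<open>w\<close> with
  \<open>w^2 = 1\<close>. The scalars are the values of \<open>\<rho>\<close> at \<open>s w\<close>
  and at \<open>s w^-1\<close>, and their product is the value at the identity.\<close>

lemma negative_braiding_reflection_pair:
  assumes rp: "reflection_pair G (refln i) z d s \<rho>"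
  shows "negative_braiding G d s \<rho> g"
proof -
  \<comment> \<open>Only the value -1 at the reflection is used below, so both characters are
    treated together through \<open>\<beta> 0 = 1\<close>.\<close>
  obtain \<phi> \<beta> where \<phi>: "tensor_character G (centralizer G (refln i)) (refln i) z Z2_sgn \<beta> \<phi>"
    and \<beta>: "\<beta> 0 = 1" and sp: "same_pair G d s \<rho> 1 (refln i) (char_rep \<phi>)"
    using rp by (auto simp: reflection_pair_def Z2_sgn_def Z2_triv_def)
  from \<phi> have "\<phi> (refln i [^] (1::nat) \<otimes> z [^] (0::nat)) = Z2_sgn 1 * \<beta> 0"
    unfolding tensor_character_def by blast
  then have \<phi>i: "\<phi> (refln i) = - 1" by (simp add: Z2_sgn_def \<beta>)
  have d: "d = 1" using sp by (simp add: same_pair_def)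
  have "char_rep \<phi> (refln i) = (-1) \<cdot>\<^sub>m 1\<^sub>m 1"
    by (intro eq_matI) (auto simp: char_rep_def \<phi>i)
  from same_pair_scalar[OF sp this] have m1: "\<rho> s $$ (0, 0) = - 1" by (simp add: d)
  obtain c where c: "c \<in> carrier G" "c \<otimes> s \<otimes> inv c = refln i"
    using sp by (auto simp: same_pair_def)
  then have "s = inv c \<otimes> refln i \<otimes> inv (inv c)" using s by (simp add: c(2)[symmetric] m_assoc)
  then obtain k where sk: "s = refln k" using conj_refl_refl[of "inv c" i] c by auto
  have cls: "\<exists>j. t = refln j" if "t \<in> \<O>" for t
    using that conj_refl_refl sk by (auto simp: conj_class_def)
  define q where "q a b = \<rho> (inv (g b) \<otimes> a \<otimes> g b) $$ (0, 0)" for a b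
  have qq: "q t t = - 1" if "t \<in> \<O>" for t
    using g_conj'[OF that] m1 by (simp add: q_def)
  have braiding: "yd_braiding G d \<rho> g (a, 0) (b, 0) r = (if r = ((b, 0), (a, 0)) then q a b else 0)"
    if ab: "a \<in> \<O>" "b \<in> \<O>" "a \<otimes> b = b \<otimes> a" for a b r
  proof -
    have "a \<otimes> b \<otimes> inv a = b" using ab class_carrier by (simp add: m_assoc)
    then show ?thesis
      by (cases r) (auto simp: yd_braiding_def yd_action_def q_def d split: prod.splits)
  qed
  have q_inv: "q t u * q u t = 1" if tu: "t \<in> \<O>" "u \<in> \<O>" "t \<otimes> u = u \<otimes> t" for t u
  proof -
    obtain a b where ab: "t = refln a" "u = refln b" using cls tu by blast
    have dvd: "int n dvd 2 * (a - b)" "int n dvd 2 * (b - a)"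
    proof -
      have "rot (b - a) = rot (a - b)" using tu(3) by (simp add: ab)
      then have "int n dvd (b - a) - (a - b)" unfolding rot_eq_iff .
      moreover have "(b - a) - (a - b) = 2 * (b - a)" "2 * (a - b) = - (2 * (b - a))" by simp_all
      ultimately show "int n dvd 2 * (a - b)" "int n dvd 2 * (b - a)" by (simp_all only: dvd_minus_iff)
    qed
    \<comment> \<open>The rotation by \<open>l' - l\<close> is central, so it moves past
      \<open>g (refln l)\<close>, and conjugation takes the rest to \<open>s\<close>.\<close>
    have *: "inv (g (refln l)) \<otimes> refln l' \<otimes> g (refln l) = s \<otimes> rot (l' - l)"
      if "refln l \<in> \<O>" "int n dvd 2 * (l' - l)" for l l'
    proof -
      note gl = g_carrier[OF that(1)]
      have "inv (g (refln l)) \<otimes> refln l' \<otimes> g (refln l) =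
          inv (g (refln l)) \<otimes> (refln l \<otimes> rot (l' - l)) \<otimes> g (refln l)" by simp
      also have "\<dots> = inv (g (refln l)) \<otimes> refln l \<otimes> (rot (l' - l) \<otimes> g (refln l))"
        using gl by (simp add: m_assoc del: refl_rot)
      also have "rot (l' - l) \<otimes> g (refln l) = g (refln l) \<otimes> rot (l' - l)"
        using rot_central[OF that(2) gl] by simp
      also have "inv (g (refln l)) \<otimes> refln l \<otimes> (g (refln l) \<otimes> rot (l' - l)) =
          (inv (g (refln l)) \<otimes> refln l \<otimes> g (refln l)) \<otimes> rot (l' - l)"
        using gl by (simp add: m_assoc)
      finally show ?thesis by (simp only: g_conj'[OF that(1)])
    qed
    have "q t u * q u t = \<rho> (s \<otimes> rot (a - b)) $$ (0, 0) * \<rho> (s \<otimes> rot (b - a)) $$ (0, 0)"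
      using *[of b a] *[of a b] tu dvd by (simp add: q_def ab)
    also have "\<dots> = \<rho> ((s \<otimes> rot (a - b)) \<otimes> (s \<otimes> rot (b - a))) $$ (0, 0)"
    proof (rule rep_mult_1[OF d, symmetric])
      show "s \<otimes> rot (a - b) \<in> centralizer G s" "s \<otimes> rot (b - a) \<in> centralizer G s"
        using centralizer_closed(2,4)[OF s] centralizer_refl(1) dvd unfolding sk by blast+
    qed
    also have "(s \<otimes> rot (a - b)) \<otimes> (s \<otimes> rot (b - a)) = rot (2 * (b - a))"
      by (simp add: sk)
    also have "\<dots> = rot 0" unfolding rot_eq_iff using dvd by simp
    finally show ?thesis by (simp add: rep_one d)
  qed
  show ?thesis
    unfolding negative_braiding_def
  proof (intro conjI ballI impI d)
    fix t u assume tu: "t \<in> \<O>" "u \<in> \<O>" "t \<otimes> u = u \<otimes> t"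
    show "\<exists>q :: 'g \<Rightarrow> 'g \<Rightarrow> complex.
         (\<forall>a \<in> {t, u}. \<forall>b \<in> {t, u}. \<forall>r \<in> yd_basis G d s \<times> yd_basis G d s.
            yd_braiding G d \<rho> g (a, 0) (b, 0) r = (if r = ((b, 0), (a, 0)) then q a b else 0)) \<and>
         q t t = -1 \<and> q u u = -1 \<and> (t \<noteq> u \<longrightarrow> q t u * q u t = 1)"
    proof (intro exI[of _ q] conjI ballI impI)
      fix a b r assume "a \<in> {t, u}" "b \<in> {t, u}"
      then have "a \<in> \<O>" "b \<in> \<O>" "a \<otimes> b = b \<otimes> a" using tu by auto
      then show "yd_braiding G d \<rho> g (a, 0) (b, 0) r = (if r = ((b, 0), (a, 0)) then q a b else 0)"
        by (rule braiding)
    qed (use qq q_inv tu in simp_all)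
  qed
qed

end

theorem theorem3p1:
  fixes G :: "('g, 'b) monoid_scheme" and x y s :: 'g and n d :: nat
    and \<omega> :: complex and \<chi> :: "'g \<Rightarrow> complex"
    and \<rho> :: "'g \<Rightarrow> complex mat" and g :: "'g \<Rightarrow> 'g"
  assumes "n \<ge> 3" and "dihedral_group n G x y"
    and "primitive_root_of_unity n \<omega>"
    and "\<chi> \<in> characters G (generate G {y})" and "\<chi> y = \<omega>"
    and "s \<in> carrier G"
    and "irreducible_rep G (centralizer G s) d \<rho>"
    and "class_section G s g"
  shows "(odd n \<longrightarrow>
           centralizer G x = generate G {x} \<and>
           G\<lparr>carrier := centralizer G x\<rparr> \<cong> integer_mod_group 2 \<and>
           (yd_finite_dim_nichols G d s \<rho> g \<longrightarrow> sgn_pair G x d s \<rho>)) \<and>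
         (\<forall>m. n = 2 * m \<longrightarrow>
           klein_direct_sum G (centralizer G x) x (y [^]\<^bsub>G\<^esub> m) \<and>
           klein_direct_sum G (centralizer G (x \<otimes>\<^bsub>G\<^esub> y)) (x \<otimes>\<^bsub>G\<^esub> y) (y [^]\<^bsub>G\<^esub> m) \<and>
           (yd_finite_dim_nichols G d s \<rho> g \<longrightarrow>
              central_pair G y m d s \<rho> \<or>
              rotation_pair G y n m \<omega> \<chi> d s \<rho> \<or>
              reflection_pair G x (y [^]\<^bsub>G\<^esub> m) d s \<rho> \<or>
              reflection_pair G (x \<otimes>\<^bsub>G\<^esub> y) (y [^]\<^bsub>G\<^esub> m) d s \<rho>) \<and>
           (central_pair G y m d s \<rho> \<or> rotation_pair G y n m \<omega> \<chi> d s \<rho> \<longrightarrow>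
              yd_finite_dim_nichols G d s \<rho> g) \<and>
           (reflection_pair G x (y [^]\<^bsub>G\<^esub> m) d s \<rho> \<or>
            reflection_pair G (x \<otimes>\<^bsub>G\<^esub> y) (y [^]\<^bsub>G\<^esub> m) d s \<rho> \<longrightarrow>
              negative_braiding G d s \<rho> g))"
proof -
  interpret dihedral G n x y
    using assms by (auto simp: dihedral_def dihedral_axioms_def dihedral_group_def)
  interpret yd_dihedral G s d \<rho> g n x y
    by unfold_locales (use assms finite_carrier in \<open>auto simp: irreducible_rep_def\<close>)
  \<comment> \<open>For odd \<open>n\<close> both rotation cases are contradictory, since each of
    them produces an \<open>m\<close> with \<open>n = 2 * m\<close>.\<close>
  have classify:
    "(odd n \<longrightarrow> sgn_pair G x d s \<rho>) \<and>
     (\<forall>m. n = 2 * m \<longrightarrow> central_pair G y m d s \<rho> \<or> rotation_pair G y n m \<omega> \<chi> d s \<rho> \<or>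
       reflection_pair G x (y [^]\<^bsub>G\<^esub> m) d s \<rho> \<or> reflection_pair G (x \<otimes>\<^bsub>G\<^esub> y) (y [^]\<^bsub>G\<^esub> m) d s \<rho>)"
    if fd: "yd_finite_dim_nichols G d s \<rho> g"
    using assms(6)
  proof (cases rule: element_cases)
    case (1 k)
    show ?thesis
    proof (cases "int n dvd 2 * k")
      case True
      then show ?thesis using central_case[OF 1 True fd] by auto
    next
      case False
      then show ?thesis using rotation_case[OF 1 False fd assms(3,4,5)] by auto
    qed
  next
    case (2 k)
    note refl = reflection_case[OF 2 fd]
    show ?thesis
      using sgn_pair_reflection[OF 2 _ refl] reflection_pair_reflection[OF 2 _ refl] by blast
  qed
  have odd: "centralizer G x = generate G {x}" "G\<lparr>carrier := centralizer G x\<rparr> \<cong> integer_mod_group 2"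
    if "odd n"
    using centralizer_refl_odd[OF that, of 0] xx generate_involution[of x] involution_iso_Z2[of x]
      one_neq_refl[of 0]
    by (simp_all add: refl_0)
  have klein: "klein_direct_sum G (centralizer G x) x (y [^]\<^bsub>G\<^esub> m)"
    "klein_direct_sum G (centralizer G (x \<otimes>\<^bsub>G\<^esub> y)) (x \<otimes>\<^bsub>G\<^esub> y) (y [^]\<^bsub>G\<^esub> m)" if "n = 2 * m" for m
    using klein_centralizer_refl[OF that, of 0] klein_centralizer_refl[OF that, of 1]
    by (simp_all add: refl_0 refl_1 rot_nat)
  have negative: "negative_braiding G d s \<rho> g"
    if "reflection_pair G x (y [^]\<^bsub>G\<^esub> m) d s \<rho> \<or>
      reflection_pair G (x \<otimes>\<^bsub>G\<^esub> y) (y [^]\<^bsub>G\<^esub> m) d s \<rho>" for m :: nat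
    using that negative_braiding_reflection_pair[of 0 "y [^]\<^bsub>G\<^esub> m"]
      negative_braiding_reflection_pair[of 1 "y [^]\<^bsub>G\<^esub> m"]
    by (auto simp: refl_0 refl_1)
  show ?thesis
    using classify odd klein negative finite_dim_central_pair
      finite_dim_rotation_pair[OF assms(4,5)] by blast
qed

end
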